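(* Let $K:(0,\infty)^2\to[0,\infty)$ be continuous and suppose there are constants $0<c_1\le c_2<\infty$ and real exponents $\gamma,\lambda$ with $-\lambda<1$ and $\gamma+\lambda<1$ such that for all $x,y\in(0,\infty)$ $$c_1\left(x^{\gamma+\lambda}y^{-\lambda}+x^{-\lambda}y^{\gamma+\lambda}\right)\le K(x,y)\le c_2\left(x^{\gamma+\lambda}y^{-\lambda}+x^{-\lambda}y^{\gamma+\lambda}\right).$$ Let $a>0$, let $f_0\in\mathcal{M}_{+,b}((0,\infty))$ have finite first moment and $\operatorname{spt}(f_0)\subset[a,\infty)$, and let $\eta\in\mathcal{M}_{+,b}((0,\infty))$ be a source term with finite first moment and $\operatorname{spt}(\eta)\subset[a,M]$ for some $M<\infty$. Then for every $T>0$ there exists a solution $f\in C([0,T],\mathcal{M}_{+,b}((0,\infty)))$ to the coagulation equation with source $\eta$ and initial data $f_0$.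
   Context: Notation: $\mathbb{R}_*=(0,\infty)$; $\mathcal{M}_{+,b}(\mathbb{R}_* )$ is the set of bounded positive Radon measures on $\mathbb{R}_*$, with the weak* topology (so $f\in C([0,T],\mathcal{M}_{+,b}(\mathbb{R}_* ))$ means $t\mapsto\int\phi\,\mathrm{d}f_t$ is continuous for every $\phi\in C_c(\mathbb{R}_* )$); $\operatorname{spt}$ denotes support; $M_p(\mu)=\int_{\mathbb{R}_*}x^p\mu(\mathrm{d}x)$. Definition. $f\in C([0,T],\mathcal{M}_{+,b}(\mathbb{R}_* ))$ is a solution to the coagulation equation with source $\eta$ (finite first moment, $\operatorname{spt}(\eta)\subset[a,M]$) and initial data $f_0$ (finite first moment, $\operatorname{spt}(f_0)\subset[a,\infty)$) if $\sup_{t\in[0,T]}M_1(f_t)<\infty$, $\int_0^TM_{-\lambda}(f_t)\,\mathrm{d}t<\infty$, $\int_0^TM_{\gamma+\lambda}(f_t)\,\mathrm{d}t<\infty$, $\operatorname{spt}(f_t)\subset[a,\infty)$ for all $t\in[0,T]$, and for every $\phi\in C^1([0,T],C_c(\mathbb{R}_* ))$ and $t\in[0,T]$ $$\int_{\mathbb{R}_*}\phi(t,x)f_t(\mathrm{d}x)-\int_{\mathbb{R}_*}\phi(0,x)f_0(\mathrm{d}x)=\int_0^t\int_{\mathbb{R}_*}\dot\phi(s,x)f_s(\mathrm{d}x)\,\mathrm{d}s$$ $$+\frac12\int_0^t\int_{\mathbb{R}_*}\int_{\mathbb{R}_*}\big(\phi(s,x+y)-\phi(s,x)-\phi(s,y)\big)K(x,y)f_s(\mathrm{d}x)f_s(\mathrm{d}y)\,\mathrm{d}s+\int_0^t\int_{\mathbb{R}_*}\phi(s,x)\eta(\mathrm{d}x)\,\mathrm{d}s,$$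 where $\dot\phi$ is the time derivative. *)

theory Defs
  imports "HOL-Analysis.Analysis"
begin

text \<open>
  The half-line \<open>(0,\<infinity>)\<close> is the set \<^term>\<open>{0<..} :: real set\<close>. Every finite Borel measure on it is
  automatically a Radon measure, so boundedness is the only condition to impose.
\<close>

definition bounded_radon_measures :: "real measure set" where
  "bounded_radon_measures =
     {\<mu>. sets \<mu> = sets (restrict_space borel {0<..}) \<and> finite_measure \<mu>}"

definition measure_support :: "real measure \<Rightarrow> real set" where
  "measure_support \<mu> =
     {x \<in> {0<..}. \<forall>U. open U \<and> x \<in> U \<longrightarrow> 0 < emeasure \<mu> (U \<inter> {0<..})}"

definition moment :: "real \<Rightarrow> real measure \<Rightarrow> ennreal" where
  "moment p \<mu> = (\<integral>\<^sup>+x. ennreal (x powr p) \<partial>\<mu>)"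

text \<open>
  A function in \<open>C\<^sub>c((0,\<infinity>))\<close> is identified with its extension by zero to the real line, which is
  bounded and continuous. The metric of \<^typ>\<open>real \<Rightarrow>\<^sub>C real\<close> is the one of the supremum norm.
\<close>

definition Cc_pos :: "(real \<Rightarrow>\<^sub>C real) set" where
  "Cc_pos = {\<phi> :: real \<Rightarrow>\<^sub>C real. compact (closure {x. \<phi> x \<noteq> 0}) \<and>
     closure {x. \<phi> x \<noteq> 0} \<subseteq> {0<..}}"

definition weak_star_continuous_on :: "real set \<Rightarrow> (real \<Rightarrow> real measure) \<Rightarrow> bool" where
  "weak_star_continuous_on I f \<longleftrightarrow>
     (\<forall>t\<in>I. f t \<in> bounded_radon_measures) \<and>
     (\<forall>\<phi>\<in>Cc_pos. continuous_on I (\<lambda>t. \<integral>x. apply_bcontfun \<phi> x \<partial>f t))"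

text \<open>
  \<open>C1_Cc T \<phi> \<phi>'\<close> says that \<open>\<phi> \<in> C\<^sup>1([0,T], C\<^sub>c((0,\<infinity>)))\<close> with time derivative \<open>\<phi>'\<close>, where
  \<open>C\<^sub>c((0,\<infinity>))\<close> carries the supremum norm. No compact set containing the supports of all
  \<open>\<phi>(t,\<cdot>)\<close> is required; so this class also contains every path that is continuously
  differentiable for the inductive limit topology.
\<close>

definition C1_Cc :: "real \<Rightarrow> (real \<Rightarrow> real \<Rightarrow>\<^sub>C real) \<Rightarrow> (real \<Rightarrow> real \<Rightarrow>\<^sub>C real) \<Rightarrow> bool" where
  "C1_Cc T \<phi> \<phi>' \<longleftrightarrow>
     (\<forall>t\<in>{0..T}. \<phi> t \<in> Cc_pos \<and> \<phi>' t \<in> Cc_pos \<and>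
        (\<phi> has_vector_derivative \<phi>' t) (at t within {0..T})) \<and>
     continuous_on {0..T} \<phi>'"

text \<open>
  The equation at \<open>t = 0\<close> forces \<open>f 0 = f0\<close>. For a kernel bounded above by a multiple of
  \<open>x\<^sup>\<gamma>\<^sup>+\<^sup>l y\<^sup>-\<^sup>l + x\<^sup>-\<^sup>l y\<^sup>\<gamma>\<^sup>+\<^sup>l\<close> with \<open>\<gamma> + l < 1\<close> and \<open>-l < 1\<close>, the support condition and the bound on
  the first moment make all the integrals below absolutely convergent, so that none of them takes
  the default value of the Bochner integral. The exponent \<open>l\<close> is usually written \<open>\<lambda>\<close>.
\<close>

definition coagulation_solution ::
  "(real \<Rightarrow> real \<Rightarrow> real) \<Rightarrow> real \<Rightarrow> real \<Rightarrow> real \<Rightarrow> real \<Rightarrow> real measure \<Rightarrow> real measure \<Rightarrow>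
   (real \<Rightarrow> real measure) \<Rightarrow> bool" where
  "coagulation_solution K \<gamma> l a T \<eta> f0 f \<longleftrightarrow>
     weak_star_continuous_on {0..T} f \<and>
     (SUP t\<in>{0..T}. moment 1 (f t)) < \<infinity> \<and>
     (\<integral>\<^sup>+t\<in>{0..T}. moment (- l) (f t) \<partial>lborel) < \<infinity> \<and>
     (\<integral>\<^sup>+t\<in>{0..T}. moment (\<gamma> + l) (f t) \<partial>lborel) < \<infinity> \<and>
     (\<forall>t\<in>{0..T}. measure_support (f t) \<subseteq> {a..}) \<and>
     (\<forall>(\<phi> :: real \<Rightarrow> real \<Rightarrow>\<^sub>C real) (\<phi>' :: real \<Rightarrow> real \<Rightarrow>\<^sub>C real).
        C1_Cc T \<phi> \<phi>' \<longrightarrow> (\<forall>t\<in>{0..T}.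
        (\<integral>x. \<phi> t x \<partial>f t) - (\<integral>x. \<phi> 0 x \<partial>f0) =
          (LINT s:{0..t}|lborel. (\<integral>x. \<phi>' s x \<partial>f s))
          + 1 / 2 * (LINT s:{0..t}|lborel.
              (\<integral>y. (\<integral>x. (\<phi> s (x + y) - \<phi> s x - \<phi> s y) * K x y \<partial>f s) \<partial>f s))
          + (LINT s:{0..t}|lborel. (\<integral>x. \<phi> s x \<partial>\<eta>))))"

end

theory Submission
  imports Defs "HOL-Probability.Helly_Selection"
begin

text \<open>
  On \<open>[a,\<infinity>)\<close> both exponents of the kernel may be replaced by some \<open>p < 1\<close>, so that for every
  \<open>\<epsilon> > 0\<close> the kernel is at most \<open>R + \<epsilon> (1 + x) (1 + y)\<close>. Explicit Euler steps with the
  kernel cut off at height \<open>n\<close> and a step size of order \<open>1/n\<close> preserve positivity and the lower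
  bound \<open>a\<close> of the support, and increase \<open>\<integral> (1 + x)\<close> at most by the contribution of the source.
  Since this bounds the collision rate \<open>\<integral>\<integral> K\<close> uniformly in \<open>n\<close>, the approximations are
  equi-Lipschitz in total variation, and the sublinearity of the kernel makes their rates of change
  equicontinuous in time. Helly's theorem at rational times and a diagonal argument give a weak limit,
  whose integrals against a fixed bounded continuous function are continuously differentiable with
  the required derivative; mass may escape to infinity in the limit, but nothing of the collision
  rate does, again by sublinearity. Time-dependent test functions are then treated by the product
  rule and the fundamental theorem of calculus.
\<close>

subsection \<open>Sums of measures\<close>

text \<open>The obstacle is that weak convergence only tests with bounded continuous functions,
  while the kernel is unbounded and nothing beyond the first moment is controlled. What rescues the
  limit is that \<open>(1 + x) (1 + y)\<close> has the square of one weighted mass as its double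
  integral: the part of the kernel above a height \<open>R\<close> then contributes at most a fixed
  multiple of \<open>\<epsilon>\<close>, uniformly over all approximations, and the bounded part is
  accessible to total variation estimates and weak convergence. The cutoff at height
  \<open>n\<close> has a different purpose, positivity: the loss rate of a particle may grow with
  its size, so without a cutoff no step size would suit all particles at once. Measures and kernel
  are moved to the whole line by \<open>x \<mapsto> max a x\<close>, which makes the kernel
  continuous on the plane and brings the setting to that of Helly's and Skorohod's theorems. The
  difference quotients of the limit are estimated uniformly over pairs of times, in either order;
  this yields the continuity in time of the collision integral, on which the fundamental theorem of
  calculus relies.\<close>

definition add_measure :: "'a measure \<Rightarrow> 'a measure \<Rightarrow> 'a measure" where
  "add_measure M N = measure_of (space M) (sets M) (\<lambda>A. emeasure M A + emeasure N A)"

lemma sets_add_measure [simp, measurable_cong]: "sets (add_measure M N) = sets M"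
  unfolding add_measure_def by simp

lemma space_add_measure [simp]: "space (add_measure M N) = space M"
  unfolding add_measure_def by simp

lemma emeasure_add_measure:
  assumes "sets N = sets M" "A \<in> sets M"
  shows "emeasure (add_measure M N) A = emeasure M A + emeasure N A"
  unfolding add_measure_def
proof (rule emeasure_measure_of_sigma)
  show "sigma_algebra (space M) (sets M)" ..
  show "positive (sets M) (\<lambda>A. emeasure M A + emeasure N A)" by (simp add: positive_def)
  show "countably_additive (sets M) (\<lambda>A. emeasure M A + emeasure N A)"
  proof (rule countably_additiveI)
    fix F :: "nat \<Rightarrow> _" assume F: "range F \<subseteq> sets M" "disjoint_family F" "(\<Union>i. F i) \<in> sets M"
    have "(\<Sum>i. emeasure M (F i) + emeasure N (F i)) = (\<Sum>i. emeasure M (F i)) + (\<Sum>i. emeasure N (F i))"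
      by (simp add: suminf_add)
    then show "(\<Sum>i. emeasure M (F i) + emeasure N (F i)) = emeasure M (\<Union>i. F i) + emeasure N (\<Union>i. F i)"
      using F assms(1) by (simp add: suminf_emeasure)
  qed
qed (fact assms)

lemma nn_integral_add_measure:
  assumes N: "sets N = sets M" and f: "f \<in> borel_measurable M"
  shows "(\<integral>\<^sup>+x. f x \<partial>add_measure M N) = (\<integral>\<^sup>+x. f x \<partial>M) + (\<integral>\<^sup>+x. f x \<partial>N)"
  using f
proof induction
  case (cong f g)
  then show ?case
    using nn_integral_cong[of "add_measure M N" f g] nn_integral_cong[of M f g] nn_integral_cong[of N f g]
      sets_eq_imp_space_eq[OF N] by simp
next
  case (set A)
  then show ?case using N by (simp add: emeasure_add_measure)
next
  case (mult u c)
  note [measurable_cong] = N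
  have [measurable]: "u \<in> borel_measurable M" "u \<in> borel_measurable N" "u \<in> borel_measurable (add_measure M N)"
    using mult(2) measurable_cong_sets[OF N] by auto
  show ?case using mult by (simp add: nn_integral_cmult distrib_left)
next
  case (add u v)
  note [measurable_cong] = N
  have [measurable]: "u \<in> borel_measurable N" "u \<in> borel_measurable (add_measure M N)" "u \<in> borel_measurable M"
    "v \<in> borel_measurable N" "v \<in> borel_measurable (add_measure M N)" "v \<in> borel_measurable M"
    using add N by (auto simp: measurable_cong_sets[OF N])
  show ?case using add by (simp add: nn_integral_add algebra_simps)
next
  case (seq U)
  note [measurable_cong] = N
  have [measurable]: "U i \<in> borel_measurable N" "U i \<in> borel_measurable (add_measure M N)" "U i \<in> borel_measurable M" for i
    using seq N by (auto simp: measurable_cong_sets[OF N])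
  \<comment> \<open>Monotonicity is what allows the supremum of the sums to split into a sum of
    suprema.\<close>
  have "incseq (\<lambda>i. integral\<^sup>N M (U i))" "incseq (\<lambda>i. integral\<^sup>N N (U i))"
    using \<open>incseq U\<close> by (auto simp: incseq_def le_fun_def intro!: nn_integral_mono)
  then show ?case
    using seq by (simp add: image_comp nn_integral_monotone_convergence_SUP SUP_apply ennreal_SUP_add)
qed

lemma
  fixes f :: "'a \<Rightarrow> real"
  assumes N: "sets N = sets M" and f: "integrable M f" "integrable N f"
  shows integrable_add_measure: "integrable (add_measure M N) f"
    and integral_add_measure: "(\<integral>x. f x \<partial>add_measure M N) = (\<integral>x. f x \<partial>M) + (\<integral>x. f x \<partial>N)"
proof -
  have [measurable]: "f \<in> borel_measurable M" "f \<in> borel_measurable N" using f by auto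
  have m: "f \<in> borel_measurable (add_measure M N)" 
    using f(1) measurable_cong_sets[OF sets_add_measure] by blast
  \<comment> \<open>One identity serves three choices of \<open>g\<close>: \<open>norm\<close> for
    integrability, and \<open>\<lambda>x. x\<close> and \<open>\<lambda>x. - x\<close> for the
    positive and negative parts, as \<open>ennreal\<close> sends negative numbers to
    \<open>0\<close>.\<close>
  have eq: "(\<integral>\<^sup>+x. ennreal (g (f x)) \<partial>add_measure M N) = (\<integral>\<^sup>+x. ennreal (g (f x)) \<partial>M) + (\<integral>\<^sup>+x. ennreal (g (f x)) \<partial>N)"
    if [measurable]: "g \<in> borel_measurable borel" for g
    by (rule nn_integral_add_measure[OF N]) measurable
  show i: "integrable (add_measure M N) f"
    using f m eq[of norm] by (simp add: integrable_iff_bounded)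
  have fin: "(\<integral>\<^sup>+x. ennreal (f x) \<partial>M) \<noteq> \<infinity>" "(\<integral>\<^sup>+x. ennreal (f x) \<partial>N) \<noteq> \<infinity>"
    "(\<integral>\<^sup>+x. ennreal (- f x) \<partial>M) \<noteq> \<infinity>" "(\<integral>\<^sup>+x. ennreal (- f x) \<partial>N) \<noteq> \<infinity>"
    using f by (auto simp: real_integrable_def)
  show "(\<integral>x. f x \<partial>add_measure M N) = (\<integral>x. f x \<partial>M) + (\<integral>x. f x \<partial>N)"
    using fin eq[of "\<lambda>x. x"] eq[of "\<lambda>x. - x"]
    by (simp add: real_lebesgue_integral_def[OF i] real_lebesgue_integral_def[OF f(1)]
        real_lebesgue_integral_def[OF f(2)] enn2real_plus less_top)
qed

subsection \<open>Measures with finite first moment and the Euler step\<close>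

text \<open>The weight \<open>1 + \<bar>x\<bar>\<close> bounds total mass and first moment by one
  number. It is subadditive, so merging does not increase its integral, and its value at a sum is at
  most the product of its values, which fits the product weight in the growth of the kernel.\<close>

definition moment_le :: "real \<Rightarrow> real measure \<Rightarrow> bool" where
  "moment_le B u \<longleftrightarrow> sets u = sets borel \<and> finite_measure u \<and>
     integrable u (\<lambda>x. 1 + \<bar>x\<bar>) \<and> (\<integral>x. 1 + \<bar>x\<bar> \<partial>u) \<le> B"

lemma moment_leD:
  assumes "moment_le B u"
  shows "sets u = sets borel" "finite_measure u" "space u = UNIV"
    "integrable u (\<lambda>x. 1 + \<bar>x\<bar>)" "(\<integral>x. 1 + \<bar>x\<bar> \<partial>u) \<le> B" "0 \<le> B"
proof -
  show "sets u = sets borel" "finite_measure u" "integrable u (\<lambda>x. 1 + \<bar>x\<bar>)" "(\<integral>x. 1 + \<bar>x\<bar> \<partial>u) \<le> B"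
    using assms by (auto simp: moment_le_def)
  then show "space u = UNIV" using sets_eq_imp_space_eq[of u borel] by simp
  have "0 \<le> (\<integral>x. 1 + \<bar>x\<bar> \<partial>u)" by (rule integral_nonneg_AE) auto
  then show "0 \<le> B" using \<open>(\<integral>x. 1 + \<bar>x\<bar> \<partial>u) \<le> B\<close> by (rule order_trans)
qed

lemma moment_le_integral:
  assumes u: "moment_le B u" and g: "g \<in> borel_measurable borel" and C: "\<And>x. \<bar>g x :: real\<bar> \<le> C * (1 + \<bar>x\<bar>)"
  shows "integrable u g" "\<bar>\<integral>x. g x \<partial>u\<bar> \<le> C * B"
proof -
  note D = moment_leD[OF u]
  have m: "g \<in> borel_measurable u" using g by (simp add: measurable_cong_sets[OF D(1) refl])
  show i: "integrable u g"
    by (rule Bochner_Integration.integrable_bound[OF integrable_mult_right[OF D(4), of C] m])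
       (use C in \<open>auto intro!: AE_I2 intro: order_trans[OF _ abs_ge_self]\<close>)
  have C0: "0 \<le> C" using C[of 0] by simp
  have "\<bar>\<integral>x. g x \<partial>u\<bar> \<le> (\<integral>x. C * (1 + \<bar>x\<bar>) \<partial>u)"
    using Bochner_Integration.integral_norm_bound_integral[OF i integrable_mult_right[OF D(4), of C]] C by simp
  also have "\<dots> \<le> C * B" using D(5) C0 by (simp add: mult_left_mono)
  finally show "\<bar>\<integral>x. g x \<partial>u\<bar> \<le> C * B" .
qed

lemma moment_le_integral_bounded:
  assumes u: "moment_le B u" and g: "g \<in> borel_measurable borel" and C: "\<And>x. \<bar>g x :: real\<bar> \<le> C"
  shows "integrable u g" "\<bar>\<integral>x. g x \<partial>u\<bar> \<le> C * B"
proof -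
  have "\<bar>g x\<bar> \<le> C * (1 + \<bar>x\<bar>)" for x
    using C[of x] mult_left_mono[of 1 "1 + \<bar>x\<bar>" C] abs_ge_zero[of "g x"] by linarith
  from moment_le_integral[OF u g this] show "integrable u g" "\<bar>\<integral>x. g x \<partial>u\<bar> \<le> C * B" by auto
qed

lemma moment_le_measure:
  assumes u: "moment_le B u"
  shows "measure u UNIV \<le> B"
proof -
  have "\<bar>\<integral>x. 1 \<partial>u\<bar> \<le> 1 * B"
    by (rule moment_le_integral_bounded(2)[OF u]) auto
  then show ?thesis by (simp add: moment_leD(3)[OF u])
qed

section \<open>Integrals over product measures\<close>

lemma integral_pair_product:
  fixes f g :: "'a \<Rightarrow> real"
  assumes "finite_measure u" "finite_measure v" and f: "integrable u f" and g: "integrable v g"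
  shows "integrable (u \<Otimes>\<^sub>M v) (\<lambda>z. f (fst z) * g (snd z))"
    and "(\<integral>z. f (fst z) * g (snd z) \<partial>(u \<Otimes>\<^sub>M v)) = (\<integral>x. f x \<partial>u) * (\<integral>x. g x \<partial>v)"
proof -
  interpret u: finite_measure u by fact
  interpret v: finite_measure v by fact
  interpret pair_sigma_finite u v ..
  have [measurable]: "f \<in> borel_measurable u" "g \<in> borel_measurable v" using f g by auto
  show i: "integrable (u \<Otimes>\<^sub>M v) (\<lambda>z. f (fst z) * g (snd z))"
  proof (rule Fubini_integrable)
    have "(\<lambda>x. \<integral>y. norm (f (fst (x, y)) * g (snd (x, y))) \<partial>v) = (\<lambda>x. \<bar>f x\<bar> * (\<integral>y. \<bar>g y\<bar> \<partial>v))"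
      by (simp add: abs_mult)
    then show "integrable u (\<lambda>x. \<integral>y. norm (f (fst (x, y)) * g (snd (x, y))) \<partial>v)"
      using f by simp
    show "AE x in u. integrable v (\<lambda>y. f (fst (x, y)) * g (snd (x, y)))"
      using g by simp
  qed measurable
  show "(\<integral>z. f (fst z) * g (snd z) \<partial>(u \<Otimes>\<^sub>M v)) = (\<integral>x. f x \<partial>u) * (\<integral>x. g x \<partial>v)"
    using integral_fst'[OF i] by simp
qed

text \<open>The dominating weight factorizes, so its integral is the product of two weighted masses.
  First moments thus control pair interactions of this growth.\<close>

lemma moment_le_pair:
  fixes H :: "real \<times> real \<Rightarrow> real"
  assumes u: "moment_le B u" and v: "moment_le B v"
    and H: "H \<in> borel_measurable borel"
    and C: "\<And>x y. \<bar>H (x, y)\<bar> \<le> C * ((1 + \<bar>x\<bar>) * (1 + \<bar>y\<bar>))"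
  shows "integrable (u \<Otimes>\<^sub>M v) H" "\<bar>\<integral>z. H z \<partial>(u \<Otimes>\<^sub>M v)\<bar> \<le> C * B\<^sup>2"
proof -
  note D = moment_leD[OF u] and D' = moment_leD[OF v]
  have "sets (u \<Otimes>\<^sub>M v) = sets (borel :: (real \<times> real) measure)"
    unfolding sets_pair_measure_cong[OF D(1) D'(1)] borel_prod ..
  then have m: "H \<in> borel_measurable (u \<Otimes>\<^sub>M v)"
    using H measurable_cong_sets by blast
  note p = integral_pair_product[OF D(2) D'(2) D(4) D'(4)]
  have bd: "norm (H z) \<le> C * ((1 + \<bar>fst z\<bar>) * (1 + \<bar>snd z\<bar>))" for z
    using C[of "fst z" "snd z"] by simp
  show i: "integrable (u \<Otimes>\<^sub>M v) H"
    by (rule Bochner_Integration.integrable_bound[OF integrable_mult_right[OF p(1), of C] m])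
       (intro AE_I2 order_trans[OF bd], simp)
  have C0: "0 \<le> C" using C[of 0 0] by simp
  have "\<bar>\<integral>z. H z \<partial>(u \<Otimes>\<^sub>M v)\<bar> \<le> (\<integral>z. C * ((1 + \<bar>fst z\<bar>) * (1 + \<bar>snd z\<bar>)) \<partial>(u \<Otimes>\<^sub>M v))"
    using Bochner_Integration.integral_norm_bound_integral[OF i integrable_mult_right[OF p(1), of C]] bd by simp
  also have "\<dots> = C * ((\<integral>x. 1 + \<bar>x\<bar> \<partial>u) * (\<integral>x. 1 + \<bar>x\<bar> \<partial>v))" using p(2) by simp
  also have "\<dots> \<le> C * B\<^sup>2"
    unfolding power2_eq_square
    by (intro mult_left_mono mult_mono C0 D D') (auto intro!: integral_nonneg_AE D)
  finally show "\<bar>\<integral>z. H z \<partial>(u \<Otimes>\<^sub>M v)\<bar> \<le> C * B\<^sup>2" .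
qed

text \<open>The weak form of the collision operator, written as a single integral over the product
  measure so that Fubini, exchange of variables and weak convergence of products apply to
  it.\<close>

definition coag_form :: "(real \<Rightarrow> real \<Rightarrow> real) \<Rightarrow> real measure \<Rightarrow> (real \<Rightarrow> real) \<Rightarrow> real" where
  "coag_form \<kappa> u g =
     1/2 * (\<integral>z. (g (fst z + snd z) - g (fst z) - g (snd z)) * \<kappa> (fst z) (snd z) \<partial>(u \<Otimes>\<^sub>M u))"

text \<open>The coercion to extended nonnegative reals cuts a negative survival factor off at \<open>0\<close>, so this is an
  Euler step of the equation only if \<open>h\<close> times the loss rate is at most \<open>1\<close>.\<close>

definition euler_step :: "(real \<Rightarrow> real \<Rightarrow> real) \<Rightarrow> real \<Rightarrow> real measure \<Rightarrow> real measure \<Rightarrow> real measure" where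
  "euler_step \<kappa> h \<eta> u =
     add_measure (density u (\<lambda>x. ennreal (1 - h * (\<integral>y. \<kappa> x y \<partial>u))))
      (add_measure
        (distr (density (u \<Otimes>\<^sub>M u) (\<lambda>z. ennreal (h / 2 * \<kappa> (fst z) (snd z)))) borel (\<lambda>z. fst z + snd z))
        (density \<eta> (\<lambda>_. ennreal h)))"

section \<open>The Euler step tested against functions\<close>

lemma weight_add_le: "1 + \<bar>x + y\<bar> \<le> (1 + \<bar>x\<bar>) * (1 + \<bar>y :: real\<bar>)"
proof -
  have "0 \<le> \<bar>x\<bar> * \<bar>y\<bar>" by simp
  moreover have "(1 + \<bar>x\<bar>) * (1 + \<bar>y\<bar>) = 1 + \<bar>x\<bar> + \<bar>y\<bar> + \<bar>x\<bar> * \<bar>y\<bar>" by (simp only: distrib_left distrib_right mult_1_left mult_1_right)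
  ultimately show ?thesis using abs_triangle_ineq[of x y] by linarith
qed

lemma weight_le: "1 + \<bar>x\<bar> \<le> (1 + \<bar>x\<bar>) * (1 + \<bar>y :: real\<bar>)" "1 + \<bar>y\<bar> \<le> (1 + \<bar>x\<bar>) * (1 + \<bar>y :: real\<bar>)"
  using mult_left_mono[of 1 "1 + \<bar>y\<bar>" "1 + \<bar>x\<bar>"] mult_right_mono[of 1 "1 + \<bar>x\<bar>" "1 + \<bar>y\<bar>"] by simp_all

lemma euler_step_integral:
  fixes \<kappa> :: "real \<Rightarrow> real \<Rightarrow> real" and g :: "real \<Rightarrow> real"
  assumes u: "moment_le B u" and \<eta>: "moment_le B' \<eta>"
    and \<kappa>[measurable]: "(\<lambda>z. \<kappa> (fst z) (snd z)) \<in> borel_measurable borel"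
    and sym: "\<And>x y. \<kappa> x y = \<kappa> y x" and \<kappa>0: "\<And>x y. 0 \<le> \<kappa> x y" and \<kappa>n: "\<And>x y. \<kappa> x y \<le> n"
    and h: "0 \<le> h" "h * n * B \<le> 1"
    and g[measurable]: "g \<in> borel_measurable borel" and C: "\<And>x. \<bar>g x\<bar> \<le> C * (1 + \<bar>x\<bar>)"
  shows "integrable (euler_step \<kappa> h \<eta> u) g"
    and "(\<integral>x. g x \<partial>euler_step \<kappa> h \<eta> u) = (\<integral>x. g x \<partial>u) + h * (coag_form \<kappa> u g + (\<integral>x. g x \<partial>\<eta>))"
proof -
  note D = moment_leD[OF u] and D' = moment_leD[OF \<eta>]
  interpret u: finite_measure u by fact
  interpret pair_sigma_finite u u ..
  note [measurable_cong] = D(1) D'(1)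
  have su: "sets (u \<Otimes>\<^sub>M u) = sets (borel :: (real \<times> real) measure)"
    unfolding sets_pair_measure_cong[OF D(1) D(1)] borel_prod ..
  have \<kappa>m[measurable]: "(\<lambda>z. \<kappa> (fst z) (snd z)) \<in> borel_measurable (u \<Otimes>\<^sub>M u)"
    "case_prod \<kappa> \<in> borel_measurable (u \<Otimes>\<^sub>M u)"
    using \<kappa> unfolding case_prod_beta' measurable_cong_sets[OF su refl] by auto
  define L where "L x = (\<integral>y. \<kappa> x y \<partial>u)" for x
  have [measurable]: "L \<in> borel_measurable u" unfolding L_def by measurable
  have C0: "0 \<le> C" using C[of 0] by simp
  have n0: "0 \<le> n" using \<kappa>0 \<kappa>n by (meson order_trans)
  have \<kappa>x[measurable]: "\<kappa> x \<in> borel_measurable borel" for x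
    using measurable_compose[OF _ \<kappa>, of "\<lambda>y. (x, y)" borel] by (simp add: borel_prod[symmetric])
  have L0: "0 \<le> L x" for x unfolding L_def by (rule integral_nonneg_AE) (simp add: \<kappa>0)
  have Ln: "L x \<le> n * B" for x
    using moment_le_integral_bounded(2)[OF u \<kappa>x, of x n] \<kappa>0 \<kappa>n
    unfolding L_def by auto
  \<comment> \<open>Here the step-size condition enters: the survival factor lies between
    \<open>0\<close> and \<open>1\<close>, so its coercion to \<open>ennreal\<close> cuts nothing
    off.\<close>
  have hL: "0 \<le> 1 - h * L x" "1 - h * L x \<le> 1" for x
    using mult_left_mono[OF Ln[of x] h(1)] h L0[of x] by (auto simp: mult.assoc)
  have gi: "integrable u g" "integrable \<eta> g"
    using moment_le_integral(1)[OF u g C] moment_le_integral(1)[OF \<eta> g C] by auto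
  \<comment> \<open>\<open>r\<close> stands for the merged particle or one of its constituents, so
    this gives all three integrabilities; the growth of \<open>g\<close> is absorbed by the product
    weight and \<open>\<kappa>\<close> by its height \<open>n\<close>.\<close>
  have bd: "\<bar>g r * \<kappa> x y\<bar> \<le> C * n * ((1 + \<bar>x\<bar>) * (1 + \<bar>y\<bar>))" if "r \<in> {x, y, x + y}" for r x y
  proof -
    have "\<bar>g r\<bar> \<le> C * ((1 + \<bar>x\<bar>) * (1 + \<bar>y\<bar>))"
      using order_trans[OF C mult_left_mono[OF _ C0]] that weight_add_le[of x y] weight_le(1)[of x y] weight_le(2)[of y x] by auto
    then have "\<bar>g r\<bar> * \<bar>\<kappa> x y\<bar> \<le> (C * ((1 + \<bar>x\<bar>) * (1 + \<bar>y\<bar>))) * n"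
      by (intro mult_mono) (use C0 \<kappa>0[of x y] \<kappa>n[of x y] in auto)
    then show ?thesis by (simp add: abs_mult mult_ac)
  qed
  have I1: "integrable (u \<Otimes>\<^sub>M u) (\<lambda>z. g (fst z) * \<kappa> (fst z) (snd z))"
    by (rule moment_le_pair(1)[OF u u, where C = "C * n"]) (use bd in \<open>auto simp: borel_prod[symmetric]\<close>, measurable)
  have I2: "integrable (u \<Otimes>\<^sub>M u) (\<lambda>z. g (snd z) * \<kappa> (fst z) (snd z))"
    by (rule moment_le_pair(1)[OF u u, where C = "C * n"]) (use bd in \<open>auto simp: borel_prod[symmetric]\<close>, measurable)
  have I3: "integrable (u \<Otimes>\<^sub>M u) (\<lambda>z. g (fst z + snd z) * \<kappa> (fst z) (snd z))"
    by (rule moment_le_pair(1)[OF u u, where C = "C * n"]) (use bd in \<open>auto simp: borel_prod[symmetric]\<close>, measurable)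
  \<comment> \<open>By symmetry the losses at the two coordinates agree; with the factor
    \<open>1/2\<close> of the form they add up to the single loss integral of
    \<open>g x * L x\<close>.\<close>
  have eq12: "(\<integral>z. g (snd z) * \<kappa> (fst z) (snd z) \<partial>(u \<Otimes>\<^sub>M u)) = (\<integral>z. g (fst z) * \<kappa> (fst z) (snd z) \<partial>(u \<Otimes>\<^sub>M u))"
    using integral_product_swap[OF borel_measurable_integrable[OF I1]] sym
    by (simp add: case_prod_beta')
  have eqL: "(\<integral>x. g x * L x \<partial>u) = (\<integral>z. g (fst z) * \<kappa> (fst z) (snd z) \<partial>(u \<Otimes>\<^sub>M u))"
    using integral_fst'[OF I1] by (simp add: L_def)
  have iL: "integrable u (\<lambda>x. g x * L x)"
    using integrable_fst'[OF I1] by (simp add: L_def)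
  let ?M1 = "density u (\<lambda>x. ennreal (1 - h * L x))"
  let ?M2 = "distr (density (u \<Otimes>\<^sub>M u) (\<lambda>z. ennreal (h / 2 * \<kappa> (fst z) (snd z)))) borel (\<lambda>z. fst z + snd z)"
  let ?M3 = "density \<eta> (\<lambda>_. ennreal h)"
  have m1: "(\<lambda>x. 1 - h * L x) \<in> borel_measurable u" "AE x in u. 0 \<le> 1 - h * L x" using hL by auto
  have m2: "(\<lambda>z. h / 2 * \<kappa> (fst z) (snd z)) \<in> borel_measurable (u \<Otimes>\<^sub>M u)"
    "AE z in u \<Otimes>\<^sub>M u. 0 \<le> h / 2 * \<kappa> (fst z) (snd z)" using \<kappa>0 h by auto
  have gu: "g \<in> borel_measurable u" "g \<in> borel_measurable \<eta>" by auto
  have T2: "(\<lambda>z. fst z + snd z) \<in> measurable (density (u \<Otimes>\<^sub>M u) (\<lambda>z. ennreal (h / 2 * \<kappa> (fst z) (snd z)))) borel"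
    by simp
  have g2: "(\<lambda>z. g (fst z + snd z)) \<in> borel_measurable (u \<Otimes>\<^sub>M u)" by simp
  have A1: "integrable ?M1 g" "(\<integral>x. g x \<partial>?M1) = (\<integral>x. g x \<partial>u) - h * (\<integral>x. g x * L x \<partial>u)"
    unfolding integrable_real_density[OF m1 gu(1)] integral_real_density[OF m1 gu(1)]
    using gi(1) iL by (auto simp: algebra_simps intro!: Bochner_Integration.integrable_diff)
  have e2: "(\<lambda>z. h / 2 * \<kappa> (fst z) (snd z) * g (fst z + snd z)) = (\<lambda>z. h / 2 * (g (fst z + snd z) * \<kappa> (fst z) (snd z)))"
    by (simp add: mult_ac)
  have A2: "integrable ?M2 g" "(\<integral>x. g x \<partial>?M2) = h / 2 * (\<integral>z. g (fst z + snd z) * \<kappa> (fst z) (snd z) \<partial>(u \<Otimes>\<^sub>M u))"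
    unfolding integrable_distr_eq[OF T2 g] integral_distr[OF T2 g]
      integrable_real_density[OF m2 g2] integral_real_density[OF m2 g2]
    unfolding e2 using I3 by (simp_all only: integrable_mult_right integral_mult_right_zero)
  have A3: "integrable ?M3 g" "(\<integral>x. g x \<partial>?M3) = h * (\<integral>x. g x \<partial>\<eta>)"
    using gi h by (auto simp: integrable_real_density integral_real_density)
  have s: "sets (add_measure ?M2 ?M3) = sets ?M1" "sets ?M3 = sets ?M2" using D D' by auto
  note B = integrable_add_measure[OF s(2) A2(1) A3(1)] integral_add_measure[OF s(2) A2(1) A3(1)]
  have st: "euler_step \<kappa> h \<eta> u = add_measure ?M1 (add_measure ?M2 ?M3)"
    unfolding euler_step_def L_def ..
  show "integrable (euler_step \<kappa> h \<eta> u) g"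
    unfolding st by (rule integrable_add_measure[OF s(1) A1(1) B(1)])
  have cf: "coag_form \<kappa> u g = 1/2 * (\<integral>z. g (fst z + snd z) * \<kappa> (fst z) (snd z) \<partial>(u \<Otimes>\<^sub>M u)) - (\<integral>x. g x * L x \<partial>u)"
    unfolding coag_form_def left_diff_distrib eqL using I1 I2 I3 eq12 by simp
  show "(\<integral>x. g x \<partial>euler_step \<kappa> h \<eta> u) = (\<integral>x. g x \<partial>u) + h * (coag_form \<kappa> u g + (\<integral>x. g x \<partial>\<eta>))"
    unfolding st integral_add_measure[OF s(1) A1(1) B(1)] B(2) A1(2) A2(2) A3(2) cf
    by (simp add: algebra_simps)
qed

subsection \<open>Sublinear kernels\<close>

text \<open>\<open>growth\<close> substitutes for boundedness: the excess of \<open>k\<close> over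
  the height \<open>R\<close> has a collision integral of order \<open>e * B\<^sup>2\<close> for
  every measure with moment bound \<open>B\<close>, so limits can be taken with
  \<open>min k R\<close> first and \<open>e\<close> made small afterwards.\<close>

locale sublinear_kernel =
  fixes k :: "real \<Rightarrow> real \<Rightarrow> real"
  assumes cont: "continuous_on UNIV (\<lambda>z. k (fst z) (snd z))"
    and sym: "\<And>x y. k x y = k y x"
    and nonneg: "\<And>x y. 0 \<le> k x y"
    and growth: "\<And>e. 0 < e \<Longrightarrow> \<exists>R\<ge>0. \<forall>x y. k x y \<le> R + e * ((1 + \<bar>x\<bar>) * (1 + \<bar>y\<bar>))"
begin

text \<open>Covers \<open>k\<close> and all its cutoffs at once, so that \<open>R\<close> and
  \<open>e\<close> in the estimates below do not depend on the cutoff height.\<close>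

definition dominated :: "(real \<Rightarrow> real \<Rightarrow> real) \<Rightarrow> bool" where
  "dominated \<kappa> \<longleftrightarrow> (\<lambda>z. \<kappa> (fst z) (snd z)) \<in> borel_measurable borel \<and> (\<forall>x y. 0 \<le> \<kappa> x y \<and> \<kappa> x y \<le> k x y)"

lemma dominated_self: "dominated k"
  unfolding dominated_def using nonneg borel_measurable_continuous_onI[OF cont] by auto

lemma dominated_min: "0 \<le> n \<Longrightarrow> dominated (\<lambda>x y. min (k x y) n)"
  using dominated_self nonneg unfolding dominated_def by auto

lemma linear_growth: "\<exists>D\<ge>0. \<forall>x y. k x y \<le> D * ((1 + \<bar>x\<bar>) * (1 + \<bar>y\<bar>))"
proof -
  obtain R where R: "R \<ge> 0" "\<And>x y. k x y \<le> R + 1 * ((1 + \<bar>x\<bar>) * (1 + \<bar>y\<bar>))"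
    using growth[of 1] by auto
  have "k x y \<le> (R + 1) * ((1 + \<bar>x\<bar>) * (1 + \<bar>y\<bar>))" for x y
  proof -
    have "1 * 1 \<le> (1 + \<bar>x\<bar>) * (1 + \<bar>y\<bar>)" by (rule mult_mono) auto
    then have "R * 1 \<le> R * ((1 + \<bar>x\<bar>) * (1 + \<bar>y\<bar>))" by (intro mult_left_mono R) simp
    then show ?thesis using R(2)[of x y] by (simp add: distrib_right)
  qed
  then show ?thesis using R(1) by (intro exI[of _ "R + 1"]) auto
qed

end

text \<open>The factor \<open>3/2\<close> is half of the three values of \<open>g\<close>. The
  kernel enters only through \<open>D\<close>, which a cutoff leaves unchanged; this is why the
  Lipschitz constant of the scheme is independent of the cutoff.\<close>

lemma coag_form_integrable_bound:
  fixes \<kappa> :: "real \<Rightarrow> real \<Rightarrow> real"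
  assumes u: "moment_le B u" and \<kappa>[measurable]: "(\<lambda>z. \<kappa> (fst z) (snd z)) \<in> borel_measurable borel"
    and \<kappa>0: "\<And>x y. 0 \<le> \<kappa> x y" and D: "\<And>x y. \<kappa> x y \<le> D * ((1 + \<bar>x\<bar>) * (1 + \<bar>y\<bar>))"
    and g[measurable]: "g \<in> borel_measurable borel" and G: "\<And>x. \<bar>g x\<bar> \<le> G"
  shows "integrable (u \<Otimes>\<^sub>M u) (\<lambda>z. (g (fst z + snd z) - g (fst z) - g (snd z)) * \<kappa> (fst z) (snd z))"
    and "\<bar>coag_form \<kappa> u g\<bar> \<le> 3/2 * G * D * B\<^sup>2"
proof -
  have m: "(\<lambda>z. (g (fst z + snd z) - g (fst z) - g (snd z)) * \<kappa> (fst z) (snd z)) \<in> borel_measurable borel"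
    unfolding borel_prod[symmetric] by (measurable, simp add: borel_prod)
  have bd: "\<bar>(g (fst (x, y) + snd (x, y)) - g (fst (x, y)) - g (snd (x, y))) * \<kappa> (fst (x, y)) (snd (x, y))\<bar>
      \<le> 3 * G * D * ((1 + \<bar>x\<bar>) * (1 + \<bar>y\<bar>))" for x y
  proof -
    have "\<bar>g (x + y) - g x - g y\<bar> \<le> 3 * G" using G[of "x + y"] G[of x] G[of y] by linarith
    then have "\<bar>g (x + y) - g x - g y\<bar> * \<bar>\<kappa> x y\<bar> \<le> 3 * G * (D * ((1 + \<bar>x\<bar>) * (1 + \<bar>y\<bar>)))"
      using G[of 0] \<kappa>0[of x y] D[of x y] by (intro mult_mono) auto
    then show ?thesis by (simp add: abs_mult mult.assoc)
  qed
  show "integrable (u \<Otimes>\<^sub>M u) (\<lambda>z. (g (fst z + snd z) - g (fst z) - g (snd z)) * \<kappa> (fst z) (snd z))"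
    by (rule moment_le_pair(1)[OF u u m bd])
  show "\<bar>coag_form \<kappa> u g\<bar> \<le> 3/2 * G * D * B\<^sup>2"
    using moment_le_pair(2)[OF u u m bd] unfolding coag_form_def by simp
qed

text \<open>Merging cannot increase the total of a subadditive quantity. The two uses are the weight
  \<open>1 + \<bar>x\<bar>\<close>, for the moment bound, and the indicator of sizes below
  \<open>a\<close>, for the support.\<close>

lemma coag_form_subadditive:
  assumes "\<And>x y. 0 \<le> \<kappa> x y" "\<And>x y. g (x + y) \<le> g x + g y"
  shows "coag_form \<kappa> u g \<le> 0"
proof -
  have "0 \<le> (\<integral>z. - ((g (fst z + snd z) - g (fst z) - g (snd z)) * \<kappa> (fst z) (snd z)) \<partial>(u \<Otimes>\<^sub>M u))"
  proof (intro integral_nonneg_AE AE_I2)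
    fix z :: "real \<times> real"
    have "(g (fst z + snd z) - g (fst z) - g (snd z)) * \<kappa> (fst z) (snd z) \<le> 0"
      using assms(1)[of "fst z" "snd z"] assms(2)[of "fst z" "snd z"] by (intro mult_nonpos_nonneg) auto
    then show "0 \<le> - ((g (fst z + snd z) - g (fst z) - g (snd z)) * \<kappa> (fst z) (snd z))" by simp
  qed
  then show ?thesis by (simp add: coag_form_def)
qed

text \<open>The hypothesis on \<open>d\<close> bounds the total variation distance. The factors are
  exchanged one at a time through \<open>v \<Otimes>\<^sub>M u\<close>; each exchange tests the
  difference with an inner integral bounded by \<open>G * B\<close>, whence the factor
  \<open>2\<close>.\<close>

lemma pair_integral_diff_le:
  fixes F :: "real \<times> real \<Rightarrow> real"
  assumes u: "moment_le B u" and v: "moment_le B v"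
    and d: "\<And>g G. g \<in> borel_measurable borel \<Longrightarrow> (\<And>x. \<bar>g x :: real\<bar> \<le> G) \<Longrightarrow> \<bar>(\<integral>x. g x \<partial>u) - (\<integral>x. g x \<partial>v)\<bar> \<le> d * G"
    and F: "F \<in> borel_measurable borel" and G: "\<And>z. \<bar>F z\<bar> \<le> G"
  shows "\<bar>(\<integral>z. F z \<partial>(u \<Otimes>\<^sub>M u)) - (\<integral>z. F z \<partial>(v \<Otimes>\<^sub>M v))\<bar> \<le> 2 * d * B * G"
proof -
  note Du = moment_leD[OF u] and Dv = moment_leD[OF v]
  interpret u: finite_measure u by fact
  interpret v: finite_measure v by fact
  interpret uu: pair_sigma_finite u u ..
  interpret vv: pair_sigma_finite v v ..
  interpret vu: pair_sigma_finite v u ..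
  have G0: "0 \<le> G" using G[of 0] by simp
  have bd: "\<bar>F (x, y)\<bar> \<le> G * ((1 + \<bar>x\<bar>) * (1 + \<bar>y\<bar>))" for x y
  proof -
    have "1 * 1 \<le> (1 + \<bar>x\<bar>) * (1 + \<bar>y\<bar>)" by (rule mult_mono) auto
    from mult_left_mono[OF this G0] show ?thesis using G[of "(x, y)"] by simp
  qed
  note i = moment_le_pair(1)[OF u u F bd] moment_le_pair(1)[OF v u F bd] moment_le_pair(1)[OF v v F bd]
  have F1[measurable]: "F \<in> borel_measurable (borel \<Otimes>\<^sub>M borel)" using F by (simp add: borel_prod)
  have Fx[measurable]: "(\<lambda>y. F (x, y)) \<in> borel_measurable borel" "(\<lambda>y. F (y, x)) \<in> borel_measurable borel" for x
    by measurable
  define A where "A x = (\<integral>y. F (x, y) \<partial>u)" for x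
  define A' where "A' y = (\<integral>x. F (x, y) \<partial>v)" for y
  have sb: "sets (borel \<Otimes>\<^sub>M u) = sets (borel \<Otimes>\<^sub>M borel)" "sets (borel \<Otimes>\<^sub>M v) = sets (borel \<Otimes>\<^sub>M borel)"
    by (intro sets_pair_measure_cong refl Du Dv)+
  have Fs: "case_prod (\<lambda>x y. F (x, y)) \<in> borel_measurable (borel \<Otimes>\<^sub>M u)"
    "case_prod (\<lambda>y x. F (x, y)) \<in> borel_measurable (borel \<Otimes>\<^sub>M v)"
    unfolding measurable_cong_sets[OF sb(1) refl] measurable_cong_sets[OF sb(2) refl] by measurable
  have Am: "A \<in> borel_measurable borel" "A' \<in> borel_measurable borel"
    unfolding A_def A'_def using u.borel_measurable_lebesgue_integral[OF Fs(1)] v.borel_measurable_lebesgue_integral[OF Fs(2)]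
    by auto
  have Ab: "\<bar>A x\<bar> \<le> G * B" "\<bar>A' x\<bar> \<le> G * B" for x
    unfolding A_def A'_def
    by (rule moment_le_integral_bounded(2)[OF u Fx(1) G], rule moment_le_integral_bounded(2)[OF v Fx(2) G])
  have "(\<integral>z. F z \<partial>(u \<Otimes>\<^sub>M u)) = (\<integral>x. A x \<partial>u)" "(\<integral>z. F z \<partial>(v \<Otimes>\<^sub>M u)) = (\<integral>x. A x \<partial>v)"
    using uu.integral_fst'[OF i(1)] vu.integral_fst'[OF i(2)] unfolding A_def by auto
  moreover have "(\<integral>z. F z \<partial>(v \<Otimes>\<^sub>M u)) = (\<integral>x. A' x \<partial>u)" "(\<integral>z. F z \<partial>(v \<Otimes>\<^sub>M v)) = (\<integral>x. A' x \<partial>v)"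
    using vu.integral_snd[of "\<lambda>x y. F (x, y)"] vv.integral_snd[of "\<lambda>x y. F (x, y)"] i unfolding A'_def by auto
  moreover have "\<bar>(\<integral>x. A x \<partial>u) - (\<integral>x. A x \<partial>v)\<bar> \<le> d * (G * B)" "\<bar>(\<integral>x. A' x \<partial>u) - (\<integral>x. A' x \<partial>v)\<bar> \<le> d * (G * B)"
    using d[OF Am(1) Ab(1)] d[OF Am(2) Ab(2)] by auto
  ultimately show ?thesis by (simp add: mult_ac)
qed

context sublinear_kernel
begin

text \<open>Where \<open>\<kappa>\<close> exceeds \<open>R\<close>, the excess is at most
  \<open>k - R\<close>, hence at most \<open>e\<close> times the product weight; the general bound
  then applies to it with \<open>D = e\<close>.\<close>

lemma coag_form_truncation:
  assumes u: "moment_le B u" and \<kappa>: "dominated \<kappa>"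
    and R: "0 \<le> R" "\<And>x y. k x y \<le> R + e * ((1 + \<bar>x\<bar>) * (1 + \<bar>y\<bar>))" and e: "0 < e"
    and g[measurable]: "g \<in> borel_measurable borel" and G: "\<And>x. \<bar>g x\<bar> \<le> G"
  shows "\<bar>coag_form \<kappa> u g - coag_form (\<lambda>x y. min (\<kappa> x y) R) u g\<bar> \<le> 3/2 * G * e * B\<^sup>2"
proof -
  let ?k1 = "\<lambda>x y. min (\<kappa> x y) R" and ?k2 = "\<lambda>x y. \<kappa> x y - min (\<kappa> x y) R"
  have \<kappa>m[measurable]: "(\<lambda>z. \<kappa> (fst z) (snd z)) \<in> borel_measurable borel"
    and \<kappa>k: "\<And>x y. 0 \<le> \<kappa> x y" "\<And>x y. \<kappa> x y \<le> k x y" using \<kappa> by (auto simp: dominated_def)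
  have m: "(\<lambda>z. ?k1 (fst z) (snd z)) \<in> borel_measurable borel" "(\<lambda>z. ?k2 (fst z) (snd z)) \<in> borel_measurable borel"
    by measurable
  have w1: "1 \<le> (1 + \<bar>x\<bar>) * (1 + \<bar>y :: real\<bar>)" for x y
    using mult_mono[of 1 "1 + \<bar>x\<bar>" 1 "1 + \<bar>y\<bar>"] by simp
  have b0: "\<And>x y. 0 \<le> ?k1 x y" "\<And>x y. 0 \<le> ?k2 x y" using \<kappa>k R by auto
  have b1: "\<And>x y. ?k1 x y \<le> R * ((1 + \<bar>x\<bar>) * (1 + \<bar>y\<bar>))"
    using mult_left_mono[OF w1 R(1)] by (auto intro: order_trans[OF min.cobounded2])
  have b2: "?k2 x y \<le> e * ((1 + \<bar>x\<bar>) * (1 + \<bar>y\<bar>))" for x y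
    using \<kappa>k(2)[of x y] R(2)[of x y] e by (cases "\<kappa> x y \<le> R") auto
  note i = coag_form_integrable_bound(1)[OF u m(1) b0(1) b1 g G] coag_form_integrable_bound(1)[OF u m(2) b0(2) b2 g G]
  have "coag_form \<kappa> u g = coag_form ?k1 u g + coag_form ?k2 u g"
    unfolding coag_form_def distrib_left[symmetric] Bochner_Integration.integral_add[OF i, symmetric]
    by (simp add: algebra_simps)
  then show ?thesis
    using coag_form_integrable_bound(2)[OF u m(2) b0(2) b2 g G] by simp
qed

text \<open>Continuity in total variation up to an error governed by \<open>e\<close>: the form cut
  off at \<open>R\<close> is quadratic in the measure and Lipschitz with a constant of order
  \<open>R\<close>, while removing the cutoff costs \<open>3/2 * G * e * B\<^sup>2\<close> for each
  of the two measures.\<close>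

lemma coag_form_diff_le:
  assumes u: "moment_le B u" and v: "moment_le B v"
    and d: "\<And>g G. g \<in> borel_measurable borel \<Longrightarrow> (\<And>x. \<bar>g x :: real\<bar> \<le> G) \<Longrightarrow> \<bar>(\<integral>x. g x \<partial>u) - (\<integral>x. g x \<partial>v)\<bar> \<le> d * G"
    and \<kappa>: "dominated \<kappa>"
    and R: "0 \<le> R" "\<And>x y. k x y \<le> R + e * ((1 + \<bar>x\<bar>) * (1 + \<bar>y\<bar>))" and e: "0 < e"
    and g[measurable]: "g \<in> borel_measurable borel" and G: "\<And>x. \<bar>g x\<bar> \<le> G"
  shows "\<bar>coag_form \<kappa> u g - coag_form \<kappa> v g\<bar> \<le> 3 * G * (R * d * B + e * B\<^sup>2)"
proof -
  let ?k1 = "\<lambda>x y. min (\<kappa> x y) R"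
  have \<kappa>m[measurable]: "(\<lambda>z. \<kappa> (fst z) (snd z)) \<in> borel_measurable borel"
    and \<kappa>0: "\<And>x y. 0 \<le> \<kappa> x y" using \<kappa> by (auto simp: dominated_def)
  let ?F = "\<lambda>z. (g (fst z + snd z) - g (fst z) - g (snd z)) * ?k1 (fst z) (snd z)"
  have Fm: "?F \<in> borel_measurable borel"
    unfolding borel_prod[symmetric] by (measurable, simp add: borel_prod)
  have Fb: "\<bar>?F z\<bar> \<le> 3 * G * R" for z
  proof -
    have "\<bar>g (fst z + snd z) - g (fst z) - g (snd z)\<bar> \<le> 3 * G"
      using G[of "fst z + snd z"] G[of "fst z"] G[of "snd z"] by linarith
    then have "\<bar>g (fst z + snd z) - g (fst z) - g (snd z)\<bar> * \<bar>?k1 (fst z) (snd z)\<bar> \<le> 3 * G * R"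
      using G[of 0] \<kappa>0[of "fst z" "snd z"] R(1) by (intro mult_mono) auto
    then show ?thesis by (simp only: abs_mult)
  qed
  have "\<bar>coag_form ?k1 u g - coag_form ?k1 v g\<bar> \<le> 3 * G * (R * d * B)"
    using pair_integral_diff_le[OF u v d Fm Fb] unfolding coag_form_def by (simp add: field_simps)
  then show ?thesis
    using coag_form_truncation[OF u \<kappa> R e g G] coag_form_truncation[OF v \<kappa> R e g G]
    unfolding distrib_left by linarith
qed

end

subsection \<open>The Euler scheme\<close>

primrec euler_seq :: "(real \<Rightarrow> real \<Rightarrow> real) \<Rightarrow> real \<Rightarrow> real measure \<Rightarrow> real measure \<Rightarrow> nat \<Rightarrow> real measure" where
  "euler_seq \<kappa> h \<eta> f0 0 = f0"
| "euler_seq \<kappa> h \<eta> f0 (Suc j) = euler_step \<kappa> h \<eta> (euler_seq \<kappa> h \<eta> f0 j)"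

locale euler_scheme = sublinear_kernel +
  fixes a m0 m1 T :: real and f0 \<eta> :: "real measure"
  assumes f0: "moment_le m0 f0" "measure f0 {..<a} = 0"
    and \<eta>: "moment_le m1 \<eta>" "measure \<eta> {..<a} = 0"
    and T: "0 \<le> T" and a: "0 < a"
begin

text \<open>Initial weighted mass plus all that the source can supply up to time \<open>T\<close>.
  As merging adds no weight, this bound depends neither on the cutoff nor on the step size.\<close>

definition mass_bound :: real where "mass_bound = m0 + T * m1"

lemma m_nonneg: "0 \<le> m0" "0 \<le> m1" "0 \<le> mass_bound"
  using moment_leD(6)[OF f0(1)] moment_leD(6)[OF \<eta>(1)] T unfolding mass_bound_def by auto

lemma moment_le_mono: "moment_le b u \<Longrightarrow> b \<le> b' \<Longrightarrow> moment_le b' u"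
  unfolding moment_le_def by auto

context
  fixes n h :: real
  assumes n: "0 \<le> n" and h: "0 \<le> h" "h * n * mass_bound \<le> 1"
begin

abbreviation "\<kappa> \<equiv> \<lambda>x y. min (k x y) n"
abbreviation "u j \<equiv> euler_seq \<kappa> h \<eta> f0 j"

lemma kappa: "(\<lambda>z. \<kappa> (fst z) (snd z)) \<in> borel_measurable borel" "\<And>x y. \<kappa> x y = \<kappa> y x"
    "\<And>x y. 0 \<le> \<kappa> x y" "\<And>x y. \<kappa> x y \<le> n"
  using dominated_min[OF n] sym nonneg n by (auto simp: dominated_def)

lemma step_integral:
  fixes g :: "real \<Rightarrow> real"
  assumes u: "moment_le mass_bound v" and g: "g \<in> borel_measurable borel" "\<And>x. \<bar>g x\<bar> \<le> C * (1 + \<bar>x\<bar>)"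
  shows "integrable (euler_step \<kappa> h \<eta> v) g"
    and "(\<integral>x. g x \<partial>euler_step \<kappa> h \<eta> v) = (\<integral>x. g x \<partial>v) + h * (coag_form \<kappa> v g + (\<integral>x. g x \<partial>\<eta>))"
  using euler_step_integral[OF u \<eta>(1) kappa h g] by auto

lemma step_subadditive:
  fixes g :: "real \<Rightarrow> real"
  assumes u: "moment_le mass_bound v" and g: "g \<in> borel_measurable borel" "\<And>x. \<bar>g x\<bar> \<le> C * (1 + \<bar>x\<bar>)"
    and sub: "\<And>x y. g (x + y) \<le> g x + g y"
  shows "(\<integral>x. g x \<partial>euler_step \<kappa> h \<eta> v) \<le> (\<integral>x. g x \<partial>v) + h * (\<integral>x. g x \<partial>\<eta>)"
  using mult_left_mono[OF coag_form_subadditive[of \<kappa> g v, OF kappa(3) sub] h(1)] step_integral(2)[OF u g]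
  by (simp add: distrib_left)

lemma moment_le_euler_step:
  assumes v: "moment_le b v" "b \<le> mass_bound" and va: "measure v {..<a} = 0"
  shows "moment_le (b + h * m1) (euler_step \<kappa> h \<eta> v)" "measure (euler_step \<kappa> h \<eta> v) {..<a} = 0"
proof -
  note v' = moment_le_mono[OF v]
  note D = moment_leD[OF v'] and D' = moment_leD[OF \<eta>(1)]
  have w: "(\<lambda>x::real. 1 + \<bar>x\<bar>) \<in> borel_measurable borel" "\<And>x::real. \<bar>1 + \<bar>x\<bar>\<bar> \<le> 1 * (1 + \<bar>x\<bar>)" by auto
  have s: "sets (euler_step \<kappa> h \<eta> v) = sets borel" using D by (simp add: euler_step_def)
  then have sp: "space (euler_step \<kappa> h \<eta> v) = UNIV" using sets_eq_imp_space_eq[of _ borel] by simp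
  have "integrable (euler_step \<kappa> h \<eta> v) (indicat_real UNIV)"
    by (rule step_integral(1)[OF v', of _ 1]) auto
  then have fin: "finite_measure (euler_step \<kappa> h \<eta> v)"
    unfolding integrable_indicator_iff by (intro finite_measureI) (auto simp: sp)
  have "(\<integral>x. 1 + \<bar>x\<bar> \<partial>euler_step \<kappa> h \<eta> v) \<le> (\<integral>x. 1 + \<bar>x\<bar> \<partial>v) + h * (\<integral>x. 1 + \<bar>x\<bar> \<partial>\<eta>)"
    by (rule step_subadditive[OF v' w]) auto
  also have "\<dots> \<le> b + h * m1"
    using D'(5) h(1) moment_leD(5)[OF v(1)] by (intro add_mono mult_left_mono)
  finally show "moment_le (b + h * m1) (euler_step \<kappa> h \<eta> v)"
    unfolding moment_le_def using s fin step_integral(1)[OF v' w] by auto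
  \<comment> \<open>If both constituents are at least \<open>a > 0\<close>, so is their sum; hence a
    merged particle below \<open>a\<close> has a constituent below \<open>a\<close>.\<close>
  have i: "indicat_real {..<a} (x + y) \<le> indicator {..<a} x + indicator {..<a} y" for x y
    using a by (auto simp: indicator_def)
  have "(\<integral>x. indicator {..<a} x \<partial>euler_step \<kappa> h \<eta> v) \<le> (\<integral>x. indicat_real {..<a} x \<partial>v) + h * (\<integral>x. indicat_real {..<a} x \<partial>\<eta>)"
    by (rule step_subadditive[OF v', of _ 1]) (use i in \<open>auto simp: indicator_def\<close>)
  then have "measure (euler_step \<kappa> h \<eta> v) {..<a} \<le> 0"
    using va \<eta>(2) by (simp add: D(3) D'(3) sp)
  then show "measure (euler_step \<kappa> h \<eta> v) {..<a} = 0"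
    by (simp add: measure_le_0_iff)
qed

text \<open>The induction carries the bound reached at time \<open>j * h\<close> rather than
  \<open>mass_bound\<close> itself: the step estimates apply to measures below
  \<open>mass_bound\<close>, each step adds \<open>h * m1\<close>, and the time-dependent bound
  stays below \<open>mass_bound\<close> up to \<open>T\<close>.\<close>

lemma euler_seq_invariant:
  "real j * h \<le> T \<Longrightarrow> moment_le (m0 + real j * h * m1) (u j) \<and> measure (u j) {..<a} = 0"
proof (induction j)
  case 0
  then show ?case using f0 by simp
next
  case (Suc j)
  have j: "real j * h \<le> T" using Suc.prems h(1) by (simp add: algebra_simps)
  have "m0 + real j * h * m1 \<le> mass_bound"
    unfolding mass_bound_def using mult_right_mono[OF j m_nonneg(2)] by simp
  from moment_le_euler_step[OF _ this, of "u j"] Suc.IH[OF j]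
  show ?case by (simp add: algebra_simps)
qed

lemma euler_seq_moment:
  assumes "real j * h \<le> T"
  shows "moment_le mass_bound (u j)" "measure (u j) {..<a} = 0"
  using euler_seq_invariant[OF assms] moment_le_mono[of _ "u j" mass_bound] mult_right_mono[OF assms m_nonneg(2)]
  unfolding mass_bound_def by auto

text \<open>An estimate in total variation, since \<open>g\<close> is any bounded measurable
  function. The constant comes from \<open>mass_bound\<close>, the linear growth \<open>D\<close>
  and the source, so neither \<open>n\<close> nor \<open>h\<close> enters it.\<close>

lemma euler_seq_diff:
  fixes g :: "real \<Rightarrow> real"
  assumes D: "\<And>x y. k x y \<le> D * ((1 + \<bar>x\<bar>) * (1 + \<bar>y\<bar>))"
    and g: "g \<in> borel_measurable borel" "\<And>x. \<bar>g x\<bar> \<le> G"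
    and ij: "i \<le> j" "real j * h \<le> T"
  shows "\<bar>(\<integral>x. g x \<partial>u j) - (\<integral>x. g x \<partial>u i)\<bar> \<le> (real j - real i) * h * ((3/2 * D * mass_bound\<^sup>2 + m1) * G)"
  using ij
proof (induction j rule: dec_induct)
  case base
  then show ?case by simp
next
  case (step j)
  have j: "real j * h \<le> T" using step.prems h(1) by (simp add: algebra_simps)
  note v = euler_seq_moment(1)[OF j]
  have kD: "\<kappa> x y \<le> D * ((1 + \<bar>x\<bar>) * (1 + \<bar>y\<bar>))" for x y using D[of x y] by simp
  have gC: "\<bar>g x\<bar> \<le> G * (1 + \<bar>x\<bar>)" for x
    using g(2)[of x] mult_left_mono[of 1 "1 + \<bar>x\<bar>" G] abs_ge_zero[of "g x"] by simp
  have "\<bar>coag_form \<kappa> (u j) g\<bar> \<le> 3/2 * G * D * mass_bound\<^sup>2"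
    by (rule coag_form_integrable_bound(2)[OF v kappa(1) kappa(3) kD g])
  moreover have "\<bar>\<integral>x. g x \<partial>\<eta>\<bar> \<le> G * m1" by (rule moment_le_integral_bounded(2)[OF \<eta>(1) g])
  ultimately have "\<bar>coag_form \<kappa> (u j) g + (\<integral>x. g x \<partial>\<eta>)\<bar> \<le> (3/2 * D * mass_bound\<^sup>2 + m1) * G"
    unfolding distrib_right by (simp add: mult_ac)
  from mult_left_mono[OF this h(1)]
  have "\<bar>(\<integral>x. g x \<partial>u (Suc j)) - (\<integral>x. g x \<partial>u j)\<bar> \<le> h * ((3/2 * D * mass_bound\<^sup>2 + m1) * G)"
    unfolding euler_seq.simps step_integral(2)[OF v g(1) gC] using h(1) by (simp add: abs_mult)
  moreover have eq: "(real (Suc j) - real i) * h * x = (real j - real i) * h * x + h * x" for x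
    by (simp add: algebra_simps)
  ultimately show ?case unfolding eq using step.IH[OF j] by linarith
qed

text \<open>The increment is compared with the rate at an arbitrary reference index \<open>r\<close>, so that the estimate
  yields both one-sided difference quotients.\<close>

lemma euler_seq_rate:
  fixes g :: "real \<Rightarrow> real"
  assumes D: "\<And>x y. k x y \<le> D * ((1 + \<bar>x\<bar>) * (1 + \<bar>y\<bar>))" "0 \<le> D"
    and R: "0 \<le> R" "\<And>x y. k x y \<le> R + e * ((1 + \<bar>x\<bar>) * (1 + \<bar>y\<bar>))" and e: "0 < e"
    and g: "g \<in> borel_measurable borel" "\<And>x. \<bar>g x\<bar> \<le> G"
    and ij: "i \<le> j" "real j * h \<le> T" and r: "i \<le> r" "r \<le> j" and d: "(real j - real i) * h \<le> d"
  shows "\<bar>(\<integral>x. g x \<partial>u j) - (\<integral>x. g x \<partial>u i) - (real j - real i) * h * (coag_form \<kappa> (u r) g + (\<integral>x. g x \<partial>\<eta>))\<bar>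
    \<le> (real j - real i) * h * (3 * G * (R * (d * (3/2 * D * mass_bound\<^sup>2 + m1)) * mass_bound + e * mass_bound\<^sup>2))"
proof -
  define A where "A = 3/2 * D * mass_bound\<^sup>2 + m1"
  have A0: "0 \<le> A" using D m_nonneg by (simp add: A_def)
  define E where "E = 3 * G * (R * (d * A) * mass_bound + e * mass_bound\<^sup>2)"
  define c where "c l = coag_form \<kappa> (u l) g + (\<integral>x. g x \<partial>\<eta>)" for l
  have G0: "0 \<le> G" using g(2)[of 0] by simp
  have gC: "\<bar>g x\<bar> \<le> G * (1 + \<bar>x\<bar>)" for x
    using g(2)[of x] mult_left_mono[of 1 "1 + \<bar>x\<bar>" G] abs_ge_zero[of "g x"] by simp
  have le_T: "real l * h \<le> T" if "l \<le> j" for l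
    using mult_right_mono[of "real l" "real j" h] that ij h(1) by simp
  \<comment> \<open>All indices between \<open>i\<close> and \<open>j\<close> are within time
    \<open>d\<close> of the reference index, on whichever side they lie, so in total variation their
    measures differ from that at \<open>r\<close> by at most \<open>d * A\<close>.\<close>
  have diff: "\<bar>(\<integral>x. f x \<partial>u l) - (\<integral>x. f x \<partial>u r)\<bar> \<le> (d * A) * F"
    if l: "i \<le> l" "l \<le> j" and f: "f \<in> borel_measurable borel" "\<And>x. \<bar>f x :: real\<bar> \<le> F" for f F l
  proof -
    have F0: "0 \<le> F" using f(2)[of 0] by simp
    have le: "(real q - real p) * h * (A * F) \<le> d * (A * F)" if "i \<le> p" "q \<le> j" for p q
    proof (rule mult_right_mono)
      have "(real q - real p) * h \<le> (real j - real i) * h" using that h(1) by (intro mult_right_mono) auto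
      then show "(real q - real p) * h \<le> d" using d by simp
    qed (use A0 F0 in auto)
    show ?thesis
    proof (cases "r \<le> l")
      case True
      then show ?thesis
        using euler_seq_diff[OF D(1) f True le_T[OF l(2)]] le[of r l] l r unfolding A_def[symmetric] by (simp add: mult.assoc)
    next
      case False
      then show ?thesis
        using euler_seq_diff[OF D(1) f, of l r] le_T[OF r(2)] le[of l r] l r unfolding A_def[symmetric]
        by (simp add: abs_minus_commute mult.assoc)
    qed
  qed
  \<comment> \<open>The error \<open>E\<close> is the same for every intermediate index, so the
    single steps can be summed.\<close>
  have cl: "\<bar>c l - c r\<bar> \<le> E" if l: "i \<le> l" "l \<le> j" for l
    using coag_form_diff_le[OF euler_seq_moment(1)[OF le_T[OF l(2)]] euler_seq_moment(1)[OF le_T[OF r(2)]]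
        diff[OF l] dominated_min[OF n] R e g]
    unfolding c_def E_def by simp
  have "\<bar>(\<integral>x. g x \<partial>u l) - (\<integral>x. g x \<partial>u i) - (real l - real i) * h * c r\<bar> \<le> (real l - real i) * h * E"
    if "i \<le> l" "l \<le> j" for l
    using that
  proof (induction l rule: dec_induct)
    case base
    then show ?case by simp
  next
    case (step l)
    have l: "i \<le> l" "l \<le> j" using step by auto
    have "(\<integral>x. g x \<partial>u (Suc l)) = (\<integral>x. g x \<partial>u l) + h * c l"
      unfolding c_def euler_seq.simps by (rule step_integral(2)[OF euler_seq_moment(1)[OF le_T[OF l(2)]] g(1) gC])
    moreover have "\<bar>h * c l - h * c r\<bar> \<le> h * E"
      using mult_left_mono[OF cl[OF l] h(1)] h(1) by (simp add: abs_mult flip: right_diff_distrib)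
    moreover have eq: "(real (Suc l) - real i) * h * x = (real l - real i) * h * x + h * x" for x
      by (simp add: algebra_simps)
    ultimately show ?case unfolding eq using step.IH[OF l(2)] by linarith
  qed
  from this[OF ij(1) order_refl] show ?thesis unfolding c_def E_def A_def .
qed

end
end

subsection \<open>Weak convergence\<close>

text \<open>The constant \<open>1\<close> is among the test functions, so total masses converge: no
  particles are lost at infinity, although the first moment may drop in the limit.\<close>

definition weakly_conv :: "(nat \<Rightarrow> real measure) \<Rightarrow> real measure \<Rightarrow> bool" where
  "weakly_conv u v \<longleftrightarrow> (\<forall>f :: real \<Rightarrow> real. continuous_on UNIV f \<longrightarrow> bounded (range f) \<longrightarrow>
     (\<lambda>n. \<integral>x. f x \<partial>u n) \<longlonglongrightarrow> (\<integral>x. f x \<partial>v))"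

lemma weakly_convD:
  fixes f :: "real \<Rightarrow> real"
  assumes "weakly_conv u v" "continuous_on UNIV f" "\<And>x. \<bar>f x\<bar> \<le> G"
  shows "(\<lambda>n. \<integral>x. f x \<partial>u n) \<longlonglongrightarrow> (\<integral>x. f x \<partial>v)"
  using assms unfolding weakly_conv_def by (auto simp: bounded_iff)

lemma weakly_convI:
  assumes "\<And>(f :: real \<Rightarrow> real) G. continuous_on UNIV f \<Longrightarrow> (\<And>x. \<bar>f x\<bar> \<le> G) \<Longrightarrow> (\<lambda>n. \<integral>x. f x \<partial>u n) \<longlonglongrightarrow> (\<integral>x. f x \<partial>v)"
  shows "weakly_conv u v"
  using assms unfolding weakly_conv_def by (auto simp: bounded_iff)

lemma measure_null_cong:
  assumes "moment_le B u"
  shows "measure u {..<a} = 0 \<longleftrightarrow> (AE x in u. a \<le> x)"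
proof -
  interpret finite_measure u using assms by (rule moment_leD)
  have "{x \<in> space u. \<not> a \<le> x} = {..<a}" using moment_leD(3)[OF assms] by auto
  moreover have "{..<a} \<in> sets u" using moment_leD(1)[OF assms] by simp
  ultimately show ?thesis
    by (subst AE_iff_measurable[of "{..<a}"]) (auto simp: emeasure_eq_measure)
qed

text \<open>The weight is unbounded, so its bound passes to the limit only for
  \<open>min (1 + \<bar>x\<bar>) (real i)\<close>; Fatou's lemma in \<open>i\<close> removes the
  truncation. The support bound is carried over by a bounded continuous function that is positive
  exactly below \<open>a\<close>.\<close>

lemma weak_limit_moment_le:
  assumes u: "\<And>n. moment_le B (u n)" "\<And>n. measure (u n) {..<a} = 0"
    and v: "sets v = sets borel" "finite_measure v" and conv: "weakly_conv u v"
  shows "moment_le B v" "measure v {..<a} = 0"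
proof -
  interpret finite_measure v by fact
  note [measurable_cong] = v(1)
  have B: "0 \<le> B" by (rule moment_leD(6)[OF u(1)])
  have bd: "(\<integral>x. min (1 + \<bar>x\<bar>) (real i) \<partial>v) \<le> B" for i
  proof (rule LIMSEQ_le_const2)
    show "(\<lambda>n. \<integral>x. min (1 + \<bar>x\<bar>) (real i) \<partial>u n) \<longlonglongrightarrow> (\<integral>x. min (1 + \<bar>x\<bar>) (real i) \<partial>v)"
      by (rule weakly_convD[OF conv, of _ "real i"]) (auto intro!: continuous_intros)
    have "(\<integral>x. min (1 + \<bar>x\<bar>) (real i) \<partial>u n) \<le> B" for n
      using moment_le_integral(2)[OF u(1), of "\<lambda>x. min (1 + \<bar>x\<bar>) (real i)" 1] by simp
    then show "\<exists>N. \<forall>n\<ge>N. (\<integral>x. min (1 + \<bar>x\<bar>) (real i) \<partial>u n) \<le> B" by blast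
  qed
  have int: "integrable v (\<lambda>x. min (1 + \<bar>x\<bar>) (real i))" for i
    by (rule integrable_const_bound[of _ "real i"]) auto
  have "(\<integral>\<^sup>+x. ennreal (1 + \<bar>x\<bar>) \<partial>v) \<le> (\<integral>\<^sup>+x. liminf (\<lambda>i. ennreal (min (1 + \<bar>x\<bar>) (real i))) \<partial>v)"
  proof (rule nn_integral_mono)
    fix x :: real
    have "\<forall>\<^sub>F i in sequentially. min (1 + \<bar>x\<bar>) (real i) = 1 + \<bar>x\<bar>"
      using eventually_ge_at_top[of "nat \<lceil>1 + \<bar>x\<bar>\<rceil>"] by eventually_elim (auto simp: min_def le_nat_iff; linarith)
    then have "(\<lambda>i. ennreal (min (1 + \<bar>x\<bar>) (real i))) \<longlonglongrightarrow> ennreal (1 + \<bar>x\<bar>)"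
      by (intro tendsto_ennrealI tendsto_eventually)
    then show "ennreal (1 + \<bar>x\<bar>) \<le> liminf (\<lambda>i. ennreal (min (1 + \<bar>x\<bar>) (real i)))"
      by (simp add: lim_imp_Liminf)
  qed
  also have "\<dots> \<le> liminf (\<lambda>i. \<integral>\<^sup>+x. ennreal (min (1 + \<bar>x\<bar>) (real i)) \<partial>v)"
    by (rule nn_integral_liminf) measurable
  also have "\<dots> \<le> liminf (\<lambda>i::nat. ennreal B)"
    using bd by (intro Liminf_mono always_eventually allI) (simp add: nn_integral_eq_integral[OF int] ennreal_leI)
  also have "\<dots> = ennreal B" by (simp add: Liminf_const)
  finally have le: "(\<integral>\<^sup>+x. ennreal (1 + \<bar>x\<bar>) \<partial>v) \<le> ennreal B" .
  have i: "integrable v (\<lambda>x. 1 + \<bar>x\<bar>)"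
    using le by (intro integrableI_nonneg) (auto intro: le_less_trans)
  have "ennreal (\<integral>x. 1 + \<bar>x\<bar> \<partial>v) \<le> ennreal B"
    using le nn_integral_eq_integral[OF i] by simp
  then have "(\<integral>x. 1 + \<bar>x\<bar> \<partial>v) \<le> B" using B by (simp only: ennreal_le_iff)
  then show m: "moment_le B v" using v i unfolding moment_le_def by blast
  define g where "g x = min 1 (max 0 (a - x))" for x :: real
  have gm[measurable]: "g \<in> borel_measurable borel" unfolding g_def by measurable
  have "(\<integral>x. g x \<partial>u n) = 0" for n
  proof (rule integral_eq_zero_AE)
    show "AE x in u n. g x = 0"
      using u(2)[of n, unfolded measure_null_cong[OF u(1)]] by eventually_elim (auto simp: g_def)
  qed
  moreover have "(\<lambda>n. \<integral>x. g x \<partial>u n) \<longlonglongrightarrow> (\<integral>x. g x \<partial>v)"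
    by (rule weakly_convD[OF conv, of _ 1]) (auto simp: g_def intro!: continuous_intros)
  ultimately have g0: "(\<integral>x. g x \<partial>v) = 0" by (simp add: LIMSEQ_const_iff)
  have "integrable v g" by (rule integrable_const_bound[of _ 1]) (auto simp: g_def)
  then have "AE x in v. g x = 0"
    using integral_nonneg_eq_0_iff_AE[of v g] g0 by (auto simp: g_def)
  then have "AE x in v. a \<le> x" by eventually_elim (auto simp: g_def min_def max_def split: if_splits)
  then show "measure v {..<a} = 0" using measure_null_cong[OF m] by simp
qed

section \<open>Total mass, normalization and products\<close>

lemma total_mass_conv:
  assumes "weakly_conv u v" "\<And>n. moment_le B (u n)" "moment_le B v"
  shows "(\<lambda>n. measure (u n) UNIV) \<longlonglongrightarrow> measure v UNIV"
  using weakly_convD[OF assms(1), of "\<lambda>_. 1" 1] moment_leD(3)[OF assms(2)] moment_leD(3)[OF assms(3)]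
  by simp

text \<open>Helly's and Skorohod's theorems concern probability distributions, so the total mass is
  split off and its convergence is tracked separately.\<close>

definition normalized :: "real measure \<Rightarrow> real measure" where
  "normalized u = density u (\<lambda>_. ennreal (1 / measure u UNIV))"

lemma
  assumes u: "moment_le B u" and pos: "0 < measure u UNIV"
  shows real_distribution_normalized: "real_distribution (normalized u)"
    and integral_normalized: "f \<in> borel_measurable borel \<Longrightarrow> (\<integral>x. f x \<partial>normalized u) = (\<integral>x. f x \<partial>u) / measure u UNIV"
    and measure_normalized: "A \<in> sets borel \<Longrightarrow> measure (normalized u) A = measure u A / measure u UNIV"
    and integral_pair_normalized: "F \<in> borel_measurable borel \<Longrightarrow>
      (\<integral>z. F z \<partial>(u \<Otimes>\<^sub>M u)) = (measure u UNIV)\<^sup>2 * (\<integral>z. (F z :: real) \<partial>(normalized u \<Otimes>\<^sub>M normalized u))"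
proof -
  note D = moment_leD[OF u]
  interpret finite_measure u by fact
  let ?m = "measure u UNIV"
  have em: "A \<in> sets borel \<Longrightarrow> emeasure (normalized u) A = ennreal (measure u A / ?m)" for A
    using D pos by (simp add: normalized_def emeasure_density_const emeasure_eq_measure ennreal_mult[symmetric])
  show P: "real_distribution (normalized u)"
  proof (intro real_distribution.intro prob_spaceI real_distribution_axioms.intro)
    show "emeasure (normalized u) (space (normalized u)) = 1"
      using em[of UNIV] pos D(3) by (simp add: normalized_def)
  qed (use D in \<open>auto simp: normalized_def\<close>)
  show "A \<in> sets borel \<Longrightarrow> measure (normalized u) A = measure u A / ?m"
    using em pos by (simp add: measure_def enn2real_ennreal)
  show "(\<integral>x. f x \<partial>normalized u) = (\<integral>x. f x \<partial>u) / ?m" if f: "f \<in> borel_measurable borel"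
  proof -
    have "f \<in> borel_measurable u" using f measurable_cong_sets[OF D(1) refl] by blast
    then show ?thesis using pos unfolding normalized_def
      by (subst integral_real_density) auto
  qed
  assume F: "F \<in> borel_measurable borel"
  have "sets (u \<Otimes>\<^sub>M u) = sets (borel :: (real \<times> real) measure)"
    unfolding sets_pair_measure_cong[OF D(1) D(1)] borel_prod ..
  then have Fm: "F \<in> borel_measurable (u \<Otimes>\<^sub>M u)" using F measurable_cong_sets by blast
  interpret P: real_distribution "normalized u" by (rule P)
  have "normalized u \<Otimes>\<^sub>M normalized u = density (u \<Otimes>\<^sub>M u) (\<lambda>(x, y). ennreal (1 / ?m) * ennreal (1 / ?m))"
    unfolding normalized_def
  proof (rule pair_measure_density)
    show "sigma_finite_measure (density u (\<lambda>x. ennreal (1 / ?m)))"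
      using P.sigma_finite_measure_axioms unfolding normalized_def .
  qed (auto intro: sigma_finite_measure_axioms)
  also have "(\<lambda>(x::real, y::real). ennreal (1 / ?m) * ennreal (1 / ?m)) = (\<lambda>_. ennreal ((1 / ?m)\<^sup>2))"
    by (auto simp: ennreal_mult[symmetric] power2_eq_square)
  finally have "(\<integral>z. F z \<partial>(normalized u \<Otimes>\<^sub>M normalized u)) = (1 / ?m)\<^sup>2 * (\<integral>z. F z \<partial>(u \<Otimes>\<^sub>M u))"
    using Fm by (simp add: integral_real_density)
  then show "(\<integral>z. F z \<partial>(u \<Otimes>\<^sub>M u)) = ?m\<^sup>2 * (\<integral>z. F z \<partial>(normalized u \<Otimes>\<^sub>M normalized u))"
    using pos by (simp add: field_simps)
qed

text \<open>Skorohod's representation replaces weak convergence of the product measures by pointwise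
  convergence on a product of probability spaces.\<close>

lemma weak_limit_pair:
  fixes F :: "real \<times> real \<Rightarrow> real"
  assumes u: "\<And>n. moment_le B (u n)" and v: "moment_le B v" and conv: "weakly_conv u v"
    and F: "continuous_on UNIV F" "\<And>z. \<bar>F z\<bar> \<le> G"
  shows "(\<lambda>n. \<integral>z. F z \<partial>(u n \<Otimes>\<^sub>M u n)) \<longlonglongrightarrow> (\<integral>z. F z \<partial>(v \<Otimes>\<^sub>M v))"
proof -
  have Fm: "F \<in> borel_measurable borel" by (rule borel_measurable_continuous_onI[OF F(1)])
  have G0: "0 \<le> G" using F(2)[of 0] by simp
  have mass: "(\<lambda>n. measure (u n) UNIV) \<longlonglongrightarrow> measure v UNIV" by (rule total_mass_conv[OF conv u v])
  have bound: "\<bar>\<integral>z. F z \<partial>(w \<Otimes>\<^sub>M w)\<bar> \<le> G * (measure w UNIV)\<^sup>2" if w: "moment_le B w" for w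
  proof -
    note D = moment_leD[OF w]
    interpret finite_measure w by fact
    have s: "sets (w \<Otimes>\<^sub>M w) = sets (borel :: (real \<times> real) measure)"
      unfolding sets_pair_measure_cong[OF D(1) D(1)] borel_prod ..
    then have Fw: "F \<in> borel_measurable (w \<Otimes>\<^sub>M w)" using Fm measurable_cong_sets by blast
    have "integrable (w \<Otimes>\<^sub>M w) (\<lambda>z. 1 * (1::real))" "(\<integral>z. 1 * (1::real) \<partial>(w \<Otimes>\<^sub>M w)) = (measure w UNIV)\<^sup>2"
      using integral_pair_product[of w w "\<lambda>_. 1" "\<lambda>_. 1"] D by (auto simp: power2_eq_square)
    then have "integrable (w \<Otimes>\<^sub>M w) (\<lambda>z. G * (1 * (1::real)))"
      "(\<integral>z. G * (1 * (1::real)) \<partial>(w \<Otimes>\<^sub>M w)) = G * (measure w UNIV)\<^sup>2"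
      by (simp_all only: integrable_mult_right integral_mult_right_zero)
    then have c: "integrable (w \<Otimes>\<^sub>M w) (\<lambda>z. G)" "(\<integral>z. G \<partial>(w \<Otimes>\<^sub>M w)) = G * (measure w UNIV)\<^sup>2"
      by simp_all
    have "integrable (w \<Otimes>\<^sub>M w) F"
      by (rule Bochner_Integration.integrable_bound[OF c(1) Fw]) (use F(2) G0 in auto)
    then show ?thesis
      using Bochner_Integration.integral_norm_bound_integral[of "w \<Otimes>\<^sub>M w" F "\<lambda>_. G", OF _ c(1)] F(2)
      unfolding c(2) by simp
  qed
  show ?thesis
  proof (cases "measure v UNIV = 0")
    \<comment> \<open>A limit without mass cannot be normalized; here the bound by \<open>G\<close>
      times the squared mass sends both sides to \<open>0\<close>.\<close>
    case True
    have "(\<lambda>n. G * (measure (u n) UNIV)\<^sup>2) \<longlonglongrightarrow> G * 0\<^sup>2"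
      using mass True by (intro tendsto_intros) simp
    then have lim: "(\<lambda>n. G * (measure (u n) UNIV)\<^sup>2) \<longlonglongrightarrow> 0" by simp
    have "(\<lambda>n. \<integral>z. F z \<partial>(u n \<Otimes>\<^sub>M u n)) \<longlonglongrightarrow> 0"
    proof (rule Lim_null_comparison[OF _ lim], intro always_eventually allI)
      show "norm (\<integral>z. F z \<partial>(u n \<Otimes>\<^sub>M u n)) \<le> G * (measure (u n) UNIV)\<^sup>2" for n
        using bound[OF u] by (simp only: real_norm_def)
    qed
    moreover have "(\<integral>z. F z \<partial>(v \<Otimes>\<^sub>M v)) = 0" using bound[OF v] unfolding True by simp
    ultimately show ?thesis by (simp only:)
  next
    case False
    then have pos: "0 < measure v UNIV" by (simp add: zero_less_measure_iff)
    have "\<forall>\<^sub>F n in sequentially. 0 < measure (u n) UNIV" using order_tendstoD(1)[OF mass pos] .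
    \<comment> \<open>Only a tail of the sequence is known to have positive mass, hence the shift by
      \<open>N\<close>, undone at the end by \<open>LIMSEQ_offset\<close>.\<close>
    then obtain N where N: "\<And>n. 0 < measure (u (n + N)) UNIV"
      unfolding eventually_sequentially by (metis le_add2)
    define p where "p n = normalized (u (n + N))" for n
    have pR: "real_distribution (p n)" for n unfolding p_def by (rule real_distribution_normalized[OF u N])
    have qR: "real_distribution (normalized v)" by (rule real_distribution_normalized[OF v pos])
    have mass': "(\<lambda>n. measure (u (n + N)) UNIV) \<longlonglongrightarrow> measure v UNIV" using mass by (rule LIMSEQ_ignore_initial_segment)
    have "weak_conv_m p (normalized v)"
    proof (rule integral_bdd_continuous_conv_imp_weak_conv[OF pR qR])
      fix f :: "real \<Rightarrow> real" assume f: "\<And>x. isCont f x" "\<And>x. \<bar>f x\<bar> \<le> 1"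
      have c: "continuous_on UNIV f" using f by (simp add: continuous_at_imp_continuous_on)
      then have fm: "f \<in> borel_measurable borel" by (rule borel_measurable_continuous_onI)
      show "(\<lambda>n. \<integral>x. f x \<partial>p n) \<longlonglongrightarrow> (\<integral>x. f x \<partial>normalized v)"
        unfolding p_def integral_normalized[OF u N fm] integral_normalized[OF v pos fm]
        by (intro tendsto_divide mass' LIMSEQ_ignore_initial_segment[OF weakly_convD[OF conv c f(2)]] False)
    qed
    from Skorohod[OF pR qR this] obtain \<Omega> :: "real measure" and Y Y'
      where \<Omega>: "prob_space \<Omega>" and Y: "\<And>n. Y n \<in> borel_measurable \<Omega>" "\<And>n. distr \<Omega> borel (Y n) = p n"
        and Y': "Y' \<in> measurable \<Omega> lborel" "distr \<Omega> borel Y' = normalized v"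
        and lim: "\<And>x. x \<in> space \<Omega> \<Longrightarrow> (\<lambda>n. Y n x) \<longlonglongrightarrow> Y' x" by metis
    interpret \<Omega>: prob_space \<Omega> by fact
    interpret \<Omega>2: pair_prob_space \<Omega> \<Omega> ..
    have Ym[measurable]: "Y n \<in> borel_measurable \<Omega>" "Y' \<in> borel_measurable \<Omega>" for n using Y Y' by auto
    have [measurable]: "F \<in> borel_measurable (borel \<Otimes>\<^sub>M borel)" using Fm by (simp add: borel_prod)
    \<comment> \<open>Two independent copies of \<open>X\<close> on
      \<open>\<Omega> \<Otimes>\<^sub>M \<Omega>\<close> have the product law. Varying product
      measures are thereby traded for varying integrands on a fixed space, where dominated
      convergence applies.\<close>
    have push: "(\<integral>z. F z \<partial>(distr \<Omega> borel X \<Otimes>\<^sub>M distr \<Omega> borel X)) = (\<integral>z. F (X (fst z), X (snd z)) \<partial>(\<Omega> \<Otimes>\<^sub>M \<Omega>))"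
      if [measurable]: "X \<in> borel_measurable \<Omega>" for X
    proof -
      have "sigma_finite_measure (distr \<Omega> borel X)"
        using \<Omega>.prob_space_distr[OF that] by (simp add: prob_space_imp_sigma_finite)
      from pair_measure_distr[OF that that this] show ?thesis
        by (simp add: integral_distr case_prod_beta')
    qed
    have Fcomp: "(\<lambda>z. F (X (fst z), X (snd z))) \<in> borel_measurable (\<Omega> \<Otimes>\<^sub>M \<Omega>)"
      if [measurable]: "X \<in> borel_measurable \<Omega>" for X
      by (rule measurable_compose[of _ _ "borel \<Otimes>\<^sub>M borel" F]) measurable
    have "(\<lambda>n. \<integral>z. F (Y n (fst z), Y n (snd z)) \<partial>(\<Omega> \<Otimes>\<^sub>M \<Omega>)) \<longlonglongrightarrow> (\<integral>z. F (Y' (fst z), Y' (snd z)) \<partial>(\<Omega> \<Otimes>\<^sub>M \<Omega>))"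
    proof (rule integral_dominated_convergence)
      show "AE z in \<Omega> \<Otimes>\<^sub>M \<Omega>. (\<lambda>n. F (Y n (fst z), Y n (snd z))) \<longlonglongrightarrow> F (Y' (fst z), Y' (snd z))"
      proof (rule AE_I2)
        fix z assume "z \<in> space (\<Omega> \<Otimes>\<^sub>M \<Omega>)"
        then have "fst z \<in> space \<Omega>" "snd z \<in> space \<Omega>" by (auto simp: space_pair_measure)
        then have "(\<lambda>n. (Y n (fst z), Y n (snd z))) \<longlonglongrightarrow> (Y' (fst z), Y' (snd z))"
          by (intro tendsto_intros lim)
        then show "(\<lambda>n. F (Y n (fst z), Y n (snd z))) \<longlonglongrightarrow> F (Y' (fst z), Y' (snd z))"
          using F(1) by (intro continuous_on_tendsto_compose[OF F(1)]) auto
      qed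
      show "AE z in \<Omega> \<Otimes>\<^sub>M \<Omega>. norm (F (Y n (fst z), Y n (snd z))) \<le> G" for n using F(2) by auto
      show "integrable (\<Omega> \<Otimes>\<^sub>M \<Omega>) (\<lambda>z. G)" by simp
    qed (rule Fcomp[OF Ym(2)], rule Fcomp[OF Ym(1)])
    then have "(\<lambda>n. \<integral>z. F z \<partial>(p n \<Otimes>\<^sub>M p n)) \<longlonglongrightarrow> (\<integral>z. F z \<partial>(normalized v \<Otimes>\<^sub>M normalized v))"
      using push[of "Y _"] push[of Y'] Y Y' by simp
    then have "(\<lambda>n. (measure (u (n + N)) UNIV)\<^sup>2 * (\<integral>z. F z \<partial>(p n \<Otimes>\<^sub>M p n)))
        \<longlonglongrightarrow> (measure v UNIV)\<^sup>2 * (\<integral>z. F z \<partial>(normalized v \<Otimes>\<^sub>M normalized v))"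
      by (intro tendsto_intros mass')
    then have "(\<lambda>n. \<integral>z. F z \<partial>(u (n + N) \<Otimes>\<^sub>M u (n + N))) \<longlonglongrightarrow> (\<integral>z. F z \<partial>(v \<Otimes>\<^sub>M v))"
      unfolding p_def integral_pair_normalized[OF u N Fm] integral_pair_normalized[OF v pos Fm] .
    then show ?thesis by (rule LIMSEQ_offset)
  qed
qed

section \<open>Sequential compactness of measures and of paths\<close>

lemma weakly_conv_subseq:
  assumes "weakly_conv u v" "strict_mono r"
  shows "weakly_conv (\<lambda>n. u (r n)) v"
proof (rule weakly_convI)
  fix f :: "real \<Rightarrow> real" and G assume "continuous_on UNIV f" "\<And>x. \<bar>f x\<bar> \<le> G"
  from LIMSEQ_subseq_LIMSEQ[OF weakly_convD[OF assms(1) this] assms(2)]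
  show "(\<lambda>n. \<integral>x. f x \<partial>u (r n)) \<longlonglongrightarrow> (\<integral>x. f x \<partial>v)" by (simp add: o_def)
qed

text \<open>Total masses range over a compact interval, so they converge along a subsequence. With
  limit \<open>0\<close> the weak limit is the null measure; otherwise the normalized measures are
  tight because of the first moment, Helly's theorem gives a limit law, and the limit mass times
  this law is the limit.\<close>

lemma moment_le_weakly_compact:
  assumes u: "\<And>n. moment_le B (u n)" "\<And>n. measure (u n) {..<a} = 0"
  shows "\<exists>r v. strict_mono (r :: nat \<Rightarrow> nat) \<and> moment_le B v \<and> measure v {..<a} = 0 \<and> weakly_conv (\<lambda>n. u (r n)) v"
proof -
  have B: "0 \<le> B" by (rule moment_leD(6)[OF u(1)])
  have "\<forall>n. measure (u n) UNIV \<in> {0..B}" using moment_le_measure[OF u(1)] by simp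
  then obtain r1 m where r1: "strict_mono (r1 :: nat \<Rightarrow> nat)" "m \<in> {0..B}"
    and mass: "(\<lambda>n. measure (u (r1 n)) UNIV) \<longlonglongrightarrow> m"
    using compact_Icc[of 0 B] unfolding compact_def o_def by meson
  have "\<exists>r v. strict_mono (r :: nat \<Rightarrow> nat) \<and> sets v = sets borel \<and> finite_measure v \<and> weakly_conv (\<lambda>n. u (r n)) v"
  proof (cases "m = 0")
    case True
    have "weakly_conv (\<lambda>n. u (r1 n)) (null_measure borel)"
    proof (rule weakly_convI)
      fix f :: "real \<Rightarrow> real" and G assume f: "continuous_on UNIV f" "\<And>x. \<bar>f x\<bar> \<le> G"
      have fm: "f \<in> borel_measurable borel" by (rule borel_measurable_continuous_onI[OF f(1)])
      have bd: "\<bar>\<integral>x. f x \<partial>u n\<bar> \<le> G * measure (u n) UNIV" for n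
      proof -
        interpret finite_measure "u n" by (rule moment_leD[OF u(1)])
        have i: "integrable (u n) f" by (rule moment_le_integral_bounded(1)[OF u(1) fm f(2)])
        have "\<bar>\<integral>x. f x \<partial>u n\<bar> \<le> (\<integral>x. G \<partial>u n)"
          using Bochner_Integration.integral_norm_bound_integral[of "u n" f "\<lambda>_. G", OF i] f(2) by simp
        then show ?thesis using moment_leD(3)[OF u(1)[of n]] by (simp add: mult.commute)
      qed
      have lim: "(\<lambda>n. G * measure (u (r1 n)) UNIV) \<longlonglongrightarrow> 0"
        using tendsto_mult_left[OF mass, of G] True by simp
      have "(\<lambda>n. \<integral>x. f x \<partial>u (r1 n)) \<longlonglongrightarrow> 0"
      proof (rule Lim_null_comparison[OF _ lim], intro always_eventually allI)
        show "norm (\<integral>x. f x \<partial>u (r1 n)) \<le> G * measure (u (r1 n)) UNIV" for n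
          using bd by (simp only: real_norm_def)
      qed
      then show "(\<lambda>n. \<integral>x. f x \<partial>u (r1 n)) \<longlonglongrightarrow> (\<integral>x. f x \<partial>null_measure borel)" by simp
    qed
    moreover have "finite_measure (null_measure (borel :: real measure))" by (rule finite_measureI) simp
    ultimately show ?thesis using r1(1) by (intro exI[of _ r1] exI[of _ "null_measure borel"]) auto
  next
    case False
    then have m: "0 < m" using r1 by simp
    have "\<forall>\<^sub>F n in sequentially. m / 2 < measure (u (r1 n)) UNIV"
      using order_tendstoD(1)[OF mass, of "m / 2"] m by simp
    then obtain N where N: "\<And>n. m / 2 < measure (u (r1 (n + N))) UNIV"
      unfolding eventually_sequentially by (metis le_add2)
    define w where "w n = u (r1 (n + N))" for n
    have w: "moment_le B (w n)" "0 < measure (w n) UNIV" "m / 2 < measure (w n) UNIV" for n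
      unfolding w_def using u(1) N[of n] m by auto
    have wm: "(\<lambda>n. measure (w n) UNIV) \<longlonglongrightarrow> m" using LIMSEQ_ignore_initial_segment[OF mass] unfolding w_def .
    have pR: "real_distribution (normalized (w n))" for n by (rule real_distribution_normalized[OF w(1,2)])
    have "tight (\<lambda>n. normalized (w n))"
      unfolding tight_def
    proof (intro conjI allI impI pR)
      fix e :: real assume e: "0 < e"
      define R where "R = 2 * B / (m * e) + 1"
      have R: "0 < R" "2 * B / (m * e) < R" using B m e by (auto simp: R_def add_nonneg_pos)
      have "measure (normalized (w n)) {-R<..R} > 1 - e" for n
      proof -
        interpret real_distribution "normalized (w n)" by (rule pR)
        interpret w: finite_measure "w n" by (rule moment_leD[OF w(1)])
        note D = moment_leD[OF w(1)[of n]]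
        have ind: "indicat_real (- {-R<..R}) x \<le> 1 / R * (1 + \<bar>x\<bar>)" for x
          using R(1) by (auto simp: indicator_def field_simps)
        have "measure (w n) (- {-R<..R}) = (\<integral>x. indicator (- {-R<..R}) x \<partial>w n)" by (simp add: D(3))
        also have "\<dots> \<le> 1 / R * B"
          using moment_le_integral(2)[OF w(1), of "indicat_real (- {-R<..R})" "1 / R"] ind by simp
        finally have "measure (normalized (w n)) (- {-R<..R}) \<le> (1 / R * B) / measure (w n) UNIV"
          unfolding measure_normalized[OF w(1,2) borel_comp[OF greaterThanAtMost_borel]]
          by (intro divide_right_mono) auto
        also have "\<dots> \<le> (1 / R * B) / (m / 2)"
          using w(3)[of n] B R(1) m by (intro divide_left_mono) auto
        also have "\<dots> < e" using R m e by (simp add: field_simps)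
        finally show ?thesis using prob_compl[of "{-R<..R}"] by (simp add: Compl_eq_Diff_UNIV)
      qed
      then show "\<exists>a b. a < b \<and> (\<forall>n. 1 - e < measure (normalized (w n)) {a<..b})"
        using R(1) by (intro exI[of _ "-R"] exI[of _ R]) auto
    qed
    from tight_imp_convergent_subsubsequence[OF this strict_mono_id] obtain r2 M
      where r2: "strict_mono (r2 :: nat \<Rightarrow> nat)" and M: "real_distribution M"
        and wc: "weak_conv_m (\<lambda>n. normalized (w (r2 n))) M"
      by (auto simp: o_def)
    interpret M: real_distribution M by (rule M)
    define v where "v = density M (\<lambda>_. ennreal m)"
    have "weakly_conv (\<lambda>n. w (r2 n)) v"
    proof (rule weakly_convI)
      fix f :: "real \<Rightarrow> real" and G assume f: "continuous_on UNIV f" "\<And>x. \<bar>f x\<bar> \<le> G"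
      have fm: "f \<in> borel_measurable borel" by (rule borel_measurable_continuous_onI[OF f(1)])
      have fM: "f \<in> borel_measurable M" using fm measurable_cong_sets[OF M.events_eq_borel refl] by blast
      have "(\<lambda>n. \<integral>x. f x \<partial>normalized (w (r2 n))) \<longlonglongrightarrow> (\<integral>x. f x \<partial>M)"
        by (rule weak_conv_imp_integral_bdd_continuous_conv[OF pR M wc, of f G])
           (use f in \<open>auto simp: continuous_on_eq_continuous_at\<close>)
      then have "(\<lambda>n. measure (w (r2 n)) UNIV * (\<integral>x. f x \<partial>normalized (w (r2 n)))) \<longlonglongrightarrow> m * (\<integral>x. f x \<partial>M)"
        using LIMSEQ_subseq_LIMSEQ[OF wm r2] by (intro tendsto_mult) (simp_all add: o_def)
      moreover have "measure (w n) UNIV * (\<integral>x. f x \<partial>normalized (w n)) = (\<integral>x. f x \<partial>w n)" for n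
        using w(2)[of n] unfolding integral_normalized[OF w(1,2) fm] by simp
      moreover have "(\<integral>x. f x \<partial>v) = m * (\<integral>x. f x \<partial>M)"
        unfolding v_def using m fM by (simp add: integral_real_density)
      ultimately show "(\<lambda>n. \<integral>x. f x \<partial>w (r2 n)) \<longlonglongrightarrow> (\<integral>x. f x \<partial>v)" by simp
    qed
    moreover have "sets v = sets borel" unfolding v_def by simp
    moreover have "finite_measure v"
      unfolding v_def by (intro finite_measureI) (simp add: emeasure_density_const ennreal_mult_eq_top_iff)
    moreover have "strict_mono (\<lambda>n. r1 (r2 n + N))"
      using r1(1) r2 unfolding strict_mono_def by simp
    ultimately show ?thesis unfolding w_def by (intro exI[of _ "\<lambda>n. r1 (r2 n + N)"] exI[of _ v]) auto
  qed
  then obtain r v where r: "strict_mono (r :: nat \<Rightarrow> nat)" "sets v = sets borel" "finite_measure v"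
      "weakly_conv (\<lambda>n. u (r n)) v" by blast
  moreover have "moment_le B v" "measure v {..<a} = 0"
    using weak_limit_moment_le[OF _ _ r(2,3,4), of B a] u by auto
  ultimately show ?thesis by blast
qed

text \<open>An Arzela-Ascoli argument for paths with jumps: the jumps permitted by
  \<open>h n\<close> vanish in the limit, so convergence on a dense set of times carries over to all
  times.\<close>

lemma weakly_compact_paths:
  fixes v :: "nat \<Rightarrow> real \<Rightarrow> real measure" and h :: "nat \<Rightarrow> real"
  assumes T: "0 \<le> T" and A: "0 \<le> A" and h: "h \<longlonglongrightarrow> 0"
    and v: "\<And>n t. t \<in> {0..T} \<Longrightarrow> moment_le B (v n t)" "\<And>n t. t \<in> {0..T} \<Longrightarrow> measure (v n t) {..<a} = 0"
    and equi: "\<And>n s t (f :: real \<Rightarrow> real) G. s \<in> {0..T} \<Longrightarrow> t \<in> {0..T} \<Longrightarrow> f \<in> borel_measurable borel \<Longrightarrow> (\<And>x. \<bar>f x\<bar> \<le> G) \<Longrightarrow>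
      \<bar>(\<integral>x. f x \<partial>v n t) - (\<integral>x. f x \<partial>v n s)\<bar> \<le> (\<bar>t - s\<bar> + h n) * (A * G)"
  shows "\<exists>r w. strict_mono (r :: nat \<Rightarrow> nat) \<and> (\<forall>t\<in>{0..T}. moment_le B (w t) \<and> measure (w t) {..<a} = 0 \<and>
    weakly_conv (\<lambda>n. v (r n) t) (w t))"
proof -
  \<comment> \<open>Clamping the enumerated rationals keeps every sampling time in
    \<open>{0..T}\<close> and preserves density there.\<close>
  define q where "q i = max 0 (min T (from_nat_into \<rat> i))" for i
  have q: "q i \<in> {0..T}" for i using T by (auto simp: q_def)
  have dense: "\<exists>i. \<bar>q i - t\<bar> < d" if t: "t \<in> {0..T}" and d: "0 < d" for t d
  proof -
    obtain x where x: "x \<in> \<rat>" "t - d < x" "x < t + d" using Rats_dense_in_real[of "t - d" "t + d"] d by auto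
    obtain i where "from_nat_into \<rat> i = x"
      using x(1) countable_rat by (metis from_nat_into_surj)
    then have "\<bar>q i - t\<bar> < d" using x t unfolding q_def by (auto simp: max_def min_def)
    then show ?thesis ..
  qed
  let ?P = "\<lambda>i s. \<exists>x. weakly_conv (\<lambda>j. v (s j) (q i)) x"
  interpret subseqs ?P
  proof
    fix i and s :: "nat \<Rightarrow> nat" assume "strict_mono s"
    from moment_le_weakly_compact[of B "\<lambda>n. v (s n) (q i)" a] v q
    show "\<exists>r'. strict_mono r' \<and> ?P i (s \<circ> r')" unfolding o_def by blast
  qed
  have diag: "\<exists>x. weakly_conv (\<lambda>j. v (diagseq j) (q i)) x" for i
  proof -
    \<comment> \<open>Only the diagonal sequence beyond index \<open>i\<close> is a subsequence of
      the \<open>i\<close>-th selection; the initial segment is irrelevant for the limit.\<close>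
    have "?P i (diagseq \<circ> (+) (Suc i))"
      by (rule diagseq_holds) (use weakly_conv_subseq in \<open>fastforce simp: o_def\<close>)
    then obtain x where x: "weakly_conv (\<lambda>j. v (diagseq (j + Suc i)) (q i)) x"
      by (auto simp: o_def add.commute)
    have "weakly_conv (\<lambda>j. v (diagseq j) (q i)) x"
    proof (rule weakly_convI)
      fix f :: "real \<Rightarrow> real" and G assume f: "continuous_on UNIV f" "\<And>x. \<bar>f x\<bar> \<le> G"
      show "(\<lambda>j. \<integral>x. f x \<partial>v (diagseq j) (q i)) \<longlonglongrightarrow> (\<integral>y. f y \<partial>x)"
        by (rule LIMSEQ_offset[OF weakly_convD[OF x f]])
    qed
    then show ?thesis ..
  qed
  have hd: "(\<lambda>j. h (diagseq j)) \<longlonglongrightarrow> 0"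
    using LIMSEQ_subseq_LIMSEQ[OF h subseq_diagseq] by (simp add: o_def)
  have "\<exists>w. moment_le B w \<and> measure w {..<a} = 0 \<and> weakly_conv (\<lambda>j. v (diagseq j) t) w" if t: "t \<in> {0..T}" for t
  proof -
    from moment_le_weakly_compact[of B "\<lambda>n. v (diagseq n) t" a] v t obtain r w
      where r: "strict_mono (r :: nat \<Rightarrow> nat)" and w: "moment_le B w" "measure w {..<a} = 0"
        and conv: "weakly_conv (\<lambda>n. v (diagseq (r n)) t) w" by blast
    \<comment> \<open>Compactness supplies a candidate \<open>w\<close> along a further subsequence
      \<open>r\<close>, which depends on \<open>t\<close>. The Cauchy property along the common
      sequence, shown for each test function, identifies \<open>w\<close> as the limit of the whole
      sequence.\<close>
    have "weakly_conv (\<lambda>j. v (diagseq j) t) w"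
    proof (rule weakly_convI)
      fix f :: "real \<Rightarrow> real" and G assume f: "continuous_on UNIV f" "\<And>x. \<bar>f x\<bar> \<le> G"
      have fm: "f \<in> borel_measurable borel" by (rule borel_measurable_continuous_onI[OF f(1)])
      define X where "X s j = (\<integral>x. f x \<partial>v (diagseq j) s)" for s j
      have "Cauchy (X t)"
      proof (rule metric_CauchyI)
        fix e :: real assume e: "0 < e"
        \<comment> \<open>Time distance and jump size will each be below \<open>c\<close>, so
          passing from \<open>t\<close> to a sampled time costs at most
          \<open>2 * c * (A * G)\<close>; the \<open>1\<close> in the denominator guards against
          \<open>A * G = 0\<close>.\<close>
        define c where "c = e / (8 * (\<bar>A * G\<bar> + 1))"
        have c: "0 < c" "2 * c * (A * G) < e / 3"
        proof -
          show c0: "0 < c" using e by (simp add: c_def)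
          have "2 * c * (A * G) \<le> 2 * c * (\<bar>A * G\<bar> + 1)" using c0 by (intro mult_left_mono) auto
          also have "\<dots> = e / 4" by (simp add: c_def field_simps)
          finally show "2 * c * (A * G) < e / 3" using e by simp
        qed
        obtain i where i: "\<bar>q i - t\<bar> < c" using dense[OF t c(1)] by blast
        have AG: "0 \<le> A * G" using A f(2)[of 0] by simp
        have "convergent (X (q i))"
          using diag[of i] weakly_convD[OF _ f] unfolding X_def convergent_def by blast
        then have "Cauchy (X (q i))" by (rule convergent_Cauchy)
        then obtain M where M: "\<And>m n. m \<ge> M \<Longrightarrow> n \<ge> M \<Longrightarrow> \<bar>X (q i) m - X (q i) n\<bar> < e / 3"
          unfolding Cauchy_def dist_real_def using e by (meson divide_pos_pos zero_less_numeral)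
        obtain M' where M': "\<And>n. n \<ge> M' \<Longrightarrow> h (diagseq n) < c"
          using order_tendstoD(2)[OF hd c(1)] unfolding eventually_sequentially by blast
        have near: "\<bar>X t n - X (q i) n\<bar> < e / 3" if "n \<ge> M'" for n
        proof -
          have "\<bar>X t n - X (q i) n\<bar> \<le> (\<bar>t - q i\<bar> + h (diagseq n)) * (A * G)"
            unfolding X_def by (rule equi[OF q t fm f(2)])
          also have "\<dots> \<le> 2 * c * (A * G)"
            using M'[OF that] i AG by (intro mult_right_mono) auto
          finally show ?thesis using c(2) by simp
        qed
        show "\<exists>M. \<forall>m\<ge>M. \<forall>n\<ge>M. dist (X t m) (X t n) < e"
        proof (intro exI[of _ "max M M'"] allI impI)
          fix m n assume "max M M' \<le> m" "max M M' \<le> n"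
          then show "dist (X t m) (X t n) < e"
            using near[of m] near[of n] M[of m n] unfolding dist_real_def by (simp add: abs_if split: if_splits)
        qed
      qed
      then obtain L where L: "X t \<longlonglongrightarrow> L" using Cauchy_convergent convergent_def by blast
      have "(\<lambda>n. X t (r n)) \<longlonglongrightarrow> L" using LIMSEQ_subseq_LIMSEQ[OF L r] by (simp add: o_def)
      moreover have "(\<lambda>n. X t (r n)) \<longlonglongrightarrow> (\<integral>x. f x \<partial>w)" using weakly_convD[OF conv f] unfolding X_def .
      ultimately have "L = (\<integral>x. f x \<partial>w)" by (rule LIMSEQ_unique)
      then show "(\<lambda>n. \<integral>x. f x \<partial>v (diagseq n) t) \<longlonglongrightarrow> (\<integral>x. f x \<partial>w)" using L unfolding X_def by simp
    qed
    then show ?thesis using w by blast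
  qed
  then obtain w where "\<forall>t\<in>{0..T}. moment_le B (w t) \<and> measure (w t) {..<a} = 0 \<and> weakly_conv (\<lambda>j. v (diagseq j) t) (w t)"
    by metis
  then show ?thesis using subseq_diagseq by blast
qed

text \<open>Weak convergence of products handles only the kernel cut off at a fixed
  \<open>R\<close>. The rest is below \<open>e / 3\<close> on either side, uniformly in
  \<open>j\<close>, and once \<open>n j\<close> exceeds \<open>R\<close> the cutoff of the scheme
  does not affect the kernel cut off at \<open>R\<close>.\<close>

lemma (in sublinear_kernel) coag_form_weak_limit:
  assumes u: "\<And>j. moment_le B (u j)" and v: "moment_le B v" and conv: "weakly_conv u v"
    and n: "filterlim n at_top sequentially" "\<And>j. 0 \<le> n j"
    and g: "continuous_on UNIV g" "\<And>x. \<bar>g x\<bar> \<le> G"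
  shows "(\<lambda>j. coag_form (\<lambda>x y. min (k x y) (n j)) (u j) g) \<longlonglongrightarrow> coag_form k v g"
proof (rule LIMSEQ_I)
  fix e :: real assume e: "0 < e"
  have gm: "g \<in> borel_measurable borel" by (rule borel_measurable_continuous_onI[OF g(1)])
  have G0: "0 \<le> G" using g(2)[of 0] by simp
  define c where "c = e / (6 * (G * B\<^sup>2 + 1))"
  have GB: "0 \<le> G * B\<^sup>2" using G0 by simp
  have c: "0 < c" "3/2 * G * c * B\<^sup>2 < e / 3"
  proof -
    show c0: "0 < c" using e GB by (auto simp: c_def intro!: divide_pos_pos)
    have "3/2 * G * c * B\<^sup>2 = 3/2 * c * (G * B\<^sup>2)" by simp
    also have "\<dots> \<le> 3/2 * c * (G * B\<^sup>2 + 1)" using c0 by (intro mult_left_mono) auto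
    also have "\<dots> = e / 4" using GB by (simp add: c_def field_simps)
    finally show "3/2 * G * c * B\<^sup>2 < e / 3" using e by simp
  qed
  obtain R where R: "0 \<le> R" "\<And>x y. k x y \<le> R + c * ((1 + \<bar>x\<bar>) * (1 + \<bar>y\<bar>))" using growth[OF c(1)] by blast
  let ?F = "\<lambda>z. (g (fst z + snd z) - g (fst z) - g (snd z)) * min (k (fst z) (snd z)) R"
  have "(\<lambda>j. \<integral>z. ?F z \<partial>(u j \<Otimes>\<^sub>M u j)) \<longlonglongrightarrow> (\<integral>z. ?F z \<partial>(v \<Otimes>\<^sub>M v))"
  proof (rule weak_limit_pair[OF u v conv])
    have gc: "continuous_on UNIV (\<lambda>z. g (p z))" if "continuous_on UNIV p" for p :: "real \<times> real \<Rightarrow> real"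
      using continuous_on_compose[OF that continuous_on_subset[OF g(1)]] by (simp add: o_def)
    show "continuous_on UNIV ?F"
      by (intro continuous_intros gc cont)
    show "\<bar>?F z\<bar> \<le> 3 * G * R" for z
    proof -
      have "\<bar>g (fst z + snd z) - g (fst z) - g (snd z)\<bar> \<le> 3 * G"
        using g(2)[of "fst z + snd z"] g(2)[of "fst z"] g(2)[of "snd z"] by linarith
      then have "\<bar>g (fst z + snd z) - g (fst z) - g (snd z)\<bar> * \<bar>min (k (fst z) (snd z)) R\<bar> \<le> 3 * G * R"
        using G0 nonneg[of "fst z" "snd z"] R(1) by (intro mult_mono) auto
      then show ?thesis by (simp only: abs_mult)
    qed
  qed
  then have "(\<lambda>j. coag_form (\<lambda>x y. min (k x y) R) (u j) g) \<longlonglongrightarrow> coag_form (\<lambda>x y. min (k x y) R) v g"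
    unfolding coag_form_def by (intro tendsto_mult_left)
  from LIMSEQ_D[OF this, of "e / 3"] e obtain N1
    where N1: "\<And>j. j \<ge> N1 \<Longrightarrow> \<bar>coag_form (\<lambda>x y. min (k x y) R) (u j) g - coag_form (\<lambda>x y. min (k x y) R) v g\<bar> < e / 3"
    by auto
  have "\<forall>\<^sub>F j in sequentially. R \<le> n j" using n(1) by (simp add: filterlim_at_top)
  then obtain N2 where N2: "\<And>j. j \<ge> N2 \<Longrightarrow> R \<le> n j" unfolding eventually_sequentially by blast
  show "\<exists>N. \<forall>j\<ge>N. norm (coag_form (\<lambda>x y. min (k x y) (n j)) (u j) g - coag_form k v g) < e"
  proof (intro exI[of _ "max N1 N2"] allI impI)
    fix j assume j: "max N1 N2 \<le> j"
    have "min (min (k x y) (n j)) R = min (k x y) R" for x y using N2[of j] j by (auto simp: min_def)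
    then have "\<bar>coag_form (\<lambda>x y. min (k x y) (n j)) (u j) g - coag_form (\<lambda>x y. min (k x y) R) (u j) g\<bar> < e / 3"
      using coag_form_truncation[OF u dominated_min[OF n(2)] R c(1) gm g(2), of j j] c(2) by simp
    moreover have "\<bar>coag_form k v g - coag_form (\<lambda>x y. min (k x y) R) v g\<bar> < e / 3"
      using coag_form_truncation[OF v dominated_self R c(1) gm g(2)] c(2) by simp
    ultimately show "norm (coag_form (\<lambda>x y. min (k x y) (n j)) (u j) g - coag_form k v g) < e"
      using N1[of j] j unfolding real_norm_def by linarith
  qed
qed

subsection \<open>The limit flow\<close>

lemma floor_step:
  fixes h t :: real
  assumes "0 < h" "0 \<le> t"
  shows "real (nat \<lfloor>t / h\<rfloor>) * h \<le> t" "t < real (nat \<lfloor>t / h\<rfloor>) * h + h"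
proof -
  have eq: "real (nat \<lfloor>t / h\<rfloor>) = of_int \<lfloor>t / h\<rfloor>" using assms by simp
  show "real (nat \<lfloor>t / h\<rfloor>) * h \<le> t"
    unfolding eq by (subst pos_le_divide_eq[OF assms(1), symmetric]) (rule of_int_floor_le)
  have "t < (of_int \<lfloor>t / h\<rfloor> + 1) * h"
    by (subst pos_divide_less_eq[OF assms(1), symmetric]) (rule floor_correct[THEN conjunct2, simplified])
  then show "t < real (nat \<lfloor>t / h\<rfloor>) * h + h" unfolding eq by (simp add: distrib_right)
qed

context euler_scheme
begin

definition rate :: "real measure \<Rightarrow> (real \<Rightarrow> real) \<Rightarrow> real" where
  "rate v g = coag_form k v g + (\<integral>x. g x \<partial>\<eta>)"

text \<open>The approximations are constant between multiples of the step size, so each estimate is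
  inherited from the scheme up to one rounding step. The last clause is uniform in \<open>s\<close>
  and \<open>t\<close>, in either order, since it has to give both the derivative and the continuity
  of the rate.\<close>

lemma limit_flow_uniform:
  "\<exists>w A. (\<forall>t\<in>{0..T}. moment_le mass_bound (w t) \<and> measure (w t) {..<a} = 0) \<and>
    (\<forall>(g :: real \<Rightarrow> real) G. continuous_on UNIV g \<longrightarrow> (\<forall>x. \<bar>g x\<bar> \<le> G) \<longrightarrow>
      (\<integral>x. g x \<partial>w 0) = (\<integral>x. g x \<partial>f0) \<and>
      (\<forall>s\<in>{0..T}. \<forall>t\<in>{0..T}. \<bar>(\<integral>x. g x \<partial>w t) - (\<integral>x. g x \<partial>w s)\<bar> \<le> \<bar>t - s\<bar> * (A * G)) \<and>
      (\<forall>e>0. \<exists>d>0. \<forall>s\<in>{0..T}. \<forall>t\<in>{0..T}. \<bar>t - s\<bar> < d \<longrightarrow>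
        \<bar>(\<integral>x. g x \<partial>w t) - (\<integral>x. g x \<partial>w s) - (t - s) * rate (w s) g\<bar> \<le> e * \<bar>t - s\<bar>))"
proof -
  obtain D where D: "0 \<le> D" "\<And>x y. k x y \<le> D * ((1 + \<bar>x\<bar>) * (1 + \<bar>y\<bar>))" using linear_growth by blast
  define A where "A = 3/2 * D * mass_bound\<^sup>2 + m1"
  have A0: "0 \<le> A" using D m_nonneg by (simp add: A_def)
  \<comment> \<open>With cutoff height \<open>N\<close> this satisfies the step-size condition and
    tends to \<open>0\<close>; the added ones keep the denominator positive when
    \<open>N = 0\<close> or \<open>mass_bound = 0\<close>.\<close>
  define h where "h N = 1 / (real (Suc N) * (mass_bound + 1))" for N
  have h0: "0 < h N" for N using m_nonneg by (auto simp: h_def intro!: divide_pos_pos mult_pos_pos)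
  have hB: "h N * real N * mass_bound \<le> 1" for N
  proof -
    have "real N * mass_bound \<le> real (Suc N) * (mass_bound + 1)" using m_nonneg by (intro mult_mono) auto
    then show ?thesis using m_nonneg by (simp add: h_def divide_le_eq)
  qed
  have hlim: "h \<longlonglongrightarrow> 0"
  proof -
    have "(\<lambda>N. 1 / (mass_bound + 1) * (1 / real (Suc N))) \<longlonglongrightarrow> 1 / (mass_bound + 1) * 0"
      using LIMSEQ_inverse_real_of_nat by (intro tendsto_mult_left) (simp add: inverse_eq_divide)
    then show ?thesis by (simp add: h_def[abs_def] mult.commute)
  qed
  define J where "J N t = nat \<lfloor>t / h N\<rfloor>" for N t
  have J: "real (J N t) * h N \<le> t" "t < real (J N t) * h N + h N" if "0 \<le> t" for N t
    using floor_step[OF h0 that] unfolding J_def by auto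
  have Jmono: "J N s \<le> J N t" if "s \<le> t" for N s t
    unfolding J_def using that h0[of N] by (intro nat_mono floor_mono divide_right_mono) auto
  \<comment> \<open>Rounding both times down to the grid lengthens the interval by at most one
    step.\<close>
  have Jdiff: "(real (J N t) - real (J N s)) * h N \<le> t - s + h N" if "0 \<le> s" "0 \<le> t" for N s t
    using J[OF that(1), of N] J[OF that(2), of N] by (simp add: left_diff_distrib)
  define v where "v N t = euler_seq (\<lambda>x y. min (k x y) (real N)) (h N) \<eta> f0 (J N t)" for N t
  have JT: "real (J N t) * h N \<le> T" if "t \<in> {0..T}" for N t using J(1)[of t N] that by auto
  note ctx = of_nat_0_le_iff order_less_imp_le[OF h0] hB
  have vm: "moment_le mass_bound (v N t)" "measure (v N t) {..<a} = 0" if "t \<in> {0..T}" for N t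
    unfolding v_def using euler_seq_moment[OF ctx JT[OF that]] by auto
  have equi: "\<bar>(\<integral>x. g x \<partial>v N t) - (\<integral>x. g x \<partial>v N s)\<bar> \<le> (\<bar>t - s\<bar> + h N) * (A * G)"
    if st: "s \<in> {0..T}" "t \<in> {0..T}" and g: "g \<in> borel_measurable borel" "\<And>x. \<bar>g x :: real\<bar> \<le> G" for N s t g G
  proof -
    have G0: "0 \<le> G" using g(2)[of 0] by simp
    have *: "\<bar>(\<integral>x. g x \<partial>v N t) - (\<integral>x. g x \<partial>v N s)\<bar> \<le> (\<bar>t - s\<bar> + h N) * (A * G)"
      if st: "s \<in> {0..T}" "t \<in> {0..T}" "s \<le> t" for s t
    proof -
      have "\<bar>(\<integral>x. g x \<partial>v N t) - (\<integral>x. g x \<partial>v N s)\<bar> \<le> (real (J N t) - real (J N s)) * h N * (A * G)"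
        unfolding v_def A_def by (rule euler_seq_diff[OF ctx D(2) g Jmono[OF st(3)] JT[OF st(2)]])
      also have "\<dots> \<le> (\<bar>t - s\<bar> + h N) * (A * G)"
        using Jdiff[of s t N] st A0 G0 by (intro mult_right_mono) auto
      finally show ?thesis .
    qed
    show ?thesis
      using *[OF st] *[OF st(2,1)] by (cases "s \<le> t") (simp_all add: abs_minus_commute)
  qed
  from weakly_compact_paths[OF T A0 hlim vm equi] obtain r w
    where r: "strict_mono (r :: nat \<Rightarrow> nat)"
      and w: "\<And>t. t \<in> {0..T} \<Longrightarrow> moment_le mass_bound (w t) \<and> measure (w t) {..<a} = 0"
      and conv: "\<And>t. t \<in> {0..T} \<Longrightarrow> weakly_conv (\<lambda>N. v (r N) t) (w t)" by blast
  have hr: "(\<lambda>N. h (r N)) \<longlonglongrightarrow> 0" using LIMSEQ_subseq_LIMSEQ[OF hlim r] by (simp add: o_def)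
  have Jlim: "(\<lambda>N. real (J (r N) t) * h (r N)) \<longlonglongrightarrow> t" if t: "0 \<le> t" for t
  proof (rule tendsto_sandwich)
    show "(\<lambda>N. t - h (r N)) \<longlonglongrightarrow> t" using tendsto_diff[OF tendsto_const hr, of t] by simp
    show "(\<lambda>N. t) \<longlonglongrightarrow> t" by simp
  qed (use J[OF t] in \<open>auto intro!: always_eventually simp: diff_le_eq less_imp_le\<close>)
  have rn: "filterlim (\<lambda>N. real (r N)) at_top sequentially"
    using filterlim_compose[OF filterlim_real_sequentially filterlim_subseq[OF r]] .
  show ?thesis
  proof (rule exI[of _ w], rule exI[of _ A], intro conjI allI impI)
    show "\<forall>t\<in>{0..T}. moment_le mass_bound (w t) \<and> measure (w t) {..<a} = 0" using w by auto
    fix g :: "real \<Rightarrow> real" and G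
    assume g: "continuous_on UNIV g" and "\<forall>x. \<bar>g x\<bar> \<le> G"
    then have G: "\<And>x. \<bar>g x\<bar> \<le> G" by simp
    have gm: "g \<in> borel_measurable borel" by (rule borel_measurable_continuous_onI[OF g])
    have G0: "0 \<le> G" using G[of 0] by simp
    define X where "X N t = (\<integral>x. g x \<partial>v (r N) t)" for N t
    define Y where "Y t = (\<integral>x. g x \<partial>w t)" for t
    have XY: "(\<lambda>N. X N t) \<longlonglongrightarrow> Y t" if "t \<in> {0..T}" for t
      unfolding X_def Y_def by (rule weakly_convD[OF conv[OF that] g G])
    have "X N 0 = (\<integral>x. g x \<partial>f0)" for N unfolding X_def v_def J_def by simp
    then show "(\<integral>x. g x \<partial>w 0) = (\<integral>x. g x \<partial>f0)"
      using XY[of 0] T unfolding Y_def by (simp add: LIMSEQ_const_iff)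
    have "\<bar>(\<integral>x. g x \<partial>w t) - (\<integral>x. g x \<partial>w s)\<bar> \<le> \<bar>t - s\<bar> * (A * G)" if st: "s \<in> {0..T}" "t \<in> {0..T}" for s t
    proof (rule LIMSEQ_le)
      show "(\<lambda>N. \<bar>X N t - X N s\<bar>) \<longlonglongrightarrow> \<bar>(\<integral>x. g x \<partial>w t) - (\<integral>x. g x \<partial>w s)\<bar>"
        using XY st unfolding Y_def by (intro tendsto_intros)
      have "(\<lambda>N. (\<bar>t - s\<bar> + h (r N)) * (A * G)) \<longlonglongrightarrow> (\<bar>t - s\<bar> + 0) * (A * G)"
        by (intro tendsto_intros hr)
      then show "(\<lambda>N. (\<bar>t - s\<bar> + h (r N)) * (A * G)) \<longlonglongrightarrow> \<bar>t - s\<bar> * (A * G)" by simp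
      show "\<exists>N. \<forall>n\<ge>N. \<bar>X n t - X n s\<bar> \<le> (\<bar>t - s\<bar> + h (r n)) * (A * G)"
        unfolding X_def using equi[OF st gm G] by blast
    qed
    then show "\<forall>s\<in>{0..T}. \<forall>t\<in>{0..T}. \<bar>(\<integral>x. g x \<partial>w t) - (\<integral>x. g x \<partial>w s)\<bar> \<le> \<bar>t - s\<bar> * (A * G)" by blast
    fix e :: real assume e: "0 < e"
    \<comment> \<open>The error in \<open>euler_seq_rate\<close> has two summands. \<open>e'\<close>
      brings the one from the large values of the kernel below \<open>e / 2\<close>; this fixes
      \<open>R\<close>, and \<open>d\<close> is then chosen in terms of \<open>R\<close> for the
      other summand.\<close>
    define e' where "e' = e / (6 * (G * mass_bound\<^sup>2 + 1))"
    have GB: "0 \<le> G * mass_bound\<^sup>2" using G0 by simp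
    have e': "0 < e'" "3 * G * (e' * mass_bound\<^sup>2) \<le> e / 2"
    proof -
      show e'0: "0 < e'" using e GB by (auto simp: e'_def intro!: divide_pos_pos)
      have "3 * G * (e' * mass_bound\<^sup>2) = 3 * e' * (G * mass_bound\<^sup>2)" by simp
      also have "\<dots> \<le> 3 * e' * (G * mass_bound\<^sup>2 + 1)" using e'0 by (intro mult_left_mono) auto
      also have "\<dots> = e / 2" using GB by (simp add: e'_def field_simps)
      finally show "3 * G * (e' * mass_bound\<^sup>2) \<le> e / 2" .
    qed
    obtain R where R: "0 \<le> R" "\<And>x y. k x y \<le> R + e' * ((1 + \<bar>x\<bar>) * (1 + \<bar>y\<bar>))" using growth[OF e'(1)] by blast
    define d where "d = e / (6 * (G * R * A * mass_bound + 1))"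
    have GR: "0 \<le> G * R * A * mass_bound" using G0 R A0 m_nonneg by simp
    have d: "0 < d" "3 * G * (R * (d * A) * mass_bound) \<le> e / 2"
    proof -
      show d0: "0 < d" using e GR by (auto simp: d_def intro!: divide_pos_pos)
      have "3 * G * (R * (d * A) * mass_bound) = 3 * d * (G * R * A * mass_bound)" by simp
      also have "\<dots> \<le> 3 * d * (G * R * A * mass_bound + 1)" using d0 by (intro mult_left_mono) auto
      also have "\<dots> = e / 2" using GR by (simp add: d_def field_simps)
      finally show "3 * G * (R * (d * A) * mass_bound) \<le> e / 2" .
    qed
    \<comment> \<open>The reference time may be either end point: when \<open>t\<close> precedes
      \<open>s\<close>, the rate at \<open>s\<close> is the one at the right end.\<close>
    have dist: "\<bar>Y t - Y s - (t - s) * rate (w q) g\<bar> \<le> (t - s) * e"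
      if st: "s \<in> {0..T}" "t \<in> {0..T}" "s \<le> t" "t - s < d" and q: "q = s \<or> q = t" for s t q
    proof (rule LIMSEQ_le)
      let ?\<kappa> = "\<lambda>N x y. min (k x y) (real (r N))"
      let ?d = "\<lambda>N. (real (J (r N) t) - real (J (r N) s)) * h (r N)"
      let ?L = "\<lambda>N. \<bar>X N t - X N s - ?d N * (coag_form (?\<kappa> N) (v (r N) q) g + (\<integral>x. g x \<partial>\<eta>))\<bar>"
      have qT: "q \<in> {0..T}" using q st by auto
      have dl: "?d \<longlonglongrightarrow> t - s"
        using tendsto_diff[OF Jlim[of t] Jlim[of s]] st by (simp add: left_diff_distrib)
      show "?L \<longlonglongrightarrow> \<bar>Y t - Y s - (t - s) * rate (w q) g\<bar>"
        unfolding rate_def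
      proof (intro tendsto_intros XY st dl)
        show "(\<lambda>N. coag_form (?\<kappa> N) (v (r N) q) g) \<longlonglongrightarrow> coag_form k (w q) g"
          by (rule coag_form_weak_limit[OF vm(1)[OF qT] conjunct1[OF w[OF qT]] conv[OF qT] rn _ g G]) simp
      qed
      show "(\<lambda>N. ?d N * e) \<longlonglongrightarrow> (t - s) * e" by (intro tendsto_intros dl)
      have "\<forall>\<^sub>F N in sequentially. h (r N) < d - (t - s)" using order_tendstoD(2)[OF hr, of "d - (t - s)"] st by simp
      \<comment> \<open>Since \<open>t - s < d\<close> is strict, there is room for the rounding
        error, and the grid interval still has length at most \<open>d\<close>.\<close>
      then obtain N0 where N0: "\<And>N. N \<ge> N0 \<Longrightarrow> h (r N) < d - (t - s)" unfolding eventually_sequentially by blast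
      have "?L N \<le> ?d N * e" if N: "N \<ge> N0" for N
      proof -
        have "J (r N) s \<le> J (r N) q" "J (r N) q \<le> J (r N) t" using q st by (auto intro: Jmono)
        moreover have "?d N \<le> d" using Jdiff[of s t "r N"] N0[OF N] st by simp
        ultimately have "?L N \<le> ?d N * (3 * G * (R * (d * A) * mass_bound + e' * mass_bound\<^sup>2))"
          unfolding X_def v_def A_def
          by (rule euler_seq_rate[OF ctx D(2,1) R e'(1) gm G Jmono[OF st(3)] JT[OF st(2)]])
        also have "\<dots> \<le> ?d N * e"
        proof (rule mult_left_mono)
          show "3 * G * (R * (d * A) * mass_bound + e' * mass_bound\<^sup>2) \<le> e" using d(2) e'(2) unfolding distrib_left by linarith
        qed (use Jmono[OF st(3), of "r N"] h0[of "r N"] in auto)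
        finally show ?thesis .
      qed
      then show "\<exists>N0. \<forall>N\<ge>N0. ?L N \<le> ?d N * e" by blast
    qed
    have "\<bar>Y t - Y s - (t - s) * rate (w s) g\<bar> \<le> e * \<bar>t - s\<bar>"
      if st: "s \<in> {0..T}" "t \<in> {0..T}" "\<bar>t - s\<bar> < d" for s t
    proof (cases "s \<le> t")
      case True
      then show ?thesis using dist[of s t s] st by (simp add: mult.commute)
    next
      case False
      have "Y t - Y s - (t - s) * rate (w s) g = - (Y s - Y t - (s - t) * rate (w s) g)"
        by (simp add: algebra_simps)
      then show ?thesis
        using dist[of t s s] st False by (simp only: abs_minus) (simp add: mult.commute)
    qed
    then show "\<exists>d>0. \<forall>s\<in>{0..T}. \<forall>t\<in>{0..T}. \<bar>t - s\<bar> < d \<longrightarrow>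
        \<bar>(\<integral>x. g x \<partial>w t) - (\<integral>x. g x \<partial>w s) - (t - s) * rate (w s) g\<bar> \<le> e * \<bar>t - s\<bar>"
      using d(1) unfolding Y_def by blast
  qed
qed

end

section \<open>Calculus for time-dependent functionals\<close>

lemma moving_functional_derivative:
  fixes I R :: "real \<Rightarrow> 'a::real_normed_vector \<Rightarrow> real" and \<phi> :: "real \<Rightarrow> 'a"
  assumes lin: "\<And>t. t \<in> S \<Longrightarrow> linear (I t)" and C: "\<And>t x. t \<in> S \<Longrightarrow> \<bar>I t x\<bar> \<le> C * norm x"
    and lip: "\<And>s t x. s \<in> S \<Longrightarrow> t \<in> S \<Longrightarrow> \<bar>I t x - I s x\<bar> \<le> \<bar>t - s\<bar> * (A * norm x)"
    and diff: "\<And>x e. 0 < e \<Longrightarrow> \<exists>d>0. \<forall>s\<in>S. \<forall>t\<in>S. \<bar>t - s\<bar> < d \<longrightarrow> \<bar>I t x - I s x - (t - s) * R s x\<bar> \<le> e * \<bar>t - s\<bar>"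
    and \<phi>: "(\<phi> has_vector_derivative \<phi>') (at s within S)" and s: "s \<in> S"
  shows "((\<lambda>t. I t (\<phi> t)) has_vector_derivative (I s \<phi>' + R s (\<phi> s))) (at s within S)"
  unfolding has_vector_derivative_def has_derivative_within_alt
proof (intro conjI allI impI)
  show "bounded_linear (\<lambda>x. x *\<^sub>R (I s \<phi>' + R s (\<phi> s)))" by (rule bounded_linear_scaleR_left)
  fix e :: real assume e: "0 < e"
  define C' where "C' = \<bar>C\<bar> + 1"
  have C': "0 < C'" "C \<le> C'" by (auto simp: C'_def)
  define A' where "A' = \<bar>A * norm \<phi>'\<bar> + 1"
  have A': "0 < A'" "A * norm \<phi>' \<le> A'" by (auto simp: A'_def)
  from \<phi> have "\<forall>e>0. \<exists>d>0. \<forall>y\<in>S. norm (y - s) < d \<longrightarrow> norm (\<phi> y - \<phi> s - (y - s) *\<^sub>R \<phi>') \<le> e * norm (y - s)"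
    unfolding has_vector_derivative_def has_derivative_within_alt by simp
  moreover have "0 < e / (3 * C')" using e C' by simp
  ultimately obtain d1 where d1: "d1 > 0"
    "\<And>y. y \<in> S \<Longrightarrow> norm (y - s) < d1 \<Longrightarrow> norm (\<phi> y - \<phi> s - (y - s) *\<^sub>R \<phi>') \<le> e / (3 * C') * norm (y - s)" by blast
  obtain d2 where d2: "d2 > 0"
    "\<And>t. t \<in> S \<Longrightarrow> \<bar>t - s\<bar> < d2 \<Longrightarrow> \<bar>I t (\<phi> s) - I s (\<phi> s) - (t - s) * R s (\<phi> s)\<bar> \<le> e / 3 * \<bar>t - s\<bar>"
    using diff[of "e / 3" "\<phi> s"] e s by (metis divide_pos_pos zero_less_numeral)
  define d where "d = min (min d1 d2) (e / (3 * A'))"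
  have d: "0 < d" using d1 d2 e A' by (simp add: d_def)
  show "\<exists>d>0. \<forall>t\<in>S. norm (t - s) < d \<longrightarrow>
      norm (I t (\<phi> t) - I s (\<phi> s) - (t - s) *\<^sub>R (I s \<phi>' + R s (\<phi> s))) \<le> e * norm (t - s)"
  proof (intro exI[of _ d] conjI d ballI impI)
    fix t assume t: "t \<in> S" "norm (t - s) < d"
    \<comment> \<open>The derivative of \<open>I\<close> is given only at fixed vectors, hence this
      splitting: the remainder \<open>?r\<close> of \<open>\<phi>\<close> is controlled by the
      uniform bound \<open>C\<close>, the change of \<open>I\<close> on \<open>\<phi>'\<close> is of
      second order by the Lipschitz bound, and \<open>diff\<close> is applied at the fixed vector
      \<open>\<phi> s\<close>.\<close>
    let ?r = "\<phi> t - \<phi> s - (t - s) *\<^sub>R \<phi>'"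
    have "\<phi> t = \<phi> s + (t - s) *\<^sub>R \<phi>' + ?r" by simp
    then have "I t (\<phi> t) = I t (\<phi> s) + (t - s) * I t \<phi>' + I t ?r"
      using linear_add[OF lin[OF t(1)]] linear_scale[OF lin[OF t(1)]] by (metis real_scaleR_def)
    then have eq: "I t (\<phi> t) - I s (\<phi> s) - (t - s) *\<^sub>R (I s \<phi>' + R s (\<phi> s)) =
        I t ?r + (t - s) * (I t \<phi>' - I s \<phi>') + (I t (\<phi> s) - I s (\<phi> s) - (t - s) * R s (\<phi> s))"
      by (simp add: algebra_simps)
    have "\<bar>I t ?r\<bar> \<le> C' * norm ?r"
      using C[OF t(1), of ?r] mult_right_mono[OF C'(2) norm_ge_zero[of ?r]] by linarith
    also have "\<dots> \<le> C' * (e / (3 * C') * norm (t - s))"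
      using d1(2)[OF t(1)] t(2) C' by (intro mult_left_mono) (auto simp: d_def)
    also have "\<dots> = e / 3 * \<bar>t - s\<bar>" using C' by simp
    finally have 1: "\<bar>I t ?r\<bar> \<le> e / 3 * \<bar>t - s\<bar>" .
    have "\<bar>I t \<phi>' - I s \<phi>'\<bar> \<le> \<bar>t - s\<bar> * A'"
      using lip[OF s t(1), of \<phi>'] mult_left_mono[OF A'(2), of "\<bar>t - s\<bar>"] by linarith
    also have "\<dots> \<le> e / (3 * A') * A'" using t(2) A' by (intro mult_right_mono) (auto simp: d_def)
    also have "\<dots> = e / 3" using A' by simp
    finally have "\<bar>t - s\<bar> * \<bar>I t \<phi>' - I s \<phi>'\<bar> \<le> \<bar>t - s\<bar> * (e / 3)" by (intro mult_left_mono) auto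
    then have 2: "\<bar>(t - s) * (I t \<phi>' - I s \<phi>')\<bar> \<le> e / 3 * \<bar>t - s\<bar>" by (simp add: abs_mult mult.commute)
    have 3: "\<bar>I t (\<phi> s) - I s (\<phi> s) - (t - s) * R s (\<phi> s)\<bar> \<le> e / 3 * \<bar>t - s\<bar>"
      using d2(2)[OF t(1)] t(2) by (simp add: d_def)
    have "\<bar>I t (\<phi> t) - I s (\<phi> s) - (t - s) *\<^sub>R (I s \<phi>' + R s (\<phi> s))\<bar> \<le> e / 3 * \<bar>t - s\<bar> + e / 3 * \<bar>t - s\<bar> + e / 3 * \<bar>t - s\<bar>"
      unfolding eq using 1 2 3 by linarith
    then show "norm (I t (\<phi> t) - I s (\<phi> s) - (t - s) *\<^sub>R (I s \<phi>' + R s (\<phi> s))) \<le> e * norm (t - s)"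
      by simp
  qed
qed

text \<open>The uniform bound upgrades continuity at fixed vectors: in
  \<open>F t (\<phi> t - \<phi> s) + F t (\<phi> s)\<close> the first term is small by
  \<open>C\<close>, and the second has a fixed argument.\<close>

lemma moving_functional_continuous:
  fixes F :: "real \<Rightarrow> 'a::real_normed_vector \<Rightarrow> real" and \<phi> :: "real \<Rightarrow> 'a"
  assumes lin: "\<And>t. t \<in> S \<Longrightarrow> linear (F t)" and C: "\<And>t x. t \<in> S \<Longrightarrow> \<bar>F t x\<bar> \<le> C * norm x"
    and cont: "\<And>x. continuous_on S (\<lambda>t. F t x)" and \<phi>: "continuous_on S \<phi>"
  shows "continuous_on S (\<lambda>t. F t (\<phi> t))"
  unfolding continuous_on_def
proof
  fix s assume s: "s \<in> S"
  have "((\<lambda>t. F t (\<phi> t - \<phi> s)) \<longlongrightarrow> 0) (at s within S)"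
  proof (rule Lim_null_comparison)
    show "\<forall>\<^sub>F t in at s within S. norm (F t (\<phi> t - \<phi> s)) \<le> C * norm (\<phi> t - \<phi> s)"
      using C by (auto simp: eventually_at_filter)
    have "((\<lambda>t. C * norm (\<phi> t - \<phi> s)) \<longlongrightarrow> C * norm (\<phi> s - \<phi> s)) (at s within S)"
      using \<phi> s by (intro tendsto_intros) (auto simp: continuous_on_def)
    then show "((\<lambda>t. C * norm (\<phi> t - \<phi> s)) \<longlongrightarrow> 0) (at s within S)" by simp
  qed
  moreover have "((\<lambda>t. F t (\<phi> s)) \<longlongrightarrow> F s (\<phi> s)) (at s within S)"
    using cont s by (auto simp: continuous_on_def)
  ultimately have "((\<lambda>t. F t (\<phi> t - \<phi> s) + F t (\<phi> s)) \<longlongrightarrow> 0 + F s (\<phi> s)) (at s within S)"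
    by (rule tendsto_add)
  moreover have "\<forall>\<^sub>F t in at s within S. F t (\<phi> t - \<phi> s) + F t (\<phi> s) = F t (\<phi> t)"
    using linear_diff[OF lin] by (auto simp: eventually_at_filter)
  ultimately show "((\<lambda>t. F t (\<phi> t)) \<longlongrightarrow> F s (\<phi> s)) (at s within S)"
    using tendsto_cong by fastforce
qed

text \<open>Adding the estimates at \<open>(s, t)\<close> and \<open>(t, s)\<close> cancels the
  increments of \<open>I\<close> and leaves \<open>(t - s) * (R t - R s)\<close>. Continuity of the
  collision rate in time thus comes from the flow, not from an estimate of the rate.\<close>

lemma difference_quotient_continuous:
  fixes I R :: "real \<Rightarrow> real"
  assumes "\<And>e. 0 < e \<Longrightarrow> \<exists>d>0. \<forall>s\<in>S. \<forall>t\<in>S. \<bar>t - s\<bar> < d \<longrightarrow> \<bar>I t - I s - (t - s) * R s\<bar> \<le> e * \<bar>t - s\<bar>"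
  shows "continuous_on S R"
  unfolding continuous_on_iff
proof (intro ballI allI impI)
  fix s e :: real assume s: "s \<in> S" and e: "0 < e"
  from assms[of "e / 3"] e obtain d where d: "0 < d"
    "\<And>s t. s \<in> S \<Longrightarrow> t \<in> S \<Longrightarrow> \<bar>t - s\<bar> < d \<Longrightarrow> \<bar>I t - I s - (t - s) * R s\<bar> \<le> e / 3 * \<bar>t - s\<bar>"
    by (metis divide_pos_pos zero_less_numeral)
  show "\<exists>d>0. \<forall>t\<in>S. dist t s < d \<longrightarrow> dist (R t) (R s) < e"
  proof (intro exI[of _ d] conjI d ballI impI)
    fix t assume t: "t \<in> S" "dist t s < d"
    show "dist (R t) (R s) < e"
    proof (cases "t = s")
      case True
      then show ?thesis using e by simp
    next
      case False
      have "\<bar>I t - I s - (t - s) * R s\<bar> \<le> e / 3 * \<bar>t - s\<bar>" "\<bar>I s - I t - (s - t) * R t\<bar> \<le> e / 3 * \<bar>t - s\<bar>"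
        using d(2)[OF s t(1)] d(2)[OF t(1) s] t(2) by (auto simp: dist_real_def abs_minus_commute)
      moreover have "(t - s) * (R t - R s) = (I t - I s - (t - s) * R s) + (I s - I t - (s - t) * R t)"
        by (simp add: algebra_simps)
      ultimately have "\<bar>t - s\<bar> * \<bar>R t - R s\<bar> \<le> \<bar>t - s\<bar> * (2 * (e / 3))"
        unfolding abs_mult[symmetric]
        using abs_triangle_ineq[of "I t - I s - (t - s) * R s" "I s - I t - (s - t) * R t"]
        unfolding mult.commute[of "\<bar>t - s\<bar>" "2 * (e / 3)"] by linarith
      then have "\<bar>R t - R s\<bar> \<le> 2 * (e / 3)" using False by simp
      then show ?thesis using e by (simp add: dist_real_def)
    qed
  qed
qed

lemma moment_le_integral_linear:
  assumes v: "moment_le b v"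
  shows "linear (\<lambda>\<psi> :: real \<Rightarrow>\<^sub>C real. \<integral>x. \<psi> x \<partial>v)" "\<bar>\<integral>x. (\<psi> :: real \<Rightarrow>\<^sub>C real) x \<partial>v\<bar> \<le> b * norm \<psi>"
proof -
  have m: "apply_bcontfun \<psi> \<in> borel_measurable borel" for \<psi> :: "real \<Rightarrow>\<^sub>C real"
    by (intro borel_measurable_continuous_onI continuous_on_apply_bcontfun continuous_on_id)
  have bd: "\<bar>\<psi> x\<bar> \<le> norm \<psi>" for x and \<psi> :: "real \<Rightarrow>\<^sub>C real" using norm_bounded[of \<psi> x] by simp
  note i = moment_le_integral_bounded[OF v m bd]
  show "linear (\<lambda>\<psi> :: real \<Rightarrow>\<^sub>C real. \<integral>x. \<psi> x \<partial>v)"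
    by (rule linearI) (simp_all add: plus_bcontfun.rep_eq scaleR_bcontfun.rep_eq i)
  show "\<bar>\<integral>x. (\<psi> :: real \<Rightarrow>\<^sub>C real) x \<partial>v\<bar> \<le> b * norm \<psi>"
    using i(2)[of \<psi>] by (simp only: mult.commute)
qed

lemma (in sublinear_kernel) coag_form_linear:
  assumes v: "moment_le b v" and D: "\<And>x y. k x y \<le> D * ((1 + \<bar>x\<bar>) * (1 + \<bar>y\<bar>))"
  shows "linear (\<lambda>\<psi> :: real \<Rightarrow>\<^sub>C real. coag_form k v \<psi>)"
    "\<bar>coag_form k v (apply_bcontfun \<psi>)\<bar> \<le> (3/2 * D * b\<^sup>2) * norm \<psi>"
proof -
  have m: "apply_bcontfun \<psi> \<in> borel_measurable borel" for \<psi> :: "real \<Rightarrow>\<^sub>C real"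
    by (intro borel_measurable_continuous_onI continuous_on_apply_bcontfun continuous_on_id)
  have bd: "\<bar>\<psi> x\<bar> \<le> norm \<psi>" for x and \<psi> :: "real \<Rightarrow>\<^sub>C real" using norm_bounded[of \<psi> x] by simp
  have km: "(\<lambda>z. k (fst z) (snd z)) \<in> borel_measurable borel" by (rule borel_measurable_continuous_onI[OF cont])
  note i = coag_form_integrable_bound[OF v km nonneg D m bd]
  show "linear (\<lambda>\<psi> :: real \<Rightarrow>\<^sub>C real. coag_form k v \<psi>)"
  proof (rule linearI)
    fix \<psi> \<psi>' :: "real \<Rightarrow>\<^sub>C real" and c :: real
    show "coag_form k v (apply_bcontfun (\<psi> + \<psi>')) = coag_form k v \<psi> + coag_form k v \<psi>'"
      unfolding coag_form_def plus_bcontfun.rep_eq distrib_left[symmetric] Bochner_Integration.integral_add[OF i(1) i(1), symmetric]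
      by (simp add: algebra_simps)
    have "(\<lambda>z. (c * \<psi> (fst z + snd z) - c * \<psi> (fst z) - c * \<psi> (snd z)) * k (fst z) (snd z))
      = (\<lambda>z. c * ((\<psi> (fst z + snd z) - \<psi> (fst z) - \<psi> (snd z)) * k (fst z) (snd z)))"
      by (simp add: algebra_simps)
    then show "coag_form k v (apply_bcontfun (c *\<^sub>R \<psi>)) = c *\<^sub>R coag_form k v \<psi>"
      unfolding coag_form_def scaleR_bcontfun.rep_eq by simp
  qed
  show "\<bar>coag_form k v (apply_bcontfun \<psi>)\<bar> \<le> (3/2 * D * b\<^sup>2) * norm \<psi>"
    using i(2)[of \<psi>] by (simp add: mult_ac)
qed

context euler_scheme
begin

text \<open>A test path is a moving vector in the space of bounded continuous functions and the flow
  a moving functional on it. The product rule differentiates their pairing; continuity in time of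
  all three terms of the derivative justifies the fundamental theorem of calculus and the splitting
  of the integral.\<close>

theorem weak_solution_exists:
  "\<exists>w. (\<forall>t\<in>{0..T}. moment_le mass_bound (w t) \<and> measure (w t) {..<a} = 0) \<and>
    (\<forall>\<psi> :: real \<Rightarrow>\<^sub>C real. continuous_on {0..T} (\<lambda>t. \<integral>x. \<psi> x \<partial>w t)) \<and>
    (\<forall>(\<phi> :: real \<Rightarrow> real \<Rightarrow>\<^sub>C real) (\<phi>' :: real \<Rightarrow> real \<Rightarrow>\<^sub>C real).
      (\<forall>t\<in>{0..T}. (\<phi> has_vector_derivative \<phi>' t) (at t within {0..T})) \<longrightarrow> continuous_on {0..T} \<phi>' \<longrightarrow>
      (\<forall>t\<in>{0..T}. (\<integral>x. apply_bcontfun (\<phi> t) x \<partial>w t) - (\<integral>x. apply_bcontfun (\<phi> 0) x \<partial>f0) =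
        (LINT s:{0..t}|lborel. (\<integral>x. apply_bcontfun (\<phi>' s) x \<partial>w s)) + (LINT s:{0..t}|lborel. coag_form k (w s) (apply_bcontfun (\<phi> s)))
        + (LINT s:{0..t}|lborel. (\<integral>x. apply_bcontfun (\<phi> s) x \<partial>\<eta>))))"
proof -
  obtain D where D: "0 \<le> D" "\<And>x y. k x y \<le> D * ((1 + \<bar>x\<bar>) * (1 + \<bar>y\<bar>))" using linear_growth by blast
  obtain w A where w: "\<And>t. t \<in> {0..T} \<Longrightarrow> moment_le mass_bound (w t) \<and> measure (w t) {..<a} = 0"
    and flow: "\<And>(g :: real \<Rightarrow> real) G. continuous_on UNIV g \<Longrightarrow> (\<And>x. \<bar>g x\<bar> \<le> G) \<Longrightarrow>
      (\<integral>x. g x \<partial>w 0) = (\<integral>x. g x \<partial>f0) \<and>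
      (\<forall>s\<in>{0..T}. \<forall>t\<in>{0..T}. \<bar>(\<integral>x. g x \<partial>w t) - (\<integral>x. g x \<partial>w s)\<bar> \<le> \<bar>t - s\<bar> * (A * G)) \<and>
      (\<forall>e>0. \<exists>d>0. \<forall>s\<in>{0..T}. \<forall>t\<in>{0..T}. \<bar>t - s\<bar> < d \<longrightarrow>
        \<bar>(\<integral>x. g x \<partial>w t) - (\<integral>x. g x \<partial>w s) - (t - s) * rate (w s) g\<bar> \<le> e * \<bar>t - s\<bar>)"
    using limit_flow_uniform by blast
  have c: "continuous_on UNIV (apply_bcontfun \<psi>)" for \<psi> :: "real \<Rightarrow>\<^sub>C real"
    by (intro continuous_on_apply_bcontfun continuous_on_id)
  have bd: "\<bar>\<psi> x\<bar> \<le> norm \<psi>" for x and \<psi> :: "real \<Rightarrow>\<^sub>C real" using norm_bounded[of \<psi> x] by simp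
  note fl = flow[OF c bd]
  define I where "I t \<psi> = (\<integral>x. \<psi> x \<partial>w t)" for t and \<psi> :: "real \<Rightarrow>\<^sub>C real"
  define R where "R t \<psi> = rate (w t) \<psi>" for t and \<psi> :: "real \<Rightarrow>\<^sub>C real"
  have lin: "linear (I t)" "\<bar>I t \<psi>\<bar> \<le> mass_bound * norm \<psi>" if "t \<in> {0..T}" for t \<psi>
    unfolding I_def using moment_le_integral_linear w[OF that] by auto
  have lip: "\<bar>I t \<psi> - I s \<psi>\<bar> \<le> \<bar>t - s\<bar> * (A * norm \<psi>)" if "s \<in> {0..T}" "t \<in> {0..T}" for s t \<psi>
    unfolding I_def using fl[of \<psi>] that by blast
  have diff: "\<exists>d>0. \<forall>s\<in>{0..T}. \<forall>t\<in>{0..T}. \<bar>t - s\<bar> < d \<longrightarrow> \<bar>I t \<psi> - I s \<psi> - (t - s) * R s \<psi>\<bar> \<le> e * \<bar>t - s\<bar>"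
    if "0 < e" for e \<psi>
    unfolding I_def R_def using fl[of \<psi>] that by blast
  have Ic: "continuous_on {0..T} (\<lambda>t. I t \<psi>)" for \<psi>
  proof (rule continuous_onI)
    fix s e assume s: "s \<in> {0..T}" and e: "(0::real) < e"
    have p: "0 < \<bar>A * norm \<psi>\<bar> + 1" by simp
    show "\<exists>d>0. \<forall>t\<in>{0..T}. dist t s < d \<longrightarrow> dist (I t \<psi>) (I s \<psi>) \<le> e"
    proof (intro exI[of _ "e / (\<bar>A * norm \<psi>\<bar> + 1)"] conjI ballI impI)
      show "0 < e / (\<bar>A * norm \<psi>\<bar> + 1)" using e p by (rule divide_pos_pos)
      fix t assume t: "t \<in> {0..T}" "dist t s < e / (\<bar>A * norm \<psi>\<bar> + 1)"
      have "\<bar>I t \<psi> - I s \<psi>\<bar> \<le> \<bar>t - s\<bar> * (A * norm \<psi>)" by (rule lip[OF s t(1)])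
      also have "\<dots> \<le> \<bar>t - s\<bar> * (\<bar>A * norm \<psi>\<bar> + 1)" by (intro mult_left_mono) auto
      also have "\<dots> \<le> e" using t(2) p by (simp only: pos_less_divide_eq dist_real_def)
      finally show "dist (I t \<psi>) (I s \<psi>) \<le> e" by (simp add: dist_real_def)
    qed
  qed
  have Rc: "continuous_on {0..T} (\<lambda>t. R t \<psi>)" for \<psi>
    using difference_quotient_continuous[of "{0..T}" "\<lambda>t. I t \<psi>" "\<lambda>t. R t \<psi>"] diff[of _ \<psi>] by blast
  have Qc: "continuous_on {0..T} (\<lambda>t. coag_form k (w t) (apply_bcontfun \<psi>))" for \<psi>
  proof -
    \<comment> \<open>The source term is constant in time, so the continuity of the rate passes to
      its collision part.\<close>
    have "continuous_on {0..T} (\<lambda>t. R t \<psi> - (\<integral>x. \<psi> x \<partial>\<eta>))" by (intro continuous_intros Rc)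
    then show ?thesis by (simp add: R_def rate_def)
  qed
  show ?thesis
  proof (rule exI[of _ w], intro conjI allI impI ballI)
    show "moment_le mass_bound (w t)" "measure (w t) {..<a} = 0" if "t \<in> {0..T}" for t using w[OF that] by auto
    show "continuous_on {0..T} (\<lambda>t. \<integral>x. \<psi> x \<partial>w t)" for \<psi> :: "real \<Rightarrow>\<^sub>C real" using Ic[of \<psi>] unfolding I_def .
    fix \<phi> \<phi>' :: "real \<Rightarrow> real \<Rightarrow>\<^sub>C real" and t
    assume der: "\<forall>t\<in>{0..T}. (\<phi> has_vector_derivative \<phi>' t) (at t within {0..T})"
      and c': "continuous_on {0..T} \<phi>'" and t: "t \<in> {0..T}"
    have sub: "{0..t} \<subseteq> {0..T}" using t by auto
    have \<phi>c: "continuous_on {0..T} \<phi>"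
      unfolding continuous_on_eq_continuous_within using der has_vector_derivative_continuous by blast
    have c1: "continuous_on {0..t} (\<lambda>s. I s (\<phi>' s))"
      by (rule continuous_on_subset[OF moving_functional_continuous[OF lin Ic c'] sub])
    have c2: "continuous_on {0..t} (\<lambda>s. coag_form k (w s) (apply_bcontfun (\<phi> s)))"
      using moving_functional_continuous[where F = "\<lambda>t \<psi>. coag_form k (w t) (apply_bcontfun \<psi>)", OF _ _ Qc \<phi>c]
        coag_form_linear[OF _ D(2)] w continuous_on_subset[OF _ sub] by blast
    have c3: "continuous_on {0..t} (\<lambda>s. \<integral>x. apply_bcontfun (\<phi> s) x \<partial>\<eta>)"
      by (rule continuous_on_subset[OF moving_functional_continuous[where F = "\<lambda>t \<psi>. \<integral>x. apply_bcontfun \<psi> x \<partial>\<eta>",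
        OF moment_le_integral_linear[OF \<eta>(1)] continuous_on_const \<phi>c] sub])
    have "(LINT s:{0..t}|lborel. I s (\<phi>' s) + R s (\<phi> s)) = I t (\<phi> t) - I 0 (\<phi> 0)"
      unfolding set_lebesgue_integral_def
    proof (rule integral_FTC_atLeastAtMost)
      show "0 \<le> t" using t by simp
      show "continuous_on {0..t} (\<lambda>s. I s (\<phi>' s) + R s (\<phi> s))"
        unfolding R_def rate_def by (intro continuous_intros c1 c2 c3)
      fix s assume "0 \<le> s" "s \<le> t"
      then have s: "s \<in> {0..T}" using t by auto
      show "((\<lambda>t. I t (\<phi> t)) has_vector_derivative (I s (\<phi>' s) + R s (\<phi> s))) (at s within {0..t})"
        by (rule has_vector_derivative_within_subset[OF moving_functional_derivative[OF lin lip diff bspec[OF der s] s] sub])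
    qed
    moreover have "(LINT s:{0..t}|lborel. I s (\<phi>' s) + R s (\<phi> s)) =
      (LINT s:{0..t}|lborel. I s (\<phi>' s)) + ((LINT s:{0..t}|lborel. coag_form k (w s) (apply_bcontfun (\<phi> s))) + (LINT s:{0..t}|lborel. (\<integral>x. apply_bcontfun (\<phi> s) x \<partial>\<eta>)))"
      unfolding R_def rate_def
      using borel_integrable_atLeastAtMost'[OF c1] borel_integrable_atLeastAtMost'[OF c2] borel_integrable_atLeastAtMost'[OF c3]
      by (simp add: set_integral_add)
    moreover have "I 0 (\<phi> 0) = (\<integral>x. apply_bcontfun (\<phi> 0) x \<partial>f0)" unfolding I_def using fl[of "\<phi> 0"] by blast
    ultimately show "(\<integral>x. apply_bcontfun (\<phi> t) x \<partial>w t) - (\<integral>x. apply_bcontfun (\<phi> 0) x \<partial>f0) =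
        (LINT s:{0..t}|lborel. (\<integral>x. apply_bcontfun (\<phi>' s) x \<partial>w s)) + (LINT s:{0..t}|lborel. coag_form k (w s) (apply_bcontfun (\<phi> s)))
        + (LINT s:{0..t}|lborel. (\<integral>x. apply_bcontfun (\<phi> s) x \<partial>\<eta>))"
      unfolding I_def by simp
  qed
qed

end

subsection \<open>Measures on the half-line\<close>

text \<open>Each point outside the support has an open null neighbourhood; by Lindelof's theorem
  countably many of these have the same union as all of them, and that union is null.\<close>

lemma support_subset_null:
  assumes \<mu>: "\<mu> \<in> bounded_radon_measures" and supp: "measure_support \<mu> \<subseteq> {a..}"
  shows "emeasure \<mu> {0<..<a} = 0"
proof -
  have sets: "sets \<mu> = sets (restrict_space borel {0<..})" using \<mu> by (simp add: bounded_radon_measures_def)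
  define \<F> where "\<F> = {U :: real set. open U \<and> emeasure \<mu> (U \<inter> {0<..}) = 0}"
  obtain \<G> where \<G>: "\<G> \<subseteq> \<F>" "countable \<G>" "\<Union>\<G> = \<Union>\<F>"
    using Lindelof[of \<F>] unfolding \<F>_def by blast
  have meas: "U \<inter> {0<..} \<in> sets \<mu>" if "open U" for U :: "real set"
    using that unfolding sets by (auto simp: sets_restrict_space Int_commute)
  have "emeasure \<mu> (\<Union>U\<in>\<G>. U \<inter> {0<..}) = 0"
  proof -
    have "(\<Union>U\<in>\<G>. U \<inter> {0<..}) \<in> null_sets \<mu>"
      using \<G>(1,2) meas by (intro null_sets_UN') (auto simp: \<F>_def null_sets_def)
    then show ?thesis by auto
  qed
  moreover have "{0<..<a} \<subseteq> (\<Union>U\<in>\<G>. U \<inter> {0<..})"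
  proof
    fix x assume x: "x \<in> {0<..<a}"
    then have "x \<notin> measure_support \<mu>" using supp by auto
    then obtain U where "open U" "x \<in> U" "emeasure \<mu> (U \<inter> {0<..}) = 0"
      using x unfolding measure_support_def by auto
    then have "x \<in> \<Union>\<F>" unfolding \<F>_def by blast
    then have "x \<in> \<Union>\<G>" using \<G>(3) by simp
    then show "x \<in> (\<Union>U\<in>\<G>. U \<inter> {0<..})" using x by auto
  qed
  moreover have "(\<Union>U\<in>\<G>. U \<inter> {0<..}) \<in> sets \<mu>"
    using \<G>(1,2) meas by (intro sets.countable_UN') (auto simp: \<F>_def)
  ultimately show ?thesis by (metis emeasure_mono le_zero_eq)
qed

lemma extend_to_line:
  assumes \<mu>: "\<mu> \<in> bounded_radon_measures" "moment 1 \<mu> < \<infinity>" "measure_support \<mu> \<subseteq> {a..}"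
  defines "\<nu> \<equiv> distr \<mu> borel (\<lambda>x. x)"
  shows "moment_le (\<integral>x. 1 + \<bar>x\<bar> \<partial>\<nu>) \<nu>" "measure \<nu> {..<a} = 0"
    and "\<And>\<psi> :: real \<Rightarrow>\<^sub>C real. (\<integral>x. \<psi> x \<partial>\<nu>) = (\<integral>x. \<psi> x \<partial>\<mu>)"
proof -
  have sets: "sets \<mu> = sets (restrict_space borel {0<..})" and "finite_measure \<mu>"
    using \<mu>(1) by (auto simp: bounded_radon_measures_def)
  interpret \<mu>: finite_measure \<mu> by fact
  have sp: "space \<mu> = {0<..}" using sets_eq_imp_space_eq[OF sets] by (simp add: space_restrict_space)
  have id: "(\<lambda>x. x) \<in> measurable \<mu> borel"
    unfolding measurable_cong_sets[OF sets refl] by (rule measurable_restrict_space1) simp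
  have bm: "f \<in> borel_measurable \<mu>" if "f \<in> borel_measurable borel" for f :: "real \<Rightarrow> real"
    using measurable_compose[OF id that] by simp
  have "(\<integral>\<^sup>+x. ennreal \<bar>x\<bar> \<partial>\<mu>) = moment 1 \<mu>"
    unfolding moment_def by (rule nn_integral_cong) (simp add: sp)
  then have i: "integrable \<mu> (\<lambda>x. \<bar>x\<bar>)"
    using \<mu>(2) bm[of abs] by (intro integrableI_nonneg) auto
  have "integrable \<nu> (\<lambda>x. 1 + \<bar>x\<bar>)"
    unfolding \<nu>_def using i by (subst integrable_distr_eq[OF id]) auto
  moreover have "finite_measure \<nu>" unfolding \<nu>_def by (rule \<mu>.finite_measure_distr[OF id])
  ultimately show "moment_le (\<integral>x. 1 + \<bar>x\<bar> \<partial>\<nu>) \<nu>" unfolding moment_le_def by (simp add: \<nu>_def)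
  have "measure \<nu> {..<a} = measure \<mu> {0<..<a}"
    unfolding \<nu>_def by (subst measure_distr[OF id]) (auto simp: sp intro!: arg_cong[where f = "measure \<mu>"])
  then show "measure \<nu> {..<a} = 0" using support_subset_null[OF \<mu>(1,3)] by (simp add: measure_def)
  show "(\<integral>x. \<psi> x \<partial>\<nu>) = (\<integral>x. \<psi> x \<partial>\<mu>)" for \<psi> :: "real \<Rightarrow>\<^sub>C real"
    unfolding \<nu>_def
    by (rule integral_distr[OF id]) (intro borel_measurable_continuous_onI continuous_on_apply_bcontfun)
qed

text \<open>For a measure concentrated on \<open>[a,\<infinity>)\<close> this is the restriction to the half-line; as an image
  measure it turns the kernel \<open>K\<close> into its continuation \<open>K (max a x) (max a y)\<close>.\<close>

definition clamp_measure :: "real \<Rightarrow> real measure \<Rightarrow> real measure" where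
  "clamp_measure a w = distr w (restrict_space borel {0<..}) (\<lambda>x. max a x)"

context
  fixes a b :: real and w :: "real measure"
  assumes a: "0 < a" and w: "moment_le b w" "measure w {..<a} = 0"
begin

lemma max_measurable: "(\<lambda>x. max a x) \<in> measurable w (restrict_space borel {0<..})"
  unfolding measurable_cong_sets[OF moment_leD(1)[OF w(1)] refl]
  using a by (intro measurable_restrict_space2) auto

lemma AE_ge: "AE x in w. a \<le> x"
  using w(2) measure_null_cong[OF w(1)] by simp

lemma space_clamp: "space (clamp_measure a w) = {0<..}"
  unfolding clamp_measure_def by (simp add: space_restrict_space)

lemma integral_clamp:
  fixes g :: "real \<Rightarrow> real"
  assumes g: "g \<in> borel_measurable borel"
  shows "(\<integral>x. g x \<partial>clamp_measure a w) = (\<integral>x. g (max a x) \<partial>w)" "(\<integral>x. g (max a x) \<partial>w) = (\<integral>x. g x \<partial>w)"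
proof -
  show "(\<integral>x. g x \<partial>clamp_measure a w) = (\<integral>x. g (max a x) \<partial>w)"
    unfolding clamp_measure_def by (rule integral_distr[OF max_measurable measurable_restrict_space1[OF g]])
  have m: "(\<lambda>x. g (max a x)) \<in> borel_measurable w" "g \<in> borel_measurable w"
    unfolding measurable_cong_sets[OF moment_leD(1)[OF w(1)] refl] using g by measurable
  show "(\<integral>x. g (max a x) \<partial>w) = (\<integral>x. g x \<partial>w)"
    by (rule integral_cong_AE[OF m]) (use AE_ge in \<open>auto simp: max_absorb2 elim!: eventually_mono\<close>)
qed

lemma clamp_measure_bounded: "clamp_measure a w \<in> bounded_radon_measures"
  unfolding bounded_radon_measures_def clamp_measure_def
  using finite_measure.finite_measure_distr[OF moment_leD(2)[OF w(1)] max_measurable] by simp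

lemma support_clamp: "measure_support (clamp_measure a w) \<subseteq> {a..}"
proof
  fix x assume x: "x \<in> measure_support (clamp_measure a w)"
  show "x \<in> {a..}"
  proof (rule ccontr)
    assume "x \<notin> {a..}"
    then have "0 < emeasure (clamp_measure a w) ({..<a} \<inter> {0<..})"
      using x unfolding measure_support_def by auto
    moreover have "emeasure (clamp_measure a w) ({..<a} \<inter> {0<..}) = emeasure w {}"
      unfolding clamp_measure_def
    proof (subst emeasure_distr[OF max_measurable])
      show "{..<a} \<inter> {0<..} \<in> sets (restrict_space borel {0<..})" by (auto simp: sets_restrict_space)
      have "(\<lambda>x. max a x) -` ({..<a} \<inter> {0<..}) \<inter> space w = {}" by auto
      then show "emeasure w ((\<lambda>x. max a x) -` ({..<a} \<inter> {0<..}) \<inter> space w) = emeasure w {}" by (simp only:)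
    qed
    ultimately show False by simp
  qed
qed

text \<open>In \<open>y powr p = y powr (p - 1) * y\<close> the first factor is nonincreasing for
  \<open>p \<le> 1\<close> and largest at \<open>a\<close>, so every power up to \<open>1\<close>,
  negative ones included, is bounded by the first moment.\<close>

lemma moment_clamp:
  assumes p: "p \<le> 1"
  shows "moment p (clamp_measure a w) \<le> ennreal (a powr (p - 1) * (a + 1) * b)"
proof -
  define C where "C = a powr (p - 1) * (a + 1)"
  have C0: "0 \<le> C" using a by (simp add: C_def)
  have "moment p (clamp_measure a w) = (\<integral>\<^sup>+x. ennreal ((max a x) powr p) \<partial>w)"
    unfolding moment_def clamp_measure_def
    by (subst nn_integral_distr[OF max_measurable]) (auto intro!: measurable_restrict_space1)
  also have "\<dots> \<le> (\<integral>\<^sup>+x. ennreal (C * (1 + \<bar>x\<bar>)) \<partial>w)"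
  proof (intro nn_integral_mono ennreal_leI)
    fix x :: real
    have y: "0 < max a x" using a by auto
    have "(max a x) powr p = (max a x) powr (p - 1) * max a x"
      using y by (simp add: powr_diff)
    also have "\<dots> \<le> a powr (p - 1) * ((a + 1) * (1 + \<bar>x\<bar>))"
    proof (rule mult_mono)
      show "(max a x) powr (p - 1) \<le> a powr (p - 1)" using a p by (intro powr_mono2') auto
      have "0 \<le> a * \<bar>x\<bar>" using a by simp
      then show "max a x \<le> (a + 1) * (1 + \<bar>x\<bar>)" using a unfolding distrib_left distrib_right max_def by simp
    qed (use a in auto)
    finally show "(max a x) powr p \<le> C * (1 + \<bar>x\<bar>)" by (simp add: C_def mult.assoc)
  qed
  also have "\<dots> = ennreal (\<integral>x. C * (1 + \<bar>x\<bar>) \<partial>w)"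
    using moment_leD(4)[OF w(1)] C0 by (intro nn_integral_eq_integral) auto
  also have "\<dots> \<le> ennreal (C * b)"
    using moment_leD(5)[OF w(1)] C0 by (intro ennreal_leI) (simp only: integral_mult_right_zero mult_left_mono)
  finally show ?thesis unfolding C_def .
qed

end

section \<open>Sublinear growth of the kernel away from zero\<close>

lemma sublinear_powr:
  fixes p e :: real
  assumes p: "0 < p" "p < 1" and e: "0 < e"
  shows "\<exists>R\<ge>0. \<forall>s>0. s powr p \<le> R + e * s"
proof -
  \<comment> \<open>\<open>S\<close> solves \<open>S powr (p - 1) = e\<close>. Up to
    \<open>S\<close> the power is at most \<open>S powr p\<close>; beyond it the negative exponent
    gives \<open>s powr (p - 1) \<le> e\<close>.\<close>
  define S where "S = e powr (1 / (p - 1))"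
  have S: "0 < S" using e by (simp add: S_def)
  have Sp: "S powr (p - 1) = e" using e p by (simp add: S_def powr_powr)
  have "s powr p \<le> S powr p + e * s" if s: "0 < s" for s
  proof (cases "s \<le> S")
    case True
    then have "s powr p \<le> S powr p" using s p by (intro powr_mono2) auto
    then show ?thesis using e s by (simp add: add_increasing2)
  next
    case False
    have "s powr (p - 1) \<le> e" unfolding Sp[symmetric] using False S p by (intro powr_mono2') auto
    then have "s powr (p - 1) * s \<le> e * s" using s by (intro mult_right_mono) auto
    moreover have "s powr (p - 1) * s = s powr p" using s by (simp add: powr_diff)
    ultimately show ?thesis by (simp add: add_increasing)
  qed
  then show ?thesis by (intro exI[of _ "S powr p"]) auto
qed

text \<open>Dividing by \<open>a\<close> brings both variables to \<open>[1,\<infinity>)\<close>,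
  where powers increase with the exponent. Both exponents can then be raised to a common
  \<open>p < 1\<close>, and the product becomes \<open>(X * Y) powr p\<close>, a sublinear function
  of one variable that is at most a multiple of the product weight.\<close>

lemma clamped_kernel_growth:
  fixes a \<alpha> \<beta> e :: real
  assumes a: "0 < a" and \<alpha>: "\<alpha> < 1" and \<beta>: "\<beta> < 1" and e: "0 < e"
  shows "\<exists>R\<ge>0. \<forall>x y. (max a x) powr \<alpha> * (max a y) powr \<beta> \<le> R + e * ((1 + \<bar>x\<bar>) * (1 + \<bar>y\<bar>))"
proof -
  \<comment> \<open>The \<open>1 / 2\<close> keeps \<open>p\<close> positive even when neither
    exponent is.\<close>
  define p where "p = max (1 / 2) (max \<alpha> \<beta>)"
  have p: "0 < p" "p < 1" "\<alpha> \<le> p" "\<beta> \<le> p" using \<alpha> \<beta> by (auto simp: p_def)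
  \<comment> \<open>\<open>c\<close> collects the power of \<open>a\<close> from the rescaling and
    the constant comparing \<open>X * Y\<close> with the product weight, so that
    \<open>e / c\<close> in the one-variable bound ends up as \<open>e\<close>.\<close>
  define c where "c = a powr (\<alpha> + \<beta>) * ((a + 1)\<^sup>2 / a\<^sup>2)"
  have c: "0 < c" using a by (simp add: c_def)
  obtain R where R: "0 \<le> R" "\<And>s. 0 < s \<Longrightarrow> s powr p \<le> R + e / c * s"
    using sublinear_powr[OF p(1,2), of "e / c"] e c by auto
  have "(max a x) powr \<alpha> * (max a y) powr \<beta> \<le> a powr (\<alpha> + \<beta>) * R + e * ((1 + \<bar>x\<bar>) * (1 + \<bar>y\<bar>))" for x y
  proof -
    define X where "X = max a x / a"
    define Y where "Y = max a y / a"
    have X: "1 \<le> X" "max a x = a * X" and Y: "1 \<le> Y" "max a y = a * Y" using a by (auto simp: X_def Y_def)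
    have le: "max a z \<le> (a + 1) * (1 + \<bar>z\<bar>)" for z
    proof -
      have "0 \<le> a * \<bar>z\<bar>" using a by simp
      then show ?thesis using a unfolding distrib_left distrib_right max_def by simp
    qed
    have XY: "X * Y \<le> (a + 1)\<^sup>2 / a\<^sup>2 * ((1 + \<bar>x\<bar>) * (1 + \<bar>y\<bar>))"
    proof -
      have "max a x * max a y \<le> ((a + 1) * (1 + \<bar>x\<bar>)) * ((a + 1) * (1 + \<bar>y\<bar>))"
        using a by (intro mult_mono le) auto
      then have "max a x * max a y / a\<^sup>2 \<le> ((a + 1) * (1 + \<bar>x\<bar>)) * ((a + 1) * (1 + \<bar>y\<bar>)) / a\<^sup>2"
        using a by (intro divide_right_mono) auto
      then show ?thesis by (simp add: X_def Y_def power2_eq_square mult_ac)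
    qed
    have "X powr \<alpha> * Y powr \<beta> \<le> X powr p * Y powr p"
      using X Y p by (intro mult_mono powr_mono) auto
    also have "\<dots> = (X * Y) powr p" using X Y by (simp add: powr_mult)
    also have "\<dots> \<le> R + e / c * (X * Y)" using X Y by (intro R) (auto intro: mult_pos_pos)
    also have "\<dots> \<le> R + e / c * ((a + 1)\<^sup>2 / a\<^sup>2 * ((1 + \<bar>x\<bar>) * (1 + \<bar>y\<bar>)))"
      using XY e c by (intro add_left_mono mult_left_mono) auto
    finally have "a powr (\<alpha> + \<beta>) * (X powr \<alpha> * Y powr \<beta>)
      \<le> a powr (\<alpha> + \<beta>) * (R + e / c * ((a + 1)\<^sup>2 / a\<^sup>2 * ((1 + \<bar>x\<bar>) * (1 + \<bar>y\<bar>))))"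
      by (intro mult_left_mono) auto
    moreover have "P * (R + t * (q * W)) = P * R + t * (P * q) * W" for P t q W :: real
      by (simp add: algebra_simps)
    moreover have "e / c * (a powr (\<alpha> + \<beta>) * ((a + 1)\<^sup>2 / a\<^sup>2)) = e" unfolding c_def[symmetric] using c by simp
    moreover have "a powr (\<alpha> + \<beta>) * (X powr \<alpha> * Y powr \<beta>) = (max a x) powr \<alpha> * (max a y) powr \<beta>"
      unfolding X(2) Y(2) using a X Y by (simp add: powr_mult powr_add mult_ac)
    ultimately show ?thesis by (simp only:)
  qed
  then show ?thesis using R(1) a by (intro exI[of _ "a powr (\<alpha> + \<beta>) * R"]) auto
qed

context
  fixes K :: "real \<Rightarrow> real \<Rightarrow> real" and a :: real
  assumes K_cont: "continuous_on ({0<..} \<times> {0<..}) (\<lambda>(x, y). K x y)" and a: "0 < a"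
begin

text \<open>The constant continuation below \<open>a\<close> makes the kernel continuous on the whole plane, and the weak
  formulation only sees its symmetric part.\<close>

definition clamped_kernel :: "real \<Rightarrow> real \<Rightarrow> real" where
  "clamped_kernel x y = (K (max a x) (max a y) + K (max a y) (max a x)) / 2"

lemma clamped_continuous:
  "continuous_on UNIV (\<lambda>z. K (max a (fst z)) (max a (snd z)))"
  "continuous_on UNIV (\<lambda>z. K (max a (snd z)) (max a (fst z)))"
proof -
  have "continuous_on UNIV (\<lambda>z. (\<lambda>(x, y). K x y) (max a (fst z), max a (snd z)))"
    by (rule continuous_on_compose2[OF K_cont]) (use a in \<open>auto intro!: continuous_intros simp: less_max_iff_disj\<close>)
  then show "continuous_on UNIV (\<lambda>z. K (max a (fst z)) (max a (snd z)))" by simp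
  have "continuous_on UNIV (\<lambda>z. (\<lambda>(x, y). K x y) (max a (snd z), max a (fst z)))"
    by (rule continuous_on_compose2[OF K_cont]) (use a in \<open>auto intro!: continuous_intros simp: less_max_iff_disj\<close>)
  then show "continuous_on UNIV (\<lambda>z. K (max a (snd z)) (max a (fst z)))" by simp
qed

lemma clamped_kernel_continuous: "continuous_on UNIV (\<lambda>z. clamped_kernel (fst z) (snd z))"
  unfolding clamped_kernel_def by (intro continuous_intros clamped_continuous) simp

text \<open>The clamped measures are pulled back to the line; the clamping of the arguments
  disappears almost everywhere because \<open>w\<close> lives on \<open>[a,\<infinity>)\<close>; and
  \<open>K\<close> may be symmetrized because the other factor is symmetric. The factor
  \<open>2\<close> undoes the \<open>1/2\<close> in \<open>coag_form\<close>.\<close>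

lemma integral_clamp_coag_form:
  fixes \<psi> :: "real \<Rightarrow>\<^sub>C real"
  assumes w: "moment_le b w" "measure w {..<a} = 0"
    and K0: "\<And>x y. 0 < x \<Longrightarrow> 0 < y \<Longrightarrow> 0 \<le> K x y"
    and D: "\<And>x y. clamped_kernel x y \<le> D * ((1 + \<bar>x\<bar>) * (1 + \<bar>y\<bar>))"
  shows "(\<integral>y. (\<integral>x. (\<psi> (x + y) - \<psi> x - \<psi> y) * K x y \<partial>clamp_measure a w) \<partial>clamp_measure a w) =
    2 * coag_form clamped_kernel w \<psi>"
proof -
  note Dw = moment_leD[OF w(1)]
  interpret w: finite_measure w by fact
  interpret ww: pair_sigma_finite w w ..
  have s: "sets (w \<Otimes>\<^sub>M w) = sets (borel :: (real \<times> real) measure)"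
    unfolding sets_pair_measure_cong[OF Dw(1) Dw(1)] borel_prod ..
  define H where "H z = \<psi> (fst z + snd z) - \<psi> (fst z) - \<psi> (snd z)" for z
  \<comment> \<open>\<open>K\<close> is regular only on the open quadrant; its extension by zero is
    a Borel function on the plane with the same values there.\<close>
  define K0 where "K0 z = indicator ({0<..} \<times> {0<..}) z *\<^sub>R K (fst z) (snd z)" for z :: "real \<times> real"
  define m where "m z = (max a (fst z), max a (snd z))" for z :: "real \<times> real"
  have \<psi>m[measurable]: "apply_bcontfun \<psi> \<in> borel_measurable borel"
    by (intro borel_measurable_continuous_onI continuous_on_apply_bcontfun)
  have Hm[measurable]: "H \<in> borel_measurable borel"
    unfolding H_def borel_prod[symmetric] by measurable
  have "open ({0<..} \<times> {0<..} :: (real \<times> real) set)" by (intro open_Times) auto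
  then have K0m[measurable]: "K0 \<in> borel_measurable borel"
    unfolding K0_def using K_cont by (intro borel_measurable_continuous_on_indicator) (auto simp: case_prod_beta')
  have Fm: "(\<lambda>z. H z * K0 z) \<in> borel_measurable (borel \<Otimes>\<^sub>M borel)" unfolding borel_prod by measurable
  have pos: "0 < max a x" for x using a by auto
  have "(\<integral>y. (\<integral>x. (\<psi> (x + y) - \<psi> x - \<psi> y) * K x y \<partial>clamp_measure a w) \<partial>clamp_measure a w)
      = (\<integral>y. (\<integral>x. H (x, y) * K0 (x, y) \<partial>clamp_measure a w) \<partial>clamp_measure a w)"
    by (intro Bochner_Integration.integral_cong refl)
       (simp add: space_clamp[OF a w] H_def K0_def)
  also have "\<dots> = (\<integral>y. (\<integral>x. H (max a x, y) * K0 (max a x, y) \<partial>w) \<partial>clamp_measure a w)"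
  proof (rule Bochner_Integration.integral_cong[OF refl], rule integral_clamp(1)[OF a w])
    show "(\<lambda>x. H (x, y) * K0 (x, y)) \<in> borel_measurable borel" for y
      using measurable_compose[OF _ Fm, of "\<lambda>x. (x, y)" borel] by simp
  qed
  also have "\<dots> = (\<integral>y. (\<integral>x. H (max a x, max a y) * K0 (max a x, max a y) \<partial>w) \<partial>w)"
  proof (rule integral_clamp(1)[OF a w, where g = "\<lambda>y. \<integral>x. H (max a x, y) * K0 (max a x, y) \<partial>w"])
    have "(\<lambda>(y, x). H (max a x, y) * K0 (max a x, y)) \<in> borel_measurable (borel \<Otimes>\<^sub>M borel)"
      using measurable_compose[OF _ Fm, of "\<lambda>z. (max a (snd z), fst z)" "borel \<Otimes>\<^sub>M borel"] by (simp add: case_prod_beta')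
    then have "(\<lambda>(y, x). H (max a x, y) * K0 (max a x, y)) \<in> borel_measurable (borel \<Otimes>\<^sub>M w)"
      using measurable_cong_sets[OF sets_pair_measure_cong[OF refl Dw(1)] refl] by blast
    from w.borel_measurable_lebesgue_integral[OF this]
    show "(\<lambda>y. \<integral>x. H (max a x, y) * K0 (max a x, y) \<partial>w) \<in> borel_measurable borel" by simp
  qed
  also have "\<dots> = (\<integral>y. (\<integral>x. H (m (x, y)) * K (max a x) (max a y) \<partial>w) \<partial>w)"
    by (simp add: K0_def m_def pos)
  finally have eq1: "(\<integral>y. (\<integral>x. (\<psi> (x + y) - \<psi> x - \<psi> y) * K x y \<partial>clamp_measure a w) \<partial>clamp_measure a w)
    = (\<integral>y. (\<integral>x. H (m (x, y)) * K (max a x) (max a y) \<partial>w) \<partial>w)" .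
  have bd: "\<bar>H z\<bar> \<le> 3 * norm \<psi>" for z
    using norm_bounded[of \<psi> "fst z + snd z"] norm_bounded[of \<psi> "fst z"] norm_bounded[of \<psi> "snd z"]
    unfolding H_def real_norm_def by linarith
  \<comment> \<open>The two values averaged by \<open>clamped_kernel\<close> are nonnegative, so
    each is at most twice the average.\<close>
  have KD: "0 \<le> K (max a x) (max a y)" "K (max a x) (max a y) \<le> 2 * (D * ((1 + \<bar>x\<bar>) * (1 + \<bar>y\<bar>)))" for x y
    using K0[OF pos[of x] pos[of y]] K0[OF pos[of y] pos[of x]] D[of x y] unfolding clamped_kernel_def by auto
  let ?K1 = "\<lambda>z. K (max a (fst z)) (max a (snd z))" and ?K2 = "\<lambda>z. K (max a (snd z)) (max a (fst z))"
  have Km[measurable]: "?K1 \<in> borel_measurable borel" "?K2 \<in> borel_measurable borel"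
    by (intro borel_measurable_continuous_onI clamped_continuous)+
  have mm: "m \<in> borel_measurable borel" unfolding m_def
    by (intro borel_measurable_continuous_onI continuous_intros)
  have Hmm[measurable]: "(\<lambda>z. H (m z)) \<in> borel_measurable borel" using measurable_compose[OF mm Hm] .
  have le: "\<bar>h * K (max a x) (max a y)\<bar> \<le> 6 * norm \<psi> * D * ((1 + \<bar>x\<bar>) * (1 + \<bar>y\<bar>))" if "\<bar>h\<bar> \<le> 3 * norm \<psi>" for h x y
  proof -
    have "\<bar>h\<bar> * \<bar>K (max a x) (max a y)\<bar> \<le> 3 * norm \<psi> * (2 * (D * ((1 + \<bar>x\<bar>) * (1 + \<bar>y\<bar>))))"
      using that KD[of x y] by (intro mult_mono) auto
    then show ?thesis by (simp add: abs_mult algebra_simps)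
  qed
  have i0: "integrable (w \<Otimes>\<^sub>M w) (\<lambda>z. H (m z) * ?K1 z)"
    by (rule moment_le_pair(1)[OF w(1) w(1), where C = "6 * norm \<psi> * D"]) (measurable, use le[OF bd] in simp)
  have i1: "integrable (w \<Otimes>\<^sub>M w) (\<lambda>z. H z * ?K1 z)"
    by (rule moment_le_pair(1)[OF w(1) w(1), where C = "6 * norm \<psi> * D"]) (measurable, use le[OF bd] in simp)
  have Hsym: "H (y, x) = H (x, y)" for x y by (simp add: H_def add.commute)
  have i2: "integrable (w \<Otimes>\<^sub>M w) (\<lambda>z. H z * ?K2 z)"
    using ww.integrable_product_swap[OF i1] Hsym by (simp add: case_prod_beta')
  have eq2: "(\<integral>z. H z * ?K2 z \<partial>(w \<Otimes>\<^sub>M w)) = (\<integral>z. H z * ?K1 z \<partial>(w \<Otimes>\<^sub>M w))"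
    using ww.integral_product_swap[OF borel_measurable_integrable[OF i1]] Hsym by (simp add: case_prod_beta')
  have "(\<integral>y. (\<integral>x. H (m (x, y)) * K (max a x) (max a y) \<partial>w) \<partial>w) = (\<integral>z. H (m z) * ?K1 z \<partial>(w \<Otimes>\<^sub>M w))"
    using ww.integral_snd[of "\<lambda>x y. H (m (x, y)) * K (max a x) (max a y)"] i0 by (simp add: case_prod_beta')
  also have "\<dots> = (\<integral>z. H z * ?K1 z \<partial>(w \<Otimes>\<^sub>M w))"
  proof (rule integral_cong_AE)
    have ge: "AE x in w. a \<le> x" using w(2) measure_null_cong[OF w(1)] by simp
    have "AE z in w \<Otimes>\<^sub>M w. a \<le> fst z \<and> a \<le> snd z"
    proof (rule ww.AE_pair_measure)
      have "{z \<in> space (w \<Otimes>\<^sub>M w). a \<le> fst z \<and> a \<le> snd z} = {a..} \<times> {a..}"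
        using Dw(3) by (auto simp: space_pair_measure)
      moreover have "{a..} \<times> {a..} \<in> sets (w \<Otimes>\<^sub>M w)" using Dw(1) by (intro pair_measureI) auto
      ultimately show "{z \<in> space (w \<Otimes>\<^sub>M w). a \<le> fst z \<and> a \<le> snd z} \<in> sets (w \<Otimes>\<^sub>M w)" by simp
      show "AE x in w. AE y in w. a \<le> fst (x, y) \<and> a \<le> snd (x, y)"
        using ge by eventually_elim (use ge in simp)
    qed
    then show "AE z in w \<Otimes>\<^sub>M w. H (m z) * ?K1 z = H z * ?K1 z"
      by eventually_elim (auto simp: m_def max_absorb2)
  qed (use i0 i1 in auto)
  also have "\<dots> = (\<integral>z. H z * clamped_kernel (fst z) (snd z) \<partial>(w \<Otimes>\<^sub>M w))"
  proof -
    have "(\<lambda>z. H z * clamped_kernel (fst z) (snd z)) = (\<lambda>z. 1/2 * (H z * ?K1 z + H z * ?K2 z))"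
      unfolding clamped_kernel_def by (simp add: field_simps)
    then have "(\<integral>z. H z * clamped_kernel (fst z) (snd z) \<partial>(w \<Otimes>\<^sub>M w)) = (\<integral>z. 1/2 * (H z * ?K1 z + H z * ?K2 z) \<partial>(w \<Otimes>\<^sub>M w))"
      by (simp only:)
    also have "\<dots> = 1/2 * ((\<integral>z. H z * ?K1 z \<partial>(w \<Otimes>\<^sub>M w)) + (\<integral>z. H z * ?K2 z \<partial>(w \<Otimes>\<^sub>M w)))"
      by (simp only: integral_mult_right_zero Bochner_Integration.integral_add[OF i1 i2])
    finally show ?thesis unfolding eq2 by simp
  qed
  finally show ?thesis unfolding eq1 coag_form_def H_def by simp
qed

end

theorem proposition3p2:
  fixes K :: "real \<Rightarrow> real \<Rightarrow> real"
    and c1 c2 \<gamma> l a M T :: real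
    and f0 \<eta> :: "real measure"
  assumes K_cont: "continuous_on ({0<..} \<times> {0<..}) (\<lambda>(x, y). K x y)"
    and K_nonneg: "\<And>x y. 0 < x \<Longrightarrow> 0 < y \<Longrightarrow> 0 \<le> K x y"
    and c: "0 < c1" "c1 \<le> c2"
    and exponents: "- l < 1" "\<gamma> + l < 1"
    and K_lower: "\<And>x y. 0 < x \<Longrightarrow> 0 < y \<Longrightarrow>
      c1 * (x powr (\<gamma> + l) * y powr (- l) + x powr (- l) * y powr (\<gamma> + l)) \<le> K x y"
    and K_upper: "\<And>x y. 0 < x \<Longrightarrow> 0 < y \<Longrightarrow>
      K x y \<le> c2 * (x powr (\<gamma> + l) * y powr (- l) + x powr (- l) * y powr (\<gamma> + l))"
    and a: "0 < a"
    and f0: "f0 \<in> bounded_radon_measures" "moment 1 f0 < \<infinity>" "measure_support f0 \<subseteq> {a..}"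
    and \<eta>: "\<eta> \<in> bounded_radon_measures" "moment 1 \<eta> < \<infinity>" "measure_support \<eta> \<subseteq> {a..M}"
    and T: "0 < T"
  shows "\<exists>f. coagulation_solution K \<gamma> l a T \<eta> f0 f"
proof -
  let ?k = "clamped_kernel K a"
  note k_def = clamped_kernel_def[OF K_cont a]
  let ?f0 = "distr f0 borel (\<lambda>x. x)" and ?\<eta> = "distr \<eta> borel (\<lambda>x. x)"
  have \<eta>3: "measure_support \<eta> \<subseteq> {a..}" using \<eta>(3) by auto
  have pos: "0 < max a x" for x using a by auto
  interpret sublinear_kernel ?k
  proof
    show "continuous_on UNIV (\<lambda>z. ?k (fst z) (snd z))" by (rule clamped_kernel_continuous[OF K_cont a])
    show "?k x y = ?k y x" "0 \<le> ?k x y" for x y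
      using K_nonneg[OF pos pos] by (simp_all add: k_def add.commute)
    fix e :: real assume e: "0 < e"
    \<comment> \<open>The upper bound on \<open>K\<close> consists of two monomials, each with both
      exponents below \<open>1\<close>; each receives half of the allowance \<open>e\<close>,
      divided by \<open>c2\<close>.\<close>
    define e' where "e' = e / (2 * c2)"
    have e': "0 < e'" "c2 * (e' + e') = e" using e c by (auto simp: e'_def)
    obtain R1 where R1: "0 \<le> R1" "\<And>x y. (max a x) powr (\<gamma> + l) * (max a y) powr (- l) \<le> R1 + e' * ((1 + \<bar>x\<bar>) * (1 + \<bar>y\<bar>))"
      using clamped_kernel_growth[OF a exponents(2,1) e'(1)] by blast
    obtain R2 where R2: "0 \<le> R2" "\<And>x y. (max a x) powr (- l) * (max a y) powr (\<gamma> + l) \<le> R2 + e' * ((1 + \<bar>x\<bar>) * (1 + \<bar>y\<bar>))"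
      using clamped_kernel_growth[OF a exponents(1,2) e'(1)] by blast
    have Kle: "K (max a x) (max a y) \<le> c2 * (R1 + R2) + e * ((1 + \<bar>x\<bar>) * (1 + \<bar>y\<bar>))" for x y
    proof -
      have "K (max a x) (max a y) \<le> c2 * ((max a x) powr (\<gamma> + l) * (max a y) powr (- l) + (max a x) powr (- l) * (max a y) powr (\<gamma> + l))"
        by (rule K_upper[OF pos pos])
      also have "\<dots> \<le> c2 * ((R1 + e' * ((1 + \<bar>x\<bar>) * (1 + \<bar>y\<bar>))) + (R2 + e' * ((1 + \<bar>x\<bar>) * (1 + \<bar>y\<bar>))))"
        using c by (intro mult_left_mono add_mono R1 R2) auto
      also have "\<dots> = c2 * (R1 + R2) + c2 * (e' + e') * ((1 + \<bar>x\<bar>) * (1 + \<bar>y\<bar>))" by algebra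
      finally show ?thesis unfolding e'(2) .
    qed
    have "?k x y \<le> c2 * (R1 + R2) + e * ((1 + \<bar>x\<bar>) * (1 + \<bar>y\<bar>))" for x y
      using Kle[of x y] Kle[of y x] unfolding k_def mult.commute[of "1 + \<bar>y\<bar>"] by simp
    then show "\<exists>R\<ge>0. \<forall>x y. ?k x y \<le> R + e * ((1 + \<bar>x\<bar>) * (1 + \<bar>y\<bar>))"
      using R1(1) R2(1) c by (intro exI[of _ "c2 * (R1 + R2)"]) auto
  qed
  note ext = extend_to_line(3)[OF f0] extend_to_line(3)[OF \<eta>(1,2) \<eta>3]
  interpret euler_scheme ?k a "\<integral>x. 1 + \<bar>x\<bar> \<partial>?f0" "\<integral>x. 1 + \<bar>x\<bar> \<partial>?\<eta>" T ?f0 ?\<eta>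
    by unfold_locales (use extend_to_line[OF f0] extend_to_line[OF \<eta>(1,2) \<eta>3] a T in auto)
  obtain D where D: "\<And>x y. ?k x y \<le> D * ((1 + \<bar>x\<bar>) * (1 + \<bar>y\<bar>))" using linear_growth by blast
  obtain w where w: "\<And>t. t \<in> {0..T} \<Longrightarrow> moment_le mass_bound (w t)" "\<And>t. t \<in> {0..T} \<Longrightarrow> measure (w t) {..<a} = 0"
    and wc: "\<And>\<psi> :: real \<Rightarrow>\<^sub>C real. continuous_on {0..T} (\<lambda>t. \<integral>x. apply_bcontfun \<psi> x \<partial>w t)"
    and weq: "\<And>(\<phi> :: real \<Rightarrow> real \<Rightarrow>\<^sub>C real) \<phi>' t. (\<forall>t\<in>{0..T}. (\<phi> has_vector_derivative \<phi>' t) (at t within {0..T})) \<Longrightarrow>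
      continuous_on {0..T} \<phi>' \<Longrightarrow> t \<in> {0..T} \<Longrightarrow>
      (\<integral>x. apply_bcontfun (\<phi> t) x \<partial>w t) - (\<integral>x. apply_bcontfun (\<phi> 0) x \<partial>?f0) =
        (LINT s:{0..t}|lborel. (\<integral>x. apply_bcontfun (\<phi>' s) x \<partial>w s)) + (LINT s:{0..t}|lborel. coag_form ?k (w s) (apply_bcontfun (\<phi> s)))
        + (LINT s:{0..t}|lborel. (\<integral>x. apply_bcontfun (\<phi> s) x \<partial>?\<eta>))"
    using weak_solution_exists by blast
  define f where "f t = clamp_measure a (w t)" for t
  have int: "(\<integral>x. apply_bcontfun \<psi> x \<partial>f t) = (\<integral>x. apply_bcontfun \<psi> x \<partial>w t)" if "t \<in> {0..T}" for t and \<psi> :: "real \<Rightarrow>\<^sub>C real"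
  proof -
    have "apply_bcontfun \<psi> \<in> borel_measurable borel"
      by (intro borel_measurable_continuous_onI continuous_on_apply_bcontfun)
    from integral_clamp[OF a w[OF that] this] show ?thesis unfolding f_def by simp
  qed
  have mom: "moment p (f t) \<le> ennreal (a powr (p - 1) * (a + 1) * mass_bound)" if "p \<le> 1" "t \<in> {0..T}" for p t
    unfolding f_def by (rule moment_clamp[OF a w[OF that(2)] that(1)])
  have mom_int: "(\<integral>\<^sup>+t\<in>{0..T}. moment p (f t) \<partial>lborel) < \<infinity>" if "p \<le> 1" for p
  proof -
    have "(\<integral>\<^sup>+t\<in>{0..T}. moment p (f t) \<partial>lborel) \<le> (\<integral>\<^sup>+t\<in>{0..T}. ennreal (a powr (p - 1) * (a + 1) * mass_bound) \<partial>lborel)"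
      using mom[OF that] by (intro nn_integral_mono) (auto simp: indicator_def)
    also have "\<dots> < \<infinity>" using T by (simp add: nn_integral_cmult_indicator ennreal_mult_less_top)
    finally show ?thesis .
  qed
  have "coagulation_solution K \<gamma> l a T \<eta> f0 f"
    unfolding coagulation_solution_def
  proof (intro conjI allI impI ballI)
    show "weak_star_continuous_on {0..T} f"
      unfolding weak_star_continuous_on_def
    proof (intro conjI ballI)
      show "f t \<in> bounded_radon_measures" if "t \<in> {0..T}" for t
        unfolding f_def by (rule clamp_measure_bounded[OF a w[OF that]])
      show "continuous_on {0..T} (\<lambda>t. \<integral>x. apply_bcontfun \<psi> x \<partial>f t)" for \<psi> :: "real \<Rightarrow>\<^sub>C real"
        using wc[of \<psi>] by (rule continuous_on_eq) (simp add: int)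
    qed
    have "(SUP t\<in>{0..T}. moment 1 (f t)) \<le> ennreal (a powr (1 - 1) * (a + 1) * mass_bound)"
      using mom[of 1] by (intro SUP_least) simp
    then show "(SUP t\<in>{0..T}. moment 1 (f t)) < \<infinity>" by (rule le_less_trans) simp
    show "(\<integral>\<^sup>+t\<in>{0..T}. moment (- l) (f t) \<partial>lborel) < \<infinity>" "(\<integral>\<^sup>+t\<in>{0..T}. moment (\<gamma> + l) (f t) \<partial>lborel) < \<infinity>"
      using mom_int exponents by auto
    show "measure_support (f t) \<subseteq> {a..}" if "t \<in> {0..T}" for t
      unfolding f_def by (rule support_clamp[OF a w[OF that]])
    fix \<phi> \<phi>' :: "real \<Rightarrow> real \<Rightarrow>\<^sub>C real" and t
    assume C1: "C1_Cc T \<phi> \<phi>'" and t: "t \<in> {0..T}"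
    have sub: "s \<in> {0..T}" if "s \<in> {0..t}" for s using that t by auto
    \<comment> \<open>The set integral only sees times in \<open>{0..t}\<close>, where the passage
      between \<open>f\<close> and \<open>w\<close> is available.\<close>
    have t1: "(LINT s:{0..t}|lborel. (\<integral>x. \<phi>' s x \<partial>f s)) = (LINT s:{0..t}|lborel. (\<integral>x. \<phi>' s x \<partial>w s))"
      by (rule set_lebesgue_integral_cong) (simp, intro allI impI int sub)
    have "(LINT s:{0..t}|lborel. (\<integral>y. (\<integral>x. (\<phi> s (x + y) - \<phi> s x - \<phi> s y) * K x y \<partial>f s) \<partial>f s))
        = (LINT s:{0..t}|lborel. 2 * coag_form ?k (w s) (\<phi> s))"
      unfolding f_def
      by (rule set_lebesgue_integral_cong)
        (simp, intro allI impI integral_clamp_coag_form[OF K_cont a w K_nonneg D] sub)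
    then have t2: "1 / 2 * (LINT s:{0..t}|lborel. (\<integral>y. (\<integral>x. (\<phi> s (x + y) - \<phi> s x - \<phi> s y) * K x y \<partial>f s) \<partial>f s))
        = (LINT s:{0..t}|lborel. coag_form ?k (w s) (\<phi> s))"
      by simp
    show "(\<integral>x. \<phi> t x \<partial>f t) - (\<integral>x. \<phi> 0 x \<partial>f0) =
          (LINT s:{0..t}|lborel. (\<integral>x. \<phi>' s x \<partial>f s))
          + 1 / 2 * (LINT s:{0..t}|lborel.
              (\<integral>y. (\<integral>x. (\<phi> s (x + y) - \<phi> s x - \<phi> s y) * K x y \<partial>f s) \<partial>f s))
          + (LINT s:{0..t}|lborel. (\<integral>x. \<phi> s x \<partial>\<eta>))"
      unfolding t1 t2 int[OF t] ext[symmetric]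
      by (rule weq[OF _ _ t]) (use C1 in \<open>auto simp: C1_Cc_def\<close>)
  qed
  then show ?thesis by (rule exI[of _ f])
qed

end
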